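(* Let $\sigma$ be a partition of the set of all primes, let $G$ be a finite $\sigma$-soluble group and let $\mathcal{H}$ be a complete Hall $\sigma$-set of $G$. Then the following statements hold. (i) If $G$ is soluble but not $\sigma$-nilpotent and $r\in\mathbb{N}$ is such that $r(H)\leq r$ for all $H\in\mathcal{H}$, then $r(G)\leq m_{\sigma q}(G)+r-2$. (ii) $l_{\sigma}(G)\leq m_{\sigma}(G)$. (iii) If $G$ is soluble but not $\sigma$-nilpotent, then $|\pi(G)|\leq m_{\sigma}(G)$.
   Context: All groups are finite. $\sigma=\{\sigma_i\mid i\in I\}$, $I\subseteq\mathbb{N}$, is a partition of the set $\mathbb{P}$ of all primes: $\mathbb{P}=\bigcup_{i\in I}\sigma_i$ and $\sigma_i\cap\sigma_j=\emptyset$ for $i\neq j$. For an integer $n$, $\pi(n)$ is the set of primes dividing $|n|$ and $\sigma(n)=\{\sigma_i\mid\sigma_i\cap\pi(n)\neq\emptyset\}$; $\pi(G)=\pi(|G|)$ and $\sigma(G)=\sigma(|G|)$. $G$ is $\sigma$-primary if $|\sigma(G)|\leq 1$ (i.e. $G$ is a $\sigma_i$-group for some $i$); $\sigma$-nilpotent if $G$ is a direct product of some $\sigma$-primary groups; $\sigma$-soluble if every chief factor of $G$ is $\sigma$-primary. For $\sigma$-soluble $G$, the $\sigma$-nilpotent length $l_\sigma(G)$ is the length of the shortest normal chain of $G$ with $\sigma$-nilpotent factors. The rank $r(G)$ of a soluble group $G$ is the maximal integer $k$ such that $G$ has a chief factor of order $p^k$ for some prime $p$. A complete Hall $\sigma$-set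 of $G$ is a set $\mathcal{H}$ of subgroups of $G$ such that every member $\neq 1$ of $\mathcal{H}$ is a Hall $\sigma_i$-subgroup of $G$ for some $i\in I$ and $\mathcal{H}$ contains exactly one Hall $\sigma_i$-subgroup of $G$ for every $\sigma_i\in\sigma(G)$. A subgroup $H$ of $G$ is $\sigma$-quasinormal (or $\sigma$-permutable) in $G$ if $G$ possesses a complete Hall $\sigma$-set $\mathcal{H}$ such that $HA^x=A^xH$ for all $A\in\mathcal{H}$ and all $x\in G$. A subgroup $A$ of $G$ is $\sigma$-subnormal in $G$ if there is a subgroup chain $A=A_0\leq A_1\leq\cdots\leq A_t=G$ such that for each $i=1,\ldots,t$ either $A_{i-1}\trianglelefteq A_i$ or $A_i/(A_{i-1})_{A_i}$ is $\sigma$-primary, where $(A_{i-1})_{A_i}$ is the largest normal subgroup of $A_i$ contained in $A_{i-1}$. If $M_n<M_{n-1}<\cdots<M_1<M_0=G$ with $M_i$ a maximal subgroup of $M_{i-1}$ for all $i=1,\ldots,n$ ($n>0$), then $M_n$ is called an $n$-maximal subgroup of $G$. One writes $m_\sigma(G)=n$ (respectively $m_{\sigma q}(G)=n$) if each $n$-maximal subgroup of $G$ is $\sigma$-subnormal (respectively $\sigma$-quasinormal) in $G$ but, in the case $n>1$, some $(n-1)$-maximal subgroup is not $\sigma$-subnormal (respectively not $\sigma$-quasinormal) in $G$. *)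

theory Defs
  imports
    "HOL-Algebra.Algebra"
    "HOL-Computational_Algebra.Primes"
    "HOL-Library.Disjoint_Sets"
begin

text \<open>
  A partition \<open>\<sigma>\<close> of the set of all primes is a set \<open>\<sigma> :: nat set set\<close> with
  \<^term>\<open>partition_on {p::nat. Factorial_Ring.prime p} \<sigma>\<close>; the indexing of its blocks is immaterial.
  A subgroup \<open>H\<close> of \<open>G\<close> is a carrier set; as a group in its own right it is
  \<open>G\<lparr>carrier := H\<rparr>\<close>.
\<close>

definition sigma_of :: "nat set set \<Rightarrow> nat \<Rightarrow> nat set set" where
  "sigma_of \<sigma> n = {s \<in> \<sigma>. s \<inter> prime_factors n \<noteq> {}}"

text \<open>
  Finiteness has to be demanded explicitly below: an infinite group has \<^term>\<open>order G = 0\<close>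
  and would otherwise count as \<open>\<sigma>\<close>-primary.
\<close>

definition sigma_primary :: "nat set set \<Rightarrow> ('a, 'b) monoid_scheme \<Rightarrow> bool" where
  "sigma_primary \<sigma> G \<longleftrightarrow> finite (carrier G) \<and> card (sigma_of \<sigma> (order G)) \<le> 1"

text \<open>
  The factors live on the element type of \<open>G\<close>; this is no restriction, since every direct
  factor is isomorphic to a subgroup of \<open>G\<close>.
\<close>

definition sigma_nilpotent :: "nat set set \<Rightarrow> ('a, 'b) monoid_scheme \<Rightarrow> bool" where
  "sigma_nilpotent \<sigma> G \<longleftrightarrow>
    (\<exists>(J :: nat set) (K :: nat \<Rightarrow> 'a monoid). finite J \<and>
      (\<forall>j\<in>J. group (K j) \<and> sigma_primary \<sigma> (K j)) \<and> G \<cong> product_group J K)"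

definition chief_factor :: "('a, 'b) monoid_scheme \<Rightarrow> 'a set \<Rightarrow> 'a set \<Rightarrow> bool" where
  "chief_factor G H K \<longleftrightarrow> H \<lhd> G \<and> K \<lhd> G \<and> K \<subset> H \<and>
    \<not> (\<exists>L. L \<lhd> G \<and> K \<subset> L \<and> L \<subset> H)"

definition sigma_soluble :: "nat set set \<Rightarrow> ('a, 'b) monoid_scheme \<Rightarrow> bool" where
  "sigma_soluble \<sigma> G \<longleftrightarrow>
    (\<forall>H K. chief_factor G H K \<longrightarrow> sigma_primary \<sigma> ((G\<lparr>carrier := H\<rparr>) Mod K))"

text \<open>A normal chain consists of normal subgroups of the whole group.\<close>

definition sigma_nilpotent_chain ::
    "nat set set \<Rightarrow> ('a, 'b) monoid_scheme \<Rightarrow> (nat \<Rightarrow> 'a set) \<Rightarrow> nat \<Rightarrow> bool" where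
  "sigma_nilpotent_chain \<sigma> G A t \<longleftrightarrow>
    A 0 = {\<one>\<^bsub>G\<^esub>} \<and> A t = carrier G \<and> (\<forall>i\<le>t. A i \<lhd> G) \<and>
    (\<forall>i<t. A i \<subseteq> A (Suc i) \<and> sigma_nilpotent \<sigma> ((G\<lparr>carrier := A (Suc i)\<rparr>) Mod A i))"

definition sigma_nilpotent_length :: "nat set set \<Rightarrow> ('a, 'b) monoid_scheme \<Rightarrow> nat" where
  "sigma_nilpotent_length \<sigma> G = (LEAST t. \<exists>A. sigma_nilpotent_chain \<sigma> G A t)"

text \<open>On \<open>nat\<close>, \<open>Sup\<close> is the maximum of a finite nonempty set, and 0 for the trivial group,
  which has no chief factors.\<close>

definition rank :: "('a, 'b) monoid_scheme \<Rightarrow> nat" where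
  "rank G = Sup {k. \<exists>H K p. chief_factor G H K \<and> Factorial_Ring.prime (p::nat) \<and>
    order ((G\<lparr>carrier := H\<rparr>) Mod K) = p ^ k}"

definition Hall_subgroup :: "nat set \<Rightarrow> ('a, 'b) monoid_scheme \<Rightarrow> 'a set \<Rightarrow> bool" where
  "Hall_subgroup s G H \<longleftrightarrow> subgroup H G \<and> prime_factors (card H) \<subseteq> s \<and>
    prime_factors (card (rcosets\<^bsub>G\<^esub> H)) \<inter> s = {}"

definition complete_Hall_set ::
    "nat set set \<Rightarrow> ('a, 'b) monoid_scheme \<Rightarrow> 'a set set \<Rightarrow> bool" where
  "complete_Hall_set \<sigma> G \<H> \<longleftrightarrow>
    (\<forall>A\<in>\<H>. subgroup A G) \<and>
    (\<forall>A\<in>\<H>. A \<noteq> {\<one>\<^bsub>G\<^esub>} \<longrightarrow> (\<exists>s\<in>\<sigma>. Hall_subgroup s G A)) \<and>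
    (\<forall>s \<in> sigma_of \<sigma> (order G). \<exists>!A. A \<in> \<H> \<and> Hall_subgroup s G A)"

definition conjugate :: "('a, 'b) monoid_scheme \<Rightarrow> 'a set \<Rightarrow> 'a \<Rightarrow> 'a set" where
  "conjugate G A x = inv\<^bsub>G\<^esub> x <#\<^bsub>G\<^esub> A #>\<^bsub>G\<^esub> x"

definition sigma_quasinormal ::
    "nat set set \<Rightarrow> ('a, 'b) monoid_scheme \<Rightarrow> 'a set \<Rightarrow> bool" where
  "sigma_quasinormal \<sigma> G H \<longleftrightarrow> subgroup H G \<and>
    (\<exists>\<H>. complete_Hall_set \<sigma> G \<H> \<and>
      (\<forall>A\<in>\<H>. \<forall>x\<in>carrier G. H <#>\<^bsub>G\<^esub> conjugate G A x = conjugate G A x <#>\<^bsub>G\<^esub> H))"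

definition core :: "('a, 'b) monoid_scheme \<Rightarrow> 'a set \<Rightarrow> 'a set" where
  "core G A = (GREATEST N. N \<lhd> G \<and> N \<subseteq> A)"

definition sigma_subnormal ::
    "nat set set \<Rightarrow> ('a, 'b) monoid_scheme \<Rightarrow> 'a set \<Rightarrow> bool" where
  "sigma_subnormal \<sigma> G B \<longleftrightarrow>
    (\<exists>t A. A 0 = B \<and> A t = carrier G \<and> (\<forall>i\<le>t. subgroup (A i) G) \<and>
      (\<forall>i<t. A i \<subseteq> A (Suc i) \<and>
        (let T = G\<lparr>carrier := A (Suc i)\<rparr>
         in A i \<lhd> T \<or> sigma_primary \<sigma> (T Mod core T (A i)))))"

definition maximal_subgroup :: "('a, 'b) monoid_scheme \<Rightarrow> 'a set \<Rightarrow> bool" where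
  "maximal_subgroup G M \<longleftrightarrow> subgroup M G \<and> M \<subset> carrier G \<and>
    \<not> (\<exists>L. subgroup L G \<and> M \<subset> L \<and> L \<subset> carrier G)"

text \<open>Only \<open>n > 0\<close> is meaningful; the case \<open>n = 0\<close> merely starts the chain at \<open>G\<close>.\<close>

primrec n_maximal :: "('a, 'b) monoid_scheme \<Rightarrow> nat \<Rightarrow> 'a set \<Rightarrow> bool" where
  "n_maximal G 0 M \<longleftrightarrow> M = carrier G"
| "n_maximal G (Suc n) M \<longleftrightarrow>
    (\<exists>L. n_maximal G n L \<and> maximal_subgroup (G\<lparr>carrier := L\<rparr>) M)"

text \<open>
  The defining condition shared by \<open>m\<^sub>\<sigma>(G) = n\<close> and \<open>m\<^sub>\<sigma>\<^sub>q(G) = n\<close>, for an arbitrary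
  property \<open>P\<close> of subgroups.
\<close>

definition n_maximal_threshold ::
    "('a set \<Rightarrow> bool) \<Rightarrow> ('a, 'b) monoid_scheme \<Rightarrow> nat \<Rightarrow> bool" where
  "n_maximal_threshold P G n \<longleftrightarrow> n > 0 \<and> (\<forall>M. n_maximal G n M \<longrightarrow> P M) \<and>
    (n > 1 \<longrightarrow> (\<exists>M. n_maximal G (n - 1) M \<and> \<not> P M))"

text \<open>
  For finite \<open>G\<close> such an \<open>n\<close> exists, because there are no \<open>n\<close>-maximal subgroups for large \<open>n\<close>.
  The condition does not by itself make \<open>n\<close> unique; the least one is taken, so that an upper
  bound by \<open>m_sigma\<close> or \<open>m_sigma_q\<close> is one by every \<open>n\<close> satisfying the condition.
\<close>

definition m_sigma :: "nat set set \<Rightarrow> ('a, 'b) monoid_scheme \<Rightarrow> nat" where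
  "m_sigma \<sigma> G = (LEAST n. n_maximal_threshold (sigma_subnormal \<sigma> G) G n)"

definition m_sigma_q :: "nat set set \<Rightarrow> ('a, 'b) monoid_scheme \<Rightarrow> nat" where
  "m_sigma_q \<sigma> G = (LEAST n. n_maximal_threshold (sigma_quasinormal \<sigma> G) G n)"

end

theory Submission
  imports Defs
begin

text \<open>
  For a block \<open>s\<close> of \<open>\<sigma>\<close> let \<open>O\<^sup>s(L)\<close> be generated by the elements of \<open>L\<close> of order prime to \<open>s\<close>, and let
  \<open>D(L)\<close> be the intersection of all \<open>O\<^sup>s(L)\<close>; this residual is monotone in \<open>L\<close>, and \<open>L/D(L)\<close> is
  \<open>\<sigma>\<close>-nilpotent.  If every maximal subgroup \<open>M\<close> of \<open>L\<close> is \<open>\<sigma>\<close>-subnormal or \<open>\<sigma>\<close>-quasinormal in \<open>G\<close>,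
  then each \<open>M\<close> contains some \<open>O\<^sup>s(L)\<close>, so \<open>D(L)\<close> lies in the Frattini subgroup of \<open>L\<close>, and a minimal normal
  quotient of \<open>D(L)\<close> would have a complement in \<open>O\<^sup>s(L)\<close>, against the Frattini argument; hence \<open>D(L) = 1\<close>.
  Thus, if all \<open>n\<close>-maximal subgroups satisfy the condition, all \<open>(n-1)\<close>-maximal ones have trivial residual.

  For the nilpotent length, a proper normal subgroup of \<open>L\<close> with \<open>\<sigma>\<close>-primary quotient lies in a maximal
  subgroup, so by induction \<open>n\<close> iterations of \<open>D\<close> reach the identity.  For the number of primes, descend
  through maximal subgroups with nontrivial residual, whose index is a prime power in the soluble case, down to a
  group all of whose maximal subgroups have trivial residual; such a group has at most two primes.
  For the rank, let \<open>R/K\<close> be a chief factor of order \<open>p\<^sup>c\<close> with \<open>c\<close> too large and let \<open>H\<close> be the Hall subgroup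
  for the block of \<open>p\<close>.  A chief factor of \<open>H\<close> provides an \<open>H\<close>-invariant group \<open>V\<close> with \<open>K < V \<le> R\<close> and
  \<open>|V/K| \<le> p\<^sup>r\<close>, and the permutability of the \<open>n\<close>-maximal subgroups makes \<open>V\<close> invariant under all elements of
  order prime to the block as well, so that \<open>V\<close> would be a proper \<open>G\<close>-invariant subgroup between \<open>K\<close> and \<open>R\<close>.
\<close>

section \<open>Elements and subgroups of finite groups\<close>

text \<open>The residual stands in for \<sigma>-nilpotency because it is monotone: triviality passes
  to subgroups by plain inclusion, with no theorem on subgroups of direct products. Direct products
  occur only where a chain for the nilpotent length is built and where trivial residual of G is
  turned into \<sigma>-nilpotency; the converse implication never occurs. The constants come from
  one shift. If n = Suc k and all n-maximal subgroups are good, residuals are trivial from the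
  k-maximal subgroups on, and k > 0 when G is not \<sigma>-nilpotent. For the rank, read R/K as a
  space of dimension c over the field with p elements. If c \<ge> k + r, a subspace of dimension at
  most r has codimension at least k. The hypothesis on n-maximal subgroups controls the subspaces of
  one codimension d with 0 < d \<le> k, and every subspace of larger codimension is an intersection
  of those. So c \<le> k + r - 1 = n + r - 2.\<close>

definition pi_num :: "nat set \<Rightarrow> nat \<Rightarrow> bool" where
  "pi_num s n \<longleftrightarrow> n > 0 \<and> (\<forall>p. Factorial_Ring.prime p \<longrightarrow> p dvd n \<longrightarrow> p \<in> s)"

text \<open>Stated by powers rather than by \<open>ord\<close>, so that it is literally the same in every subgroup.\<close>

definition pi_elt :: "('a, 'b) monoid_scheme \<Rightarrow> nat set \<Rightarrow> 'a \<Rightarrow> bool" where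
  "pi_elt G s x \<longleftrightarrow> (\<exists>m. pi_num s m \<and> x [^]\<^bsub>G\<^esub> m = \<one>\<^bsub>G\<^esub>)"

lemma pi_num_pos: "pi_num s n \<Longrightarrow> n > 0"
  by (simp add: pi_num_def)

lemma pi_num_1 [simp]: "pi_num s 1" "pi_num s (Suc 0)"
  by (auto simp: pi_num_def)

lemma pi_num_mult: "pi_num s (a * b) \<longleftrightarrow> pi_num s a \<and> pi_num s b"
  by (auto simp: pi_num_def prime_dvd_mult_iff)

lemma pi_num_power: "pi_num s a \<Longrightarrow> pi_num s (a ^ k)"
  by (induction k) (auto simp: pi_num_mult)

lemma pi_num_prime: "Factorial_Ring.prime p \<Longrightarrow> pi_num s p \<longleftrightarrow> p \<in> s"
  unfolding pi_num_def using prime_gt_0_nat primes_dvd_imp_eq dvd_refl by metis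

lemma pi_num_prime_power:
  "Factorial_Ring.prime p \<Longrightarrow> p \<in> s \<Longrightarrow> pi_num s (p ^ k)"
  by (simp add: pi_num_power pi_num_prime)

lemma pi_num_dvd: "pi_num s n \<Longrightarrow> m dvd n \<Longrightarrow> pi_num s m"
  by (auto simp: pi_num_mult elim!: dvdE)

lemma pi_num_mono: "pi_num s n \<Longrightarrow> s \<subseteq> t \<Longrightarrow> pi_num t n"
  by (auto simp: pi_num_def)

lemma pi_num_coprime: "pi_num s m \<Longrightarrow> pi_num (-s) n \<Longrightarrow> coprime m n"
  unfolding pi_num_def
  by (metis ComplD bot_nat_0.not_eq_extremum coprime_iff_gcd_eq_1 gcd_dvd1 gcd_dvd2 dvd_trans prime_factor_nat)

lemma pi_num_both: "pi_num s m \<Longrightarrow> pi_num (-s) m \<Longrightarrow> m = 1"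
  using pi_num_coprime[of s m m] by simp

lemma pi_num_split:
  assumes "n > 0"
  obtains a b where "n = a * b" "pi_num s a" "pi_num (-s) b"
proof -
  have "n > 0 \<Longrightarrow> \<exists>a b. n = a * b \<and> pi_num s a \<and> pi_num (-s) b" for n
  proof (induction n rule: prime_divisors_induct)
    case (factor p x)
    hence p: "Factorial_Ring.prime p" "x > 0" by auto
    then obtain a b where ab: "x = a * b" "pi_num s a" "pi_num (-s) b"
      using factor by blast
    show ?case
    proof (cases "p \<in> s")
      case True
      thus ?thesis using ab p by (intro exI[of _ "p * a"] exI[of _ b]) (simp add: pi_num_mult pi_num_prime)
    next
      case False
      thus ?thesis using ab p by (intro exI[of _ a] exI[of _ "p * b"]) (simp add: pi_num_mult pi_num_prime)
    qed
  qed (auto intro: exI[of _ 1])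
  thus ?thesis using assms that by blast
qed

lemma pi_num_singleton_power:
  assumes "pi_num {p} n" "Factorial_Ring.prime p"
  obtains k where "n = p ^ k"
proof -
  have "n \<noteq> 0" "\<not> is_unit p" using assms by (auto simp: pi_num_def)
  then obtain y where y: "n = p ^ multiplicity p n * y" "\<not> p dvd y"
    using multiplicity_decompose' by blast
  have "y = 1"
  proof (rule ccontr)
    assume "y \<noteq> 1"
    then obtain q where q: "Factorial_Ring.prime q" "q dvd y" using prime_factor_nat by blast
    hence "q dvd n" using y(1) by (metis dvd_mult)
    thus False using q y(2) assms unfolding pi_num_def by blast
  qed
  thus ?thesis using y that by simp
qed

lemma pi_num_compl_singleton:
  "Factorial_Ring.prime p \<Longrightarrow> pi_num (-{p}) n \<longleftrightarrow> n > 0 \<and> \<not> p dvd n"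
  by (auto simp: pi_num_def)

lemma pi_elt_consistent [simp]: "pi_elt (G\<lparr>carrier := H\<rparr>) s = pi_elt G s"
  by (simp add: pi_elt_def fun_eq_iff nat_pow_def)

lemma pi_elt_mono: "pi_elt G s x \<Longrightarrow> s \<subseteq> t \<Longrightarrow> pi_elt G t x"
  unfolding pi_elt_def using pi_num_mono by blast

section \<open>Powers of elements and their splitting along a set of primes\<close>

context group
begin

lemma cancel_inv_left:
  "x \<in> carrier G \<Longrightarrow> y \<in> carrier G \<Longrightarrow> inv x \<otimes> (x \<otimes> y) = y"
  "x \<in> carrier G \<Longrightarrow> y \<in> carrier G \<Longrightarrow> x \<otimes> (inv x \<otimes> y) = y"
  by (simp_all add: m_assoc[symmetric])

lemmas group_simps = m_assoc inv_mult_group cancel_inv_left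

lemma pi_elt_pow: 
  assumes "x \<in> carrier G" "pi_elt G s x" shows "pi_elt G s (x [^] (k::nat))"
proof -
  obtain m where m: "pi_num s m" "x [^] m = \<one>" using assms(2) unfolding pi_elt_def by blast
  have "(x [^] k) [^] m = (x [^] m) [^] k" using assms(1) by (simp add: nat_pow_pow mult.commute)
  thus ?thesis using m unfolding pi_elt_def by auto
qed

text \<open>The integers m with x^m in H form a subgroup of the integers, and Bezout makes its
  closure under gcd explicit. This does the work that orders of elements modulo H would do.\<close>

lemma pow_gcd_mem:
  fixes a b :: nat
  assumes H: "subgroup H G" and x: "x \<in> carrier G" and a: "x [^] a \<in> H" and b: "x [^] b \<in> H"
  shows "x [^] gcd a b \<in> H"
proof -
  obtain u v where uv: "u * int a + v * int b = int (gcd a b)"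
    using bezout_int[of "int a" "int b"] by auto
  have "x [^] int (gcd a b) = (x [^] int a) [^] u \<otimes> (x [^] int b) [^] v"
    using x by (simp add: uv[symmetric] int_pow_mult int_pow_pow mult.commute)
  moreover have "x [^] int a \<in> H" "x [^] int b \<in> H" using a b by (simp_all add: int_pow_int)
  ultimately have "x [^] int (gcd a b) \<in> H"
    using H by (simp add: subgroup.m_closed subgroup_int_pow_closed)
  thus ?thesis by (simp only: int_pow_int)
qed

text \<open>The order of x is prime to m, so x is a power of x^m. A typical m is the index of a
  normal subgroup H.\<close>

lemma pi_elt_mem:
  assumes "subgroup H G" "x \<in> carrier G" "pi_elt G s x" "x [^] (m::nat) \<in> H" "pi_num (-s) m"
  shows "x \<in> H"
proof -
  obtain k where k: "pi_num s k" "x [^] k = \<one>" using assms(3) unfolding pi_elt_def by blast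
  have "x [^] gcd k m \<in> H"
    using pow_gcd_mem[OF assms(1,2), of k m] assms(1,4) k by (simp add: subgroup.one_closed)
  moreover have "gcd k m = 1" using pi_num_coprime[OF k(1) assms(5)] by simp
  ultimately show ?thesis using assms(2) by simp
qed

lemma pi_elt_both:
  assumes "x \<in> carrier G" "pi_elt G s x" "pi_elt G (-s) x" shows "x = \<one>"
proof -
  obtain k where "pi_num (-s) k" "x [^] k = \<one>" using assms(3) unfolding pi_elt_def by blast
  hence "x \<in> {\<one>}" using pi_elt_mem[OF triv_subgroup assms(1,2), of k] by auto
  thus ?thesis by simp
qed

lemma subgroup_nat_pow: "subgroup H G \<Longrightarrow> x \<in> H \<Longrightarrow> x [^] (n::nat) \<in> H"
  by (induction n) (auto simp: subgroup.one_closed subgroup.m_closed)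

lemma pi_elt_split:
  assumes "finite (carrier G)" "x \<in> carrier G"
  obtains i j :: nat where "x = x [^] i \<otimes> x [^] j" "pi_elt G s (x [^] i)" "pi_elt G (-s) (x [^] j)"
    "\<And>m::nat. x [^] m = (x [^] i) [^] m \<otimes> (x [^] j) [^] m"
proof -
  have "order G > 0" using assms(1) by (simp add: order_gt_0_iff_finite)
  then obtain a b where ab: "order G = a * b" "pi_num s a" "pi_num (-s) b"
    using pi_num_split by blast
  have "coprime b a" using pi_num_coprime[of "s" a b] ab by (simp add: coprime_commute)
  hence "\<exists>u v. b * u = a * v + 1" 
    using bezout_nat[of b a] pi_num_pos[OF ab(3)] by (auto simp: coprime_iff_gcd_eq_1)
  then obtain u v where uv: "b * u = a * v + 1" by blast
  \<comment> \<open>\<open>w\<close> is \<open>-a * v\<close> modulo the order of G, with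
    \<open>order G - 1\<close> in place of -1 so that the exponent stays natural.\<close>
  define w where "w = a * v * (order G - 1)"
  have xo: "x [^] order G = \<one>" using pow_order_eq_1[OF assms(2)] .
  have o1: "order G = Suc (order G - 1)" using \<open>order G > 0\<close> by simp
  have "x [^] (b * u) \<otimes> x [^] w = x [^] (b * u + w)" using assms(2) by (simp add: nat_pow_mult)
  also have "b * u + w = order G * (a * v) + 1"
    unfolding w_def uv by (subst o1) (simp add: algebra_simps)
  also have "x [^] (order G * (a * v) + 1) = x" 
    using assms(2) xo by (simp add: nat_pow_mult[symmetric] nat_pow_pow[symmetric])
  finally have 1: "x = x [^] (b * u) \<otimes> x [^] w" by simp
  have "(x [^] (b * u)) [^] a = (x [^] order G) [^] u"
    using assms(2) ab(1) by (simp add: nat_pow_pow algebra_simps)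
  hence 2: "pi_elt G s (x [^] (b * u))" unfolding pi_elt_def using ab xo by auto
  have "(x [^] w) [^] b = (x [^] order G) [^] (v * (order G - 1))"
    unfolding w_def using assms(2) ab(1) by (simp add: nat_pow_pow algebra_simps)
  hence 3: "pi_elt G (-s) (x [^] w)" unfolding pi_elt_def using ab xo by auto
  have "x [^] m = (x [^] (b * u)) [^] m \<otimes> (x [^] w) [^] m" for m :: nat
    by (subst 1, rule pow_mult_distrib) (use assms(2) in \<open>auto simp: nat_pow_mult add.commute\<close>)
  thus ?thesis using that 1 2 3 by blast
qed

lemma conj_pow:
  assumes "x \<in> carrier G" "g \<in> carrier G"
  shows "(g \<otimes> x \<otimes> inv g) [^] (n::nat) = g \<otimes> x [^] n \<otimes> inv g"
proof (induction n)
  case (Suc n)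
  thus ?case using assms by (simp add: group_simps)
qed (use assms in simp)

lemma pi_elt_conj:
  assumes "x \<in> carrier G" "g \<in> carrier G" "pi_elt G s x"
  shows "pi_elt G s (g \<otimes> x \<otimes> inv g)"
  using assms conj_pow unfolding pi_elt_def by fastforce

lemma pi_elt_of_card:
  assumes "subgroup H G" "finite (carrier G)" "pi_num s (card H)" "x \<in> H"
  shows "pi_elt G s x"
proof -
  interpret H: group "G\<lparr>carrier := H\<rparr>" using assms(1) subgroup_imp_group by blast
  have "x [^]\<^bsub>G\<lparr>carrier := H\<rparr>\<^esub> order (G\<lparr>carrier := H\<rparr>) = \<one>\<^bsub>G\<lparr>carrier := H\<rparr>\<^esub>"
    by (rule H.pow_order_eq_1) (use assms in auto)
  hence "x [^] card H = \<one>" by (simp add: order_def nat_pow_def)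
  thus ?thesis using assms(3) unfolding pi_elt_def by blast
qed

section \<open>Counting: Cauchy, Lagrange and Sylow\<close>

lemma Cauchy:
  assumes "finite (carrier G)" "Factorial_Ring.prime p" "p dvd order G"
  obtains x where "x \<in> carrier G" "x \<noteq> \<one>" "x [^] p = \<one>"
proof -
  obtain m where "order G = p ^ 1 * m" using assms(3) by auto
  then obtain H where H: "subgroup H G" "card H = p ^ 1"
    using sylow_thm[OF assms(2) group_axioms _ assms(1), of 1 m] by blast
  have "card H > 1" using H assms(2) prime_gt_1_nat by simp
  hence "\<not> H \<subseteq> {\<one>}" using card_mono[of "{\<one>}" H] by auto
  then obtain x where x: "x \<in> H" "x \<noteq> \<one>" by blast
  interpret H: group "G\<lparr>carrier := H\<rparr>" using H(1) subgroup_imp_group by blast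
  have "x [^]\<^bsub>G\<lparr>carrier := H\<rparr>\<^esub> order (G\<lparr>carrier := H\<rparr>) = \<one>\<^bsub>G\<lparr>carrier := H\<rparr>\<^esub>"
    by (rule H.pow_order_eq_1) (use x in auto)
  hence "x [^] p = \<one>" using H by (simp add: order_def nat_pow_def)
  thus ?thesis using that x subgroup.mem_carrier[OF H(1)] by blast
qed

text \<open>By Cauchy, a prime divisor of |H| outside s would give a nontrivial element that is both
  an s-element and an s'-element.\<close>

lemma pi_num_card_of_pi_elt:
  assumes "subgroup H G" "finite (carrier G)" "\<And>x. x \<in> H \<Longrightarrow> pi_elt G s x"
  shows "pi_num s (card H)"
  unfolding pi_num_def
proof (intro conjI allI impI)
  have fH: "finite H" using finite_subset[OF subgroup.subset[OF assms(1)] assms(2)] .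
  show "0 < card H" using subgroup.finite_imp_card_positive[OF assms(1,2)] .
  fix p :: nat assume p: "Factorial_Ring.prime p" "p dvd card H"
  interpret H: group "G\<lparr>carrier := H\<rparr>" using assms(1) subgroup_imp_group by blast
  obtain x where x: "x \<in> H" "x \<noteq> \<one>" "x [^]\<^bsub>G\<lparr>carrier := H\<rparr>\<^esub> p = \<one>"
    using H.Cauchy[of p] fH p by (auto simp: order_def)
  show "p \<in> s"
  proof (rule ccontr)
    assume "p \<notin> s"
    hence "pi_elt G (-s) x" using x p unfolding pi_elt_def
      by (intro exI[of _ p]) (simp add: pi_num_prime nat_pow_def)
    thus False using pi_elt_both[of x s] assms(1,3) x(1,2) subgroup.mem_carrier[OF assms(1)] by auto
  qed
qed

lemma card_subgroup_dvd:
  assumes "subgroup H G" "subgroup K G" "K \<subseteq> H" 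
  shows "card K dvd card H"
proof (cases "finite H")
  case True
  interpret H: group "G\<lparr>carrier := H\<rparr>" using assms(1) subgroup_imp_group by blast
  have "subgroup K (G\<lparr>carrier := H\<rparr>)" using subgroup_incl assms by blast
  from H.lagrange[OF this] have "card (rcosets\<^bsub>G\<lparr>carrier := H\<rparr>\<^esub> K) * card K = card H"
    by (simp add: order_def)
  thus ?thesis by (metis dvd_triv_right)
qed auto

lemma subgroup_eqI:
  assumes "subgroup H G" "subgroup K G" "K \<subseteq> H" "finite (carrier G)" "card H dvd card K"
  shows "K = H"
proof -
  have "finite H" "finite K" using assms subgroup.subset finite_subset by metis+
  moreover have "card K > 0" using subgroup.finite_imp_card_positive assms by blast
  ultimately show ?thesis using assms(3,5) card_seteq[of H K] dvd_imp_le[of "card H" "card K"] by blast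
qed

text \<open>Fix one factorisation z = f z * g z of each product. All other factorisations of z arise
  by moving an element w of A \<inter> B from one factor to the other; this is the bijection
  \<open>h\<close>. The set AB need not be a subgroup here.\<close>

lemma card_set_mult:
  assumes A: "subgroup A G" and B: "subgroup B G"
  shows "card (A <#> B) * card (A \<inter> B) = card A * card B"
proof -
  have Ac: "\<And>a. a \<in> A \<Longrightarrow> a \<in> carrier G" using A subgroup.mem_carrier by metis
  have Bc: "\<And>a. a \<in> B \<Longrightarrow> a \<in> carrier G" using B subgroup.mem_carrier by metis
  have "\<forall>z \<in> A <#> B. \<exists>a b. a \<in> A \<and> b \<in> B \<and> z = a \<otimes> b" by (auto simp: set_mult_def)
  then obtain f g where fg: "\<And>z. z \<in> A <#> B \<Longrightarrow> f z \<in> A \<and> g z \<in> B \<and> z = f z \<otimes> g z" by metis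
  define h where "h = (\<lambda>(z, w). (f z \<otimes> w, inv w \<otimes> g z))"
  have prod: "fst (h (z, w)) \<otimes> snd (h (z, w)) = z" if "z \<in> A <#> B" "w \<in> A \<inter> B" for z w
  proof -
    have c: "f z \<in> carrier G" "g z \<in> carrier G" "w \<in> carrier G" using fg that Ac Bc by auto
    hence "f z \<otimes> w \<otimes> (inv w \<otimes> g z) = f z \<otimes> g z" by (simp add: group_simps)
    thus ?thesis using fg[OF that(1)] by (simp add: h_def)
  qed
  have "bij_betw h ((A <#> B) \<times> (A \<inter> B)) (A \<times> B)"
  proof (rule bij_betw_imageI)
    show "inj_on h ((A <#> B) \<times> (A \<inter> B))"
    proof (rule inj_onI, clarsimp)
      fix z w z' w' assume *: "z \<in> A <#> B" "w \<in> A" "w \<in> B" "z' \<in> A <#> B" "w' \<in> A" "w' \<in> B" "h (z, w) = h (z', w')"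
      have "z = z'" using prod[of z w] prod[of z' w'] * by auto
      moreover have "f z \<otimes> w = f z' \<otimes> w'" using * by (simp add: h_def)
      ultimately show "z = z' \<and> w = w'" using fg[OF *(1)] Ac * by (metis l_cancel)
    qed
    show "h ` ((A <#> B) \<times> (A \<inter> B)) = A \<times> B"
    proof (intro equalityI subsetI)
      fix y assume "y \<in> h ` ((A <#> B) \<times> (A \<inter> B))"
      then obtain z w where zw: "z \<in> A <#> B" "w \<in> A" "w \<in> B" "y = h (z, w)" by auto
      thus "y \<in> A \<times> B" using fg[OF zw(1)] A B by (simp add: h_def subgroup.m_closed subgroup.m_inv_closed)
    next
      fix y assume "y \<in> A \<times> B"
      then obtain a b where y: "y = (a, b)" "a \<in> A" "b \<in> B" by auto
      define z where "z = a \<otimes> b"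
      define w where "w = inv (f z) \<otimes> a"
      have z: "z \<in> A <#> B" using y by (auto simp: z_def set_mult_def)
      note fz = fg[OF z]
      have c: "f z \<in> carrier G" "g z \<in> carrier G" "a \<in> carrier G" "b \<in> carrier G" using fz y Ac Bc by auto
      have eq: "f z \<otimes> g z = a \<otimes> b" using fz by (simp add: z_def)
      hence w2: "w = g z \<otimes> inv b" using c unfolding w_def
        by (metis inv_closed inv_solve_left inv_solve_right m_assoc m_closed)
      have "w \<in> A" unfolding w_def using fz y A by (simp add: subgroup.m_closed subgroup.m_inv_closed)
      moreover have "w \<in> B" unfolding w2 using fz y B by (simp add: subgroup.m_closed subgroup.m_inv_closed)
      moreover have "f z \<otimes> w = a" unfolding w_def using c by (simp add: m_assoc[symmetric])
      moreover have "inv w \<otimes> g z = b" unfolding w2 using c by (simp add: inv_mult_group m_assoc)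
      ultimately show "y \<in> h ` ((A <#> B) \<times> (A \<inter> B))" using z y
        by (intro image_eqI[of _ _ "(z, w)"]) (auto simp: h_def)
    qed
  qed
  thus ?thesis using bij_betw_same_card by (fastforce simp: card_cartesian_product)
qed

text \<open>On the moved points alone every orbit has length greater than 1, and by orbit-stabilizer
  this length is a power of p. The action is a bare function, so that conjugation and translation of
  cosets can be inserted directly; \<open>\<phi>\<close> repackages it as a
  \<open>group_action\<close>.\<close>

lemma p_group_moved_points:
  assumes P: "subgroup P G" "card P = p ^ a" and p: "Factorial_Ring.prime (p::nat)" and fin: "finite E"
    and closed: "\<And>g x. g \<in> P \<Longrightarrow> x \<in> E \<Longrightarrow> act g x \<in> E"
    and act_one: "\<And>x. x \<in> E \<Longrightarrow> act \<one> x = x"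
    and act_mult: "\<And>g h x. g \<in> P \<Longrightarrow> h \<in> P \<Longrightarrow> x \<in> E \<Longrightarrow> act (g \<otimes> h) x = act g (act h x)"
  shows "p dvd card {x \<in> E. \<exists>g\<in>P. act g x \<noteq> x}"
proof -
  define M where "M = {x \<in> E. \<exists>g\<in>P. act g x \<noteq> x}"
  define \<phi> where "\<phi> = (\<lambda>g. restrict (act g) M)"
  let ?P = "G\<lparr>carrier := P\<rparr>"
  interpret P: group ?P using P(1) subgroup_imp_group by blast
  have inv_act: "act (inv g) (act g x) = x" if "g \<in> P" "x \<in> E" for g x
    using act_mult[of "inv g" g x] act_one that subgroup.m_inv_closed[OF P(1)] subgroup.mem_carrier[OF P(1)] by auto
  have inv_act': "act g (act (inv g) x) = x" if "g \<in> P" "x \<in> E" for g x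
    using inv_act[of "inv g" x] that subgroup.m_inv_closed[OF P(1)] subgroup.mem_carrier[OF P(1)] by auto
  have M_closed: "act g x \<in> M" if g: "g \<in> P" and x: "x \<in> M" for g x
  proof (rule ccontr)
    \<comment> \<open>If P fixed \<open>act g x\<close>, then applying \<open>inv g\<close> would
      give \<open>act g x = x\<close>, and P would fix x.\<close>
    assume "act g x \<notin> M"
    hence fixed: "act h (act g x) = act g x" if "h \<in> P" for h 
      using that closed g x by (auto simp: M_def)
    have "x = act g x"
      using fixed[of "inv g"] inv_act[of g x] g x subgroup.m_inv_closed[OF P(1)] by (auto simp: M_def)
    hence "x \<notin> M" using fixed unfolding M_def by auto
    thus False using x by simp
  qed
  have bij: "\<phi> g \<in> Bij M" if g: "g \<in> P" for g
  proof -
    have gi: "inv g \<in> P" using g subgroup.m_inv_closed[OF P(1)] by blast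
    have "bij_betw (act g) M M"
      by (rule bij_betw_byWitness[where f' = "act (inv g)"])
        (use M_closed[OF g] M_closed[OF gi] inv_act[OF g] inv_act'[OF g] in \<open>auto simp: M_def\<close>)
    thus ?thesis unfolding Bij_def \<phi>_def by (auto intro: bij_betw_cong[THEN iffD1])
  qed
  have hom: "\<phi> \<in> hom ?P (BijGroup M)"
  proof (rule homI)
    fix g h assume "g \<in> carrier ?P" "h \<in> carrier ?P"
    hence gh: "g \<in> P" "h \<in> P" by auto
    have "\<phi> (g \<otimes> h) = compose M (\<phi> g) (\<phi> h)"
      unfolding \<phi>_def compose_def using act_mult[OF gh] M_closed[OF gh(2)] 
      by (auto simp: M_def restrict_def fun_eq_iff)
    thus "\<phi> (g \<otimes>\<^bsub>?P\<^esub> h) = \<phi> g \<otimes>\<^bsub>BijGroup M\<^esub> \<phi> h"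
      using bij gh by (simp add: BijGroup_def)
  qed (use bij in \<open>auto simp: BijGroup_def\<close>)
  interpret act: group_action ?P M \<phi>
    by (intro group_action.intro group_hom.intro group_hom_axioms.intro P.group_axioms group_BijGroup hom)
  have finM: "finite M" using fin by (simp add: M_def)
  have orb_dvd: "p dvd card orb" if "orb \<in> orbits ?P M \<phi>" for orb
  proof -
    obtain x where x: "x \<in> M" "orb = orbit ?P \<phi> x" using \<open>orb \<in> _\<close> unfolding orbits_def by auto
    have "card orb * card (stabilizer ?P \<phi> x) = p ^ a"
      using act.orbit_stabilizer_theorem[OF x(1)] P(2) x(2) by (simp add: order_def)
    then obtain i where i: "card orb = p ^ i" using p by (metis divides_primepow_nat dvd_triv_left)
    obtain g where g: "g \<in> P" "act g x \<noteq> x" using x(1) by (auto simp: M_def)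
    have "x \<in> orb" using act.orbit_refl[OF x(1)] x by simp
    moreover have "act g x \<in> orb" unfolding x(2) orbit_def using g(1) x(1) by (auto simp: \<phi>_def intro!: exI[of _ g])
    ultimately have "card orb \<noteq> 1" using g(2) by (metis card_1_singletonE singletonD)
    thus ?thesis using i by (cases i) auto
  qed
  have "card M = (\<Sum>orb\<in>orbits ?P M \<phi>. card orb)"
    using act.disjoint_sum[OF finM, of "\<lambda>_. 1::nat"] by simp
  thus ?thesis using orb_dvd unfolding M_def[symmetric] by (simp add: dvd_sum)
qed

lemma r_coset_eq_iff:
  assumes "subgroup H G" "x \<in> carrier G" "y \<in> carrier G"
  shows "H #> x = H #> y \<longleftrightarrow> x \<otimes> inv y \<in> H"
proof
  assume "H #> x = H #> y"
  hence "x \<in> H #> y" using rcos_self[OF assms(2,1)] by simp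
  thus "x \<otimes> inv y \<in> H" using assms by (auto simp: r_coset_def group_simps subgroup.mem_carrier[OF assms(1)])
next
  assume "x \<otimes> inv y \<in> H"
  hence "x \<in> H #> y" unfolding r_coset_def using assms 
    by (auto simp: group_simps intro!: bexI[of _ "x \<otimes> inv y"])
  thus "H #> x = H #> y" using repr_independence[OF _ assms(3,1)] by simp
qed

text \<open>A \<open>p\<close>-group permuting a set of cosets whose number is prime to \<open>p\<close> fixes a coset.\<close>

lemma Sylow_embedding:
  assumes fin: "finite (carrier G)" and P: "subgroup P G" "card P = p ^ a" and p: "Factorial_Ring.prime (p::nat)"
    and H: "subgroup H G" "\<not> p dvd card (rcosets H)"
  obtains g where "g \<in> carrier G" "\<And>x. x \<in> P \<Longrightarrow> g \<otimes> x \<otimes> inv g \<in> H"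
proof -
  note Pc = subgroup.mem_carrier[OF P(1)] and Hc = subgroup.mem_carrier[OF H(1)]
  define act where "act = (\<lambda>g C. C #> inv g)"
  have Hsub: "H \<subseteq> carrier G" using H(1) subgroup.subset by blast
  have sub: "C \<subseteq> carrier G" if "C \<in> rcosets H" for C 
    using subgroup.rcosets_carrier[OF H(1) group_axioms that] .
  have "p dvd card {C \<in> rcosets H. \<exists>g\<in>P. act g C \<noteq> C}"
  proof (rule p_group_moved_points[OF P p])
    show "finite (rcosets H)" using finite_UnionD[of "rcosets H"] rcosets_part_G[OF H(1)] fin by simp
  next
    fix g C assume g: "g \<in> P" and C: "C \<in> rcosets H"
    then obtain x where x: "x \<in> carrier G" "C = H #> x" by (auto simp: RCOSETS_def)
    show "act g C \<in> rcosets H" unfolding act_def x(2) using x(1) g Pc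
      by (simp add: coset_mult_assoc[OF Hsub] rcosetsI[OF Hsub])
  next
    fix g h C assume g: "g \<in> P" and C: "C \<in> rcosets H" and h: "h \<in> P"
    then obtain x where x: "x \<in> carrier G" "C = H #> x" by (auto simp: RCOSETS_def)
    show "act (g \<otimes> h) C = act g (act h C)"
      unfolding act_def x(2) using x(1) g h Pc Hc by (simp add: coset_mult_assoc[OF Hsub] inv_mult_group m_assoc)
  qed (use sub in \<open>simp add: act_def\<close>)
  hence "{C \<in> rcosets H. \<exists>g\<in>P. act g C \<noteq> C} \<noteq> rcosets H" using H(2) by metis
  then obtain C where C: "C \<in> rcosets H" "\<And>g. g \<in> P \<Longrightarrow> act g C = C" by blast
  then obtain x where x: "x \<in> carrier G" "C = H #> x" by (auto simp: RCOSETS_def)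
  have "x \<otimes> y \<otimes> inv x \<in> H" if y: "y \<in> P" for y
  proof -
    have "H #> (x \<otimes> inv (inv y)) = H #> x"
      using C(2)[of "inv y"] y subgroup.m_inv_closed[OF P(1) y] x Pc[OF y] 
      by (simp add: act_def coset_mult_assoc[OF Hsub])
    thus ?thesis using r_coset_eq_iff[OF H(1), of "x \<otimes> y" x] x Pc[OF y] by simp
  qed
  thus ?thesis using that x(1) by blast
qed

lemma index_mult_card:
  "finite (carrier G) \<Longrightarrow> subgroup H G \<Longrightarrow> card (rcosets H) * card H = card (carrier G)"
  using lagrange by (simp add: order_def)

lemma index_dvd:
  assumes fin: "finite (carrier G)" and H: "subgroup H G" and K: "subgroup K G" "K \<subseteq> H"
  shows "card (rcosets H) dvd card (rcosets K)"
proof -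
  obtain i where i: "card H = card K * i" using card_subgroup_dvd[OF H K] by (auto elim!: dvdE)
  have "card (rcosets K) * card K = card (rcosets H) * i * card K"
    using index_mult_card[OF fin H] index_mult_card[OF fin K(1)] i by (simp add: mult_ac)
  moreover have "card K > 0" using subgroup.finite_imp_card_positive[OF K(1) fin] .
  ultimately show ?thesis by simp
qed

lemma Sylow_exists:
  assumes "finite (carrier G)" "Factorial_Ring.prime (p::nat)"
  obtains P a where "subgroup P G" "card P = p ^ a" "\<not> p dvd card (rcosets P)"
proof -
  have "order G \<noteq> 0" using assms(1) order_gt_0_iff_finite by simp
  moreover have "\<not> is_unit p" using assms(2) by auto
  ultimately obtain y where y: "order G = p ^ multiplicity p (order G) * y" "\<not> p dvd y"
    using multiplicity_decompose' by blast
  obtain P where P: "subgroup P G" "card P = p ^ multiplicity p (order G)"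
    using sylow_thm[OF assms(2) group_axioms y(1) assms(1)] by blast
  have "card (rcosets P) * card P = card P * y" using lagrange[OF P(1)] y P by simp
  hence "card (rcosets P) = y" using P(2) assms(2) by (simp add: mult.commute prime_gt_0_nat)
  thus ?thesis using that P y by metis
qed

end

section \<open>The Frattini argument and complements\<close>

context group
begin

lemma finite_subgroup: "finite (carrier G) \<Longrightarrow> subgroup H G \<Longrightarrow> finite H"
  using finite_subset subgroup.subset by metis

lemma order_subgroup: "order (G\<lparr>carrier := H\<rparr>) = card H"
  by (simp add: order_def)

lemma card_subgroup_pos: "finite (carrier G) \<Longrightarrow> subgroup H G \<Longrightarrow> card H > 0"
  using subgroup.finite_imp_card_positive by blast

lemma normal_closed:
  "N \<lhd> G \<Longrightarrow> g \<in> carrier G \<Longrightarrow> x \<in> N \<Longrightarrow> g \<otimes> x \<otimes> inv g \<in> N"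
  using normal_inv_iff by blast

lemma normalI':
  "subgroup N G \<Longrightarrow> (\<And>g x. g \<in> carrier G \<Longrightarrow> x \<in> N \<Longrightarrow> g \<otimes> x \<otimes> inv g \<in> N) \<Longrightarrow> N \<lhd> G"
  using normal_inv_iff by blast

text \<open>In a finite group an injection of K into itself is onto, so an inclusion suffices where
  the stabilizer asks for an equality.\<close>

lemma mem_normalizer_iff:
  assumes "finite (carrier G)" "K \<subseteq> carrier G"
  shows "g \<in> normalizer G K \<longleftrightarrow> g \<in> carrier G \<and> (\<forall>x\<in>K. g \<otimes> x \<otimes> inv g \<in> K)"
proof -
  have eq: "g <# K #> inv g = (\<lambda>x. g \<otimes> x \<otimes> inv g) ` K" by (auto simp: l_coset_def r_coset_def)
  have "(\<lambda>x. g \<otimes> x \<otimes> inv g) ` K = K \<longleftrightarrow> (\<forall>x\<in>K. g \<otimes> x \<otimes> inv g \<in> K)" if g: "g \<in> carrier G"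
  proof
    assume "\<forall>x\<in>K. g \<otimes> x \<otimes> inv g \<in> K"
    hence "(\<lambda>x. g \<otimes> x \<otimes> inv g) ` K \<subseteq> K" by auto
    moreover have "inj_on (\<lambda>x. g \<otimes> x \<otimes> inv g) K"
      using assms(2) g by (intro inj_onI) (meson inv_closed m_closed r_cancel l_cancel subsetD)
    ultimately show "(\<lambda>x. g \<otimes> x \<otimes> inv g) ` K = K"
      using endo_inj_surj[OF finite_subset[OF assms(2,1)]] by blast
  qed blast
  thus ?thesis using assms(2) unfolding normalizer_def stabilizer_def by (auto simp: eq)
qed

lemma subgroup_normalizer: "K \<subseteq> carrier G \<Longrightarrow> subgroup (normalizer G K) G"
  by (rule normalizer_imp_subgroup)

lemma normal_of_normalizer:
  assumes "finite (carrier G)" "subgroup K G" "normalizer G K = carrier G"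
  shows "K \<lhd> G"
  using mem_normalizer_iff[OF assms(1) subgroup.subset[OF assms(2)]] assms by (intro normalI') auto

lemma maximal_subgroup_exists:
  assumes fin: "finite (carrier G)" and H: "subgroup H G" "H \<noteq> carrier G"
  obtains M where "maximal_subgroup G M" "H \<subseteq> M"
proof -
  let ?S = "{M. subgroup M G \<and> H \<subseteq> M \<and> M \<noteq> carrier G}"
  have "?S \<subseteq> Pow (carrier G)" using subgroup.subset by blast
  hence "finite ?S" using fin by (meson finite_Pow_iff finite_subset)
  moreover have "H \<in> ?S" using H by blast
  ultimately obtain M where M: "M \<in> ?S" "\<And>L. L \<in> ?S \<Longrightarrow> M \<subseteq> L \<Longrightarrow> M = L"
    using finite_has_maximal[of ?S] by auto
  have sM: "subgroup M G" "H \<subseteq> M" "M \<noteq> carrier G" using M(1) by auto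
  have "\<not> (\<exists>L. subgroup L G \<and> M \<subset> L \<and> L \<subset> carrier G)"
  proof
    assume "\<exists>L. subgroup L G \<and> M \<subset> L \<and> L \<subset> carrier G"
    then obtain L where L: "subgroup L G" "M \<subset> L" "L \<subset> carrier G" by blast
    hence "L \<in> ?S" using sM by auto
    thus False using M(2)[of L] L by auto
  qed
  hence "maximal_subgroup G M" unfolding maximal_subgroup_def
    using sM subgroup.subset[OF sM(1)] by auto
  thus ?thesis using that M by blast
qed

text \<open>Elements of the Frattini subgroup are non-generators: a maximal subgroup above a proper
  K would contain D as well, hence everything that \<open>supp\<close> produces.\<close>

lemma Frattini_subgroup_supplement:
  assumes fin: "finite (carrier G)" and \<Phi>: "\<And>M. maximal_subgroup G M \<Longrightarrow> D \<subseteq> M" and D: "D \<subseteq> carrier G"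
    and K: "subgroup K G" and supp: "\<And>g. g \<in> carrier G \<Longrightarrow> \<exists>d\<in>D. d \<otimes> g \<in> K"
  shows "K = carrier G"
proof (rule ccontr)
  assume "K \<noteq> carrier G"
  then obtain M where M: "maximal_subgroup G M" "K \<subseteq> M" using maximal_subgroup_exists[OF fin K] by blast
  have sM: "subgroup M G" "M \<noteq> carrier G" using M(1) unfolding maximal_subgroup_def by auto
  have "g \<in> M" if g: "g \<in> carrier G" for g
  proof -
    obtain d where d: "d \<in> D" "d \<otimes> g \<in> K" using supp g by blast
    hence "d \<in> M" "d \<otimes> g \<in> M" using \<Phi>[OF M(1)] M(2) by auto
    hence "inv d \<otimes> (d \<otimes> g) \<in> M" using sM by (simp add: subgroup.m_closed subgroup.m_inv_closed)
    thus ?thesis using d D g by (auto simp: group_simps subset_iff)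
  qed
  thus False using sM subgroup.subset by blast
qed

lemma conj_subgroup:
  assumes H: "subgroup H G" and g: "g \<in> carrier G"
  shows "subgroup ((\<lambda>x. g \<otimes> x \<otimes> inv g) ` H) G"
    "card ((\<lambda>x. g \<otimes> x \<otimes> inv g) ` H) = card H"
proof -
  note Hc = subgroup.mem_carrier[OF H]
  show "subgroup ((\<lambda>x. g \<otimes> x \<otimes> inv g) ` H) G"
  proof (rule subgroupI)
    fix a b assume "a \<in> (\<lambda>x. g \<otimes> x \<otimes> inv g) ` H" "b \<in> (\<lambda>x. g \<otimes> x \<otimes> inv g) ` H"
    then obtain x y where xy: "x \<in> H" "y \<in> H" "a = g \<otimes> x \<otimes> inv g" "b = g \<otimes> y \<otimes> inv g" by auto
    have "a \<otimes> b = g \<otimes> (x \<otimes> y) \<otimes> inv g" using xy g Hc by (simp add: group_simps)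
    thus "a \<otimes> b \<in> (\<lambda>x. g \<otimes> x \<otimes> inv g) ` H" using xy H by (auto simp: subgroup.m_closed)
  next
    fix a assume "a \<in> (\<lambda>x. g \<otimes> x \<otimes> inv g) ` H" 
    then obtain x where xy: "x \<in> H" "a = g \<otimes> x \<otimes> inv g" by auto
    have "inv a = g \<otimes> (inv x) \<otimes> inv g" using xy g Hc by (simp add: group_simps)
    thus "inv a \<in> (\<lambda>x. g \<otimes> x \<otimes> inv g) ` H" using xy H by (auto simp: subgroup.m_inv_closed)
  qed (use g Hc subgroup.one_closed[OF H] in auto)
  have "inj_on (\<lambda>x. g \<otimes> x \<otimes> inv g) H"
    using Hc g by (intro inj_onI) (meson inv_closed m_closed r_cancel l_cancel)
  thus "card ((\<lambda>x. g \<otimes> x \<otimes> inv g) ` H) = card H" by (rule card_image)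
qed

text \<open>The g-conjugate of a Sylow subgroup Q of N stays in N, and Sylow embedding inside N
  carries it back into Q by some n; then n g normalizes Q.\<close>

lemma Frattini_argument:
  assumes fin: "finite (carrier G)" and N: "N \<lhd> G" and q: "Factorial_Ring.prime (q::nat)"
  obtains Q a m where "subgroup Q G" "Q \<subseteq> N" "card Q = q ^ a" "card N = q ^ a * m" "\<not> q dvd m"
    "\<And>g. g \<in> carrier G \<Longrightarrow> \<exists>n\<in>N. n \<otimes> g \<in> normalizer G Q"
proof -
  have sN: "subgroup N G" using N normal_imp_subgroup by blast
  note Nc = subgroup.mem_carrier[OF sN]
  let ?N = "G\<lparr>carrier := N\<rparr>"
  interpret N: group ?N using sN subgroup_imp_group by blast
  have finN: "finite (carrier ?N)" using finite_subgroup[OF fin sN] by simp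
  obtain Q a where Q: "subgroup Q ?N" "card Q = q ^ a" "\<not> q dvd card (rcosets\<^bsub>?N\<^esub> Q)"
    using N.Sylow_exists[OF finN q] by blast
  have sQ: "subgroup Q G" using incl_subgroup[OF sN Q(1)] .
  have QN: "Q \<subseteq> N" using subgroup.subset[OF Q(1)] by simp
  have Qc: "Q \<subseteq> carrier G" using sQ subgroup.subset by blast
  have card: "card N = q ^ a * card (rcosets\<^bsub>?N\<^esub> Q)"
    using N.index_mult_card[OF finN Q(1)] Q(2) by (simp add: mult.commute)
  have "\<exists>n\<in>N. n \<otimes> g \<in> normalizer G Q" if g: "g \<in> carrier G" for g
  proof -
    let ?P = "(\<lambda>x. g \<otimes> x \<otimes> inv g) ` Q"
    have "?P \<subseteq> N" using normal_closed[OF N g] QN by auto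
    hence P: "subgroup ?P ?N" "card ?P = q ^ a"
      using conj_subgroup[OF sQ g] subgroup_incl[OF _ sN] Q(2) by auto
    obtain n where n: "n \<in> carrier ?N" "\<And>x. x \<in> ?P \<Longrightarrow> n \<otimes>\<^bsub>?N\<^esub> x \<otimes>\<^bsub>?N\<^esub> inv\<^bsub>?N\<^esub> n \<in> Q"
      using N.Sylow_embedding[OF finN P q Q(1,3)] by blast
    have "n \<otimes> g \<otimes> x \<otimes> inv (n \<otimes> g) \<in> Q" if x: "x \<in> Q" for x
    proof -
      have "n \<otimes> (g \<otimes> x \<otimes> inv g) \<otimes> inv n \<in> Q"
        using n(2)[of "g \<otimes> x \<otimes> inv g"] x n(1) m_inv_consistent[OF sN] by auto
      moreover have "n \<in> carrier G" "x \<in> carrier G" using n(1) Nc x Qc by auto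
      ultimately show ?thesis using g by (simp add: group_simps)
    qed
    thus ?thesis using n(1) g Nc mem_normalizer_iff[OF fin Qc] by (intro bexI[of _ n]) auto
  qed
  thus ?thesis using that sQ QN Q(2,3) card by blast
qed

text \<open>The non-central elements are the points moved by conjugation, so their number is
  divisible by q, as is |D|. A trivial centre would leave |D| - 1 of them.\<close>

lemma p_group_centre_nontrivial:
  assumes fin: "finite (carrier G)" and D: "subgroup D G" "card D = q ^ a" "D \<noteq> {\<one>}"
    and q: "Factorial_Ring.prime (q::nat)"
  shows "{z \<in> D. \<forall>x\<in>D. x \<otimes> z \<otimes> inv x = z} \<noteq> {\<one>}"
proof
  let ?Z = "{z \<in> D. \<forall>x\<in>D. x \<otimes> z \<otimes> inv x = z}"
  assume Z1: "?Z = {\<one>}"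
  note Dc = subgroup.mem_carrier[OF D(1)]
  have finD: "finite D" using finite_subgroup[OF fin D(1)] .
  have "q dvd card {x \<in> D. \<exists>g\<in>D. g \<otimes> x \<otimes> inv g \<noteq> x}"
    by (rule p_group_moved_points[OF D(1,2) q finD])
      (use D(1) Dc in \<open>auto simp: group_simps subgroup.m_closed subgroup.m_inv_closed\<close>)
  moreover have "{x \<in> D. \<exists>g\<in>D. g \<otimes> x \<otimes> inv g \<noteq> x} = D - ?Z" by auto
  ultimately have "q dvd card D - 1" using Z1 finD D(1) by (simp add: card_Diff_singleton subgroup.one_closed)
  moreover have "a \<noteq> 0"
  proof
    assume "a = 0"
    hence "card D = 1" using D by simp
    thus False using D subgroup.one_closed[OF D(1)] by (metis card_1_singletonE singletonD)
  qed
  hence "q dvd card D" using D(2) by (cases a) auto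
  moreover have "card D > 0" using card_subgroup_pos[OF fin D(1)] .
  ultimately have "q dvd 1" by (metis One_nat_def Suc_leI dvd_diffD1)
  thus False using q by auto
qed

end

section \<open>Splitting over an abelian normal subgroup of coprime index\<close>

locale coprime_abelian_normal = group G for G (structure) +
  fixes D E
  assumes fin: "finite (carrier G)" and D: "D \<lhd> G" and E: "E \<lhd> G" and DE: "D \<subseteq> E"
    and comm: "\<And>x y. x \<in> D \<Longrightarrow> y \<in> D \<Longrightarrow> x \<otimes> y = y \<otimes> x"
    and coprime: "coprime (card D) (card E div card D)"
begin

abbreviation cj where "cj g x \<equiv> g \<otimes> x \<otimes> inv g"
abbreviation DG where "DG \<equiv> G\<lparr>carrier := D\<rparr>"

text \<open>These are the crossed homomorphisms for the conjugation action that extend the identity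
  of D. The elements sent to \<one> form a complement of D in E, so existence of such a map encodes
  splitting, and comparing two of them encodes conjugacy of complements.\<close>

definition crossed :: "('a \<Rightarrow> 'a) \<Rightarrow> bool" where
  "crossed f \<longleftrightarrow> (\<forall>g\<in>E. f g \<in> D) \<and> (\<forall>g\<in>E. \<forall>h\<in>E. f (g \<otimes> h) = cj g (f h) \<otimes> f g) \<and> (\<forall>d\<in>D. f d = d)"

lemma sD: "subgroup D G" and sE: "subgroup E G"
  using D E normal_imp_subgroup by auto

lemma Dc: "x \<in> D \<Longrightarrow> x \<in> carrier G" and Ec: "x \<in> E \<Longrightarrow> x \<in> carrier G"
  using sD sE subgroup.mem_carrier by metis+

lemma DE': "x \<in> D \<Longrightarrow> x \<in> E" using DE by blast

lemma D_closed: "x \<in> D \<Longrightarrow> y \<in> D \<Longrightarrow> x \<otimes> y \<in> D" "x \<in> D \<Longrightarrow> inv x \<in> D" "\<one> \<in> D"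
  using sD by (simp_all add: subgroup.m_closed subgroup.m_inv_closed subgroup.one_closed)

lemma E_closed: "x \<in> E \<Longrightarrow> y \<in> E \<Longrightarrow> x \<otimes> y \<in> E" "x \<in> E \<Longrightarrow> inv x \<in> E" "\<one> \<in> E"
  using sE by (simp_all add: subgroup.m_closed subgroup.m_inv_closed subgroup.one_closed)

lemma cj_D: "g \<in> carrier G \<Longrightarrow> x \<in> D \<Longrightarrow> cj g x \<in> D"
  using normal_closed[OF D] .

lemma cj_E: "g \<in> carrier G \<Longrightarrow> x \<in> E \<Longrightarrow> cj g x \<in> E"
  using normal_closed[OF E] .

lemma cj_mult: "g \<in> carrier G \<Longrightarrow> x \<in> carrier G \<Longrightarrow> y \<in> carrier G \<Longrightarrow> cj g (x \<otimes> y) = cj g x \<otimes> cj g y"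
  by (simp add: group_simps)

lemma cj_cj: "g \<in> carrier G \<Longrightarrow> h \<in> carrier G \<Longrightarrow> x \<in> carrier G \<Longrightarrow> cj (g \<otimes> h) x = cj g (cj h x)"
  by (simp add: group_simps)

lemma cj_inv: "g \<in> carrier G \<Longrightarrow> x \<in> carrier G \<Longrightarrow> cj g (inv x) = inv (cj g x)"
  by (simp add: group_simps)

lemma cj_DD: "d \<in> D \<Longrightarrow> x \<in> D \<Longrightarrow> cj d x = x"
  using comm[of d x] Dc by (simp add: group_simps)

lemma comm_DG: "comm_group DG"
proof -
  interpret DG: group DG using sD subgroup_imp_group by blast
  show ?thesis by (rule DG.group_comm_groupI) (simp add: comm)
qed

sublocale DG: comm_group DG
  by (rule comm_DG)

lemma finprod_D: "f \<in> A \<rightarrow> D \<Longrightarrow> finprod DG f A \<in> D"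
  using DG.finprod_closed[of f A] by simp

lemma cj_finprod:
  assumes "finite A" "g \<in> carrier G" "f \<in> A \<rightarrow> D"
  shows "cj g (finprod DG f A) = finprod DG (\<lambda>a. cj g (f a)) A"
  using assms
proof (induction A rule: finite_induct)
  case empty
  thus ?case by simp
next
  case (insert x F)
  have "finprod DG f F \<in> D" using insert by (intro finprod_D) auto
  moreover have "f x \<in> D" using insert by auto
  ultimately have "cj g (f x \<otimes> finprod DG f F) = cj g (f x) \<otimes> cj g (finprod DG f F)"
    using insert.prems Dc by (intro cj_mult) auto
  thus ?case using insert by (simp add: Pi_iff cj_D)
qed

definition rep :: "'a set \<Rightarrow> 'a" where "rep c = (SOME x. x \<in> c)"
definition cosets :: "'a set set" where "cosets = (\<lambda>x. D #> x) ` E"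

lemma cosets_finite: "finite cosets"
  unfolding cosets_def using finite_subgroup[OF fin sE] by simp

lemma coset_eq: "x \<in> carrier G \<Longrightarrow> y \<in> carrier G \<Longrightarrow> D #> x = D #> y \<longleftrightarrow> x \<otimes> inv y \<in> D"
  by (rule r_coset_eq_iff[OF sD])

lemma rep:
  assumes "x \<in> E" shows "rep (D #> x) \<in> E" "D #> rep (D #> x) = D #> x"
proof -
  have "x \<in> D #> x" using rcos_self[OF Ec[OF assms] sD] .
  hence r: "rep (D #> x) \<in> D #> x" unfolding rep_def by (rule someI)
  then obtain d where d: "d \<in> D" "rep (D #> x) = d \<otimes> x" by (auto simp: r_coset_def)
  thus "rep (D #> x) \<in> E" using assms DE' E_closed by auto
  show "D #> rep (D #> x) = D #> x" using repr_independence[OF r Ec[OF assms] sD] by simp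
qed

lemma rep_cosets: "c \<in> cosets \<Longrightarrow> rep c \<in> E" "c \<in> cosets \<Longrightarrow> D #> rep c = c"
  unfolding cosets_def using rep by auto

text \<open>Normality of D makes left translation well defined on right cosets, independently of the
  representative.\<close>

lemma coset_mult_rep:
  assumes "g \<in> E" "x \<in> E" shows "D #> (g \<otimes> rep (D #> x)) = D #> (g \<otimes> x)"
proof -
  have r: "rep (D #> x) \<in> carrier G" "x \<in> carrier G" "g \<in> carrier G" using rep[OF assms(2)] Ec assms by auto
  have "rep (D #> x) \<otimes> inv x \<in> D" using rep[OF assms(2)] coset_eq r by blast
  hence "cj g (rep (D #> x) \<otimes> inv x) \<in> D" using cj_D r by blast
  thus ?thesis using r by (simp add: coset_eq group_simps)
qed

lemma mult_bij:
  assumes "g \<in> E" shows "bij_betw (\<lambda>c. D #> (g \<otimes> rep c)) cosets cosets"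
proof (rule bij_betw_byWitness[where f' = "\<lambda>c. D #> (inv g \<otimes> rep c)"])
  have gi: "inv g \<in> E" using assms E_closed by blast
  show "\<forall>a\<in>cosets. D #> (inv g \<otimes> rep (D #> (g \<otimes> rep a))) = a"
    using coset_mult_rep[OF gi] rep_cosets assms E_closed Ec by (auto simp: cancel_inv_left)
  show "\<forall>a\<in>cosets. D #> (g \<otimes> rep (D #> (inv g \<otimes> rep a))) = a"
    using coset_mult_rep[OF assms] rep_cosets gi assms E_closed Ec by (auto simp: cancel_inv_left)
  show "(\<lambda>c. D #> (g \<otimes> rep c)) ` cosets \<subseteq> cosets" 
    using rep_cosets assms E_closed unfolding cosets_def by blast
  show "(\<lambda>c. D #> (inv g \<otimes> rep c)) ` cosets \<subseteq> cosets" 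
    using rep_cosets gi E_closed unfolding cosets_def by blast
qed

lemma card_cosets: "card cosets = card E div card D"
proof -
  let ?E = "G\<lparr>carrier := E\<rparr>"
  interpret E: group ?E using sE subgroup_imp_group by blast
  have "subgroup D ?E" using subgroup_incl[OF sD sE DE] .
  hence "card (rcosets\<^bsub>?E\<^esub> D) * card D = card E" using E.lagrange by (simp add: order_def)
  moreover have "rcosets\<^bsub>?E\<^esub> D = cosets" by (auto simp: RCOSETS_def cosets_def)
  moreover have "card D > 0" using card_subgroup_pos[OF fin sD] .
  ultimately show ?thesis by (metis nonzero_mult_div_cancel_right less_irrefl)
qed

lemma D_pow_card:
  assumes "x \<in> D" shows "x [^] card D = \<one>"
  using DG.pow_order_eq_1[of x] assms by (simp add: order_def nat_pow_def)

lemma D_pow: "x \<in> D \<Longrightarrow> x [^] (n::nat) \<in> D"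
  using subgroup_nat_pow[OF sD] .

lemma D_pow_mult: "x \<in> D \<Longrightarrow> y \<in> D \<Longrightarrow> (x \<otimes> y) [^] (n::nat) = x [^] n \<otimes> y [^] n"
  using pow_mult_distrib[OF comm] Dc by metis

text \<open>The index is prime to |D|, so by Bezout raising to the index is inverted on D by another
  power map.\<close>

lemma index_inverse: obtains k :: nat where "\<And>x. x \<in> D \<Longrightarrow> (x [^] (card E div card D)) [^] k = x"
proof -
  let ?h = "card E div card D"
  have "card D > 0" using card_subgroup_pos[OF fin sD] .
  moreover have "card E \<ge> card D" using DE finite_subgroup[OF fin sE] card_mono by blast
  ultimately have "?h \<noteq> 0" using div_greater_zero_iff[of "card E" "card D"] by simp
  then obtain k j where kj: "?h * k = card D * j + 1" 
    using coprime bezout_nat[of ?h "card D"] by (metis coprime_iff_gcd_eq_1 gcd.commute)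
  have "(x [^] ?h) [^] k = x" if x: "x \<in> D" for x
  proof -
    have "(x [^] ?h) [^] k = x [^] (card D * j + 1)" using x Dc by (simp only: nat_pow_pow kj)
    also have "\<dots> = (x [^] card D) [^] j \<otimes> x" using x Dc by (simp add: nat_pow_mult[symmetric] nat_pow_pow)
    finally show ?thesis using D_pow_card x Dc by simp
  qed
  thus ?thesis using that by blast
qed

text \<open>The transversal product, divided by the index \<open>|E : D|\<close>, so that it is the identity on \<open>D\<close>.\<close>

lemma crossed_exists: obtains f where "crossed f"
proof -
  \<comment> \<open>\<open>t g c\<close> measures how far the representatives are from being
    compatible with translation by g: g times the representative of c equals \<open>t g c\<close>
    times the representative of the translated coset.\<close>
  define t where "t = (\<lambda>g c. g \<otimes> rep c \<otimes> inv (rep (D #> (g \<otimes> rep c))))"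
  define f0 where "f0 = (\<lambda>g. finprod DG (t g) cosets)"
  have tD: "t g c \<in> D" if g: "g \<in> E" and c: "c \<in> cosets" for g c
  proof -
    have e: "g \<otimes> rep c \<in> E" using g c rep_cosets E_closed by auto
    note r = rep[OF this]
    have "D #> (g \<otimes> rep c) = D #> rep (D #> (g \<otimes> rep c))" using r by simp
    thus ?thesis unfolding t_def using coset_eq Ec e r(1) by blast
  qed
  hence f0D: "f0 g \<in> D" if "g \<in> E" for g
    unfolding f0_def using that by (intro finprod_D) auto
  have f0_mult: "f0 (g \<otimes> h) = cj g (f0 h) \<otimes> f0 g" if g: "g \<in> E" and h: "h \<in> E" for g h
  proof -
    let ?\<tau> = "\<lambda>c. D #> (h \<otimes> rep c)"
    have tau: "?\<tau> c \<in> cosets" if "c \<in> cosets" for c using mult_bij[OF h] that by (auto simp: bij_betw_def)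
    \<comment> \<open>This is the cocycle identity for \<open>t\<close>. Multiplying it over all
      cosets and reindexing along the permutation \<open>?\<tau>\<close> yields the crossed law for
      \<open>f0\<close>.\<close>
    have eq: "t (g \<otimes> h) c = cj g (t h c) \<otimes> t g (?\<tau> c)" if c: "c \<in> cosets" for c
    proof -
      have e: "h \<otimes> rep c \<in> E" using h c rep_cosets E_closed by auto
      have "D #> (g \<otimes> rep (?\<tau> c)) = D #> (g \<otimes> h \<otimes> rep c)"
        using coset_mult_rep[OF g e] g h c rep_cosets Ec by (simp add: m_assoc)
      moreover have "rep c \<in> carrier G" "rep (?\<tau> c) \<in> carrier G" 
        "rep (D #> (g \<otimes> h \<otimes> rep c)) \<in> carrier G" "g \<in> carrier G" "h \<in> carrier G"
        using rep_cosets Ec c g h rep E_closed by auto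
      ultimately show ?thesis unfolding t_def by (simp add: group_simps)
    qed
    have "f0 (g \<otimes> h) = finprod DG (\<lambda>c. cj g (t h c) \<otimes>\<^bsub>DG\<^esub> t g (?\<tau> c)) cosets"
      unfolding f0_def 
      by (rule DG.finprod_cong') (use eq tD tau g h cj_D Ec D_closed in auto)
    also have "\<dots> = finprod DG (\<lambda>c. cj g (t h c)) cosets \<otimes>\<^bsub>DG\<^esub> finprod DG (\<lambda>c. t g (?\<tau> c)) cosets"
      by (rule DG.finprod_multf) (use tD tau g h cj_D Ec in auto)
    also have "finprod DG (\<lambda>c. cj g (t h c)) cosets = cj g (f0 h)"
      unfolding f0_def using cj_finprod[OF cosets_finite Ec[OF g], of "t h"] tD[OF h] by auto
    also have "finprod DG (\<lambda>c. t g (?\<tau> c)) cosets = f0 g"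
      unfolding f0_def using DG.finprod_reindex[of "t g" ?\<tau> cosets] mult_bij[OF h] tD[OF g]
      by (auto simp: bij_betw_def)
    finally show ?thesis by simp
  qed
  have f0_D: "f0 d = d [^] (card E div card D)" if d: "d \<in> D" for d
  proof -
    have "t d c = d" if c: "c \<in> cosets" for c
    proof -
      have "D #> (d \<otimes> rep c) = D #> rep c"
        by (subst coset_eq) (use d Dc rep_cosets(1)[OF c] Ec in \<open>simp_all add: m_assoc\<close>)
      hence "D #> (d \<otimes> rep c) = c" using rep_cosets c by simp
      thus ?thesis unfolding t_def using d Dc rep_cosets[OF c] Ec by (simp add: m_assoc)
    qed
    hence "f0 d = finprod DG (\<lambda>_. d) cosets" unfolding f0_def by (intro DG.finprod_cong') (use d in auto)
    also have "\<dots> = d [^]\<^bsub>DG\<^esub> card cosets" by (rule DG.finprod_const) (use d in auto)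
    finally show ?thesis by (simp add: nat_pow_def card_cosets)
  qed
  obtain k :: nat where k: "\<And>x. x \<in> D \<Longrightarrow> (x [^] (card E div card D)) [^] k = x"
    using index_inverse by blast
  \<comment> \<open>The exponent \<open>k\<close> undoes the |E:D|-th power that \<open>f0\<close>
    is on D; power maps of the abelian group D respect products and conjugation, so the crossed law
    survives.\<close>
  have "crossed (\<lambda>g. f0 g [^] k)"
    unfolding crossed_def 
    using f0D D_pow f0_mult f0_D k conj_pow Ec Dc cj_D by (simp add: D_pow_mult)
  thus ?thesis using that by blast
qed

text \<open>The quotient \<open>k\<close> of the two maps again satisfies the crossed law, but is
  trivial on D, hence a function on the cosets of D. Multiplying its law over all cosets shows that
  it is a coboundary.\<close>

lemma crossed_conj:
  assumes f: "crossed f" and f': "crossed f'"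
  obtains e where "e \<in> D" "\<And>g. g \<in> E \<Longrightarrow> f' g = cj g (inv e) \<otimes> e \<otimes> f g"
proof -
  define k where "k = (\<lambda>g. f' g \<otimes> inv (f g))"
  have fD: "g \<in> E \<Longrightarrow> f g \<in> D" and f'D: "g \<in> E \<Longrightarrow> f' g \<in> D" for g using f f' by (auto simp: crossed_def)
  have kD: "k g \<in> D" if "g \<in> E" for g using that fD f'D D_closed by (simp add: k_def)
  have k_mult: "k (g \<otimes> h) = cj g (k h) \<otimes> k g" if g: "g \<in> E" and h: "h \<in> E" for g h
  proof -
    have "k (g \<otimes> h) = (cj g (f' h) \<otimes> f' g) \<otimes> inv (cj g (f h) \<otimes> f g)"
      using f f' g h by (simp add: k_def crossed_def)
    also have "\<dots> = cj g (f' h) \<otimes> ((f' g \<otimes> inv (f g)) \<otimes> inv (cj g (f h)))"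
      using fD f'D g h Ec Dc by (simp add: group_simps)
    also have "(f' g \<otimes> inv (f g)) \<otimes> inv (cj g (f h)) = inv (cj g (f h)) \<otimes> (f' g \<otimes> inv (f g))"
      using fD f'D g h Ec D_closed cj_D by (intro comm) auto
    also have "cj g (f' h) \<otimes> (inv (cj g (f h)) \<otimes> (f' g \<otimes> inv (f g))) = cj g (k h) \<otimes> k g"
      unfolding k_def using fD f'D g h Ec Dc by (simp add: group_simps)
    finally show ?thesis .
  qed
  have k_one: "k d = \<one>" if "d \<in> D" for d using that f f' Dc by (simp add: k_def crossed_def)
  have k_coset: "k x = k y" if xy: "x \<in> E" "y \<in> E" "D #> x = D #> y" for x y
  proof -
    have d: "x \<otimes> inv y \<in> D" using xy coset_eq Ec by blast
    have "k x = k ((x \<otimes> inv y) \<otimes> y)" using xy Ec by (simp add: m_assoc)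
    also have "\<dots> = cj (x \<otimes> inv y) (k y) \<otimes> k (x \<otimes> inv y)" using xy d DE' by (intro k_mult) auto
    also have "cj (x \<otimes> inv y) (k y) = k y" using d kD xy by (intro cj_DD) auto
    finally show ?thesis using k_one[OF d] kD[OF xy(2)] Dc by simp
  qed
  define u where "u = finprod DG (\<lambda>c. k (rep c)) cosets"
  have krep: "(\<lambda>c. k (rep c)) \<in> cosets \<rightarrow> D" using kD rep_cosets by auto
  have krep': "c \<in> cosets \<Longrightarrow> k (rep c) \<in> D" for c using kD rep_cosets by auto
  have uD: "u \<in> D" unfolding u_def by (rule finprod_D[OF krep])
  have ku: "u = cj g u \<otimes> k g [^] (card E div card D)" if g: "g \<in> E" for g
  proof -
    let ?\<tau> = "\<lambda>c. D #> (g \<otimes> rep c)"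
    have eq: "k (rep (?\<tau> c)) = cj g (k (rep c)) \<otimes> k g" if c: "c \<in> cosets" for c
    proof -
      have e: "g \<otimes> rep c \<in> E" using g c rep_cosets E_closed by auto
      have "k (rep (?\<tau> c)) = k (g \<otimes> rep c)" using rep[OF e] e by (intro k_coset) auto
      thus ?thesis using k_mult g rep_cosets(1)[OF c] by simp
    qed
    have "u = finprod DG (\<lambda>c. k (rep c)) (?\<tau> ` cosets)"
      using mult_bij[OF g] by (simp add: u_def bij_betw_def)
    also have "\<dots> = finprod DG (\<lambda>c. k (rep (?\<tau> c))) cosets"
      using DG.finprod_reindex[of "\<lambda>c. k (rep c)" ?\<tau> cosets] mult_bij[OF g] krep by (auto simp: bij_betw_def)
    also have "\<dots> = finprod DG (\<lambda>c. cj g (k (rep c)) \<otimes>\<^bsub>DG\<^esub> k g) cosets"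
      by (rule DG.finprod_cong') (use eq krep' kD g cj_D Ec D_closed in auto)
    also have "\<dots> = finprod DG (\<lambda>c. cj g (k (rep c))) cosets \<otimes>\<^bsub>DG\<^esub> finprod DG (\<lambda>c. k g) cosets"
      by (rule DG.finprod_multf) (use krep' kD g cj_D Ec in auto)
    also have "finprod DG (\<lambda>c. cj g (k (rep c))) cosets = cj g u"
      unfolding u_def using cj_finprod[OF cosets_finite Ec[OF g] krep] by simp
    also have "finprod DG (\<lambda>c. k g) cosets = k g [^]\<^bsub>DG\<^esub> card cosets"
      by (rule DG.finprod_const) (use kD g in auto)
    finally show ?thesis by (simp add: nat_pow_def card_cosets)
  qed
  obtain i :: nat where i: "\<And>x. x \<in> D \<Longrightarrow> (x [^] (card E div card D)) [^] i = x"
    using index_inverse by blast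
  \<comment> \<open>By \<open>ku\<close> the |E:D|-th power of \<open>k\<close> is the coboundary of
    \<open>u\<close>; the exponent \<open>i\<close> extracts the |E:D|-th root.\<close>
  define e where "e = u [^] i"
  have eD: "e \<in> D" using uD D_pow by (simp add: e_def)
  have "f' g = cj g (inv e) \<otimes> e \<otimes> f g" if g: "g \<in> E" for g
  proof -
    have "e = cj g e \<otimes> (k g [^] (card E div card D)) [^] i"
      unfolding e_def using g uD kD cj_D Ec Dc D_pow
      by (subst ku[OF g]) (simp add: D_pow_mult conj_pow)
    hence "e = cj g e \<otimes> k g" using i kD[OF g] by simp
    hence "k g = inv (cj g e) \<otimes> e" using kD[OF g] eD Dc Ec g by (metis cj_D inv_solve_left)
    hence "f' g \<otimes> inv (f g) = cj g (inv e) \<otimes> e" using cj_inv Ec[OF g] Dc[OF eD] by (simp add: k_def)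
    thus ?thesis using fD f'D g eD Dc Ec by (metis cj_D inv_solve_right D_closed)
  qed
  thus ?thesis using that eD by blast
qed

text \<open>Take for T the elements that a crossed map sends to \<one>. Transporting the map by
  conjugation with l gives another crossed map, which \<open>crossed_conj\<close> compares with the
  first through some e in D; then e l normalizes T. This is conjugacy of complements in the shape of
  a Frattini argument.\<close>

lemma complement_normalizer:
  obtains T where "subgroup T G" "T \<subseteq> E" "D \<inter> T = {\<one>}" "\<And>x. x \<in> E \<Longrightarrow> \<exists>d\<in>D. \<exists>t\<in>T. x = d \<otimes> t"
    "\<And>l. l \<in> carrier G \<Longrightarrow> \<exists>e\<in>D. e \<otimes> l \<in> normalizer G T"
proof -
  obtain f where f: "crossed f" using crossed_exists by blast
  have fD: "g \<in> E \<Longrightarrow> f g \<in> D" for g using f by (auto simp: crossed_def)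
  have f_mult: "g \<in> E \<Longrightarrow> h \<in> E \<Longrightarrow> f (g \<otimes> h) = cj g (f h) \<otimes> f g" for g h using f by (simp add: crossed_def)
  have f_id: "d \<in> D \<Longrightarrow> f d = d" for d using f by (simp add: crossed_def)
  define T where "T = {g \<in> E. f g = \<one>}"
  have sT: "subgroup T G"
  proof (rule subgroupI)
    show "T \<subseteq> carrier G" using Ec by (auto simp: T_def)
    show "T \<noteq> {}" using f_id[of \<one>] D_closed E_closed by (auto simp: T_def)
    fix a b assume "a \<in> T" "b \<in> T"
    thus "a \<otimes> b \<in> T" using f_mult E_closed Ec by (auto simp: T_def)
  next
    fix a assume a: "a \<in> T"
    hence aE: "a \<in> E" "inv a \<in> E" "f a = \<one>" using E_closed by (auto simp: T_def)
    have "f (inv a \<otimes> a) = cj (inv a) (f a) \<otimes> f (inv a)" using aE f_mult by blast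
    hence "f (inv a) = \<one>" using aE f_id[of \<one>] D_closed(3) fD[OF aE(2)] Ec Dc by simp
    thus "inv a \<in> T" using aE by (simp add: T_def)
  qed
  have DT: "D \<inter> T = {\<one>}" using f_id D_closed subgroup.one_closed[OF sT] by (auto simp: T_def)
  have dec: "\<exists>d\<in>D. \<exists>t\<in>T. x = d \<otimes> t" if x: "x \<in> E" for x
  proof -
    let ?d = "inv (f x)"
    have d: "?d \<in> D" "f x \<in> D" using fD x D_closed by auto
    have "f (?d \<otimes> x) = cj ?d (f x) \<otimes> f ?d" using f_mult x d DE' by blast
    also have "\<dots> = \<one>" using cj_DD[OF d] f_id[OF d(1)] d Dc by simp
    finally have "?d \<otimes> x \<in> T" using x d DE' E_closed by (auto simp: T_def)
    moreover have "x = f x \<otimes> (?d \<otimes> x)" using d x Ec Dc by (simp add: group_simps)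
    ultimately show ?thesis using d by blast
  qed
  have "\<exists>e\<in>D. e \<otimes> l \<in> normalizer G T" if l: "l \<in> carrier G" for l
  proof -
    define f' where "f' = (\<lambda>g. cj l (f (cj (inv l) g)))"
    have li: "inv l \<in> carrier G" using l by simp
    have "crossed f'" unfolding crossed_def
    proof (intro conjI ballI)
      fix g assume g: "g \<in> E"
      have gi: "cj (inv l) g \<in> E" using cj_E[OF li g] .
      show "f' g \<in> D" unfolding f'_def using fD[OF gi] cj_D l by blast
      fix h assume h: "h \<in> E"
      have hi: "cj (inv l) h \<in> E" using cj_E[OF li h] .
      note c = Ec[OF g] Ec[OF h] Dc[OF fD[OF gi]] Dc[OF fD[OF hi]] l
      have "cj (inv l) (g \<otimes> h) = cj (inv l) g \<otimes> cj (inv l) h" using cj_mult[OF li] c by blast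
      hence "f' (g \<otimes> h) = cj l (cj (cj (inv l) g) (f (cj (inv l) h)) \<otimes> f (cj (inv l) g))"
        unfolding f'_def using f_mult[OF gi hi] by simp
      also have "\<dots> = cj g (f' h) \<otimes> f' g"
        unfolding f'_def using c by (simp add: group_simps)
      finally show "f' (g \<otimes> h) = cj g (f' h) \<otimes> f' g" .
    next
      fix d assume d: "d \<in> D"
      have "cj (inv l) d \<in> D" using cj_D[OF li d] .
      thus "f' d = d" unfolding f'_def using f_id d Dc l by (simp add: group_simps)
    qed
    then obtain e where e: "e \<in> D" "\<And>g. g \<in> E \<Longrightarrow> f' g = cj g (inv e) \<otimes> e \<otimes> f g"
      using crossed_conj[OF f] by blast
    \<comment> \<open>As D is abelian, changing \<open>f\<close> by the coboundary of
      \<open>e\<close> is the same as composing it with conjugation by \<open>e\<close>.\<close>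
    have f'f: "f' g = f (cj e g)" if g: "g \<in> E" for g
    proof -
      have ei: "inv e \<in> D" "e \<in> E" "inv e \<in> E" using e D_closed DE' by auto
      have gei: "g \<otimes> inv e \<in> E" using g ei E_closed by blast
      have D3: "cj g (inv e) \<in> D" "f g \<in> D" using ei g fD cj_D Ec by auto
      have "f (cj e g) = f (e \<otimes> (g \<otimes> inv e))" using g e Ec Dc by (simp add: m_assoc)
      also have "\<dots> = cj e (f (g \<otimes> inv e)) \<otimes> f e" using f_mult ei gei by blast
      also have "\<dots> = f (g \<otimes> inv e) \<otimes> e" using cj_DD[OF e(1) fD[OF gei]] f_id e by simp
      also have "f (g \<otimes> inv e) = cj g (inv e) \<otimes> f g" using f_mult[OF g ei(3)] f_id[OF ei(1)] by simp
      also have "cj g (inv e) \<otimes> f g \<otimes> e = cj g (inv e) \<otimes> (e \<otimes> f g)"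
        using comm[OF D3(2) e(1)] D3 e(1) Dc by (simp add: m_assoc)
      finally show ?thesis using e(2)[OF g] D3 Dc e(1) by (simp add: m_assoc)
    qed
    have "cj (e \<otimes> l) t \<in> T" if t: "t \<in> T" for t
    proof -
      have tE: "t \<in> E" "f t = \<one>" using t by (auto simp: T_def)
      have ltE: "cj l t \<in> E" using cj_E l tE by blast
      have "cj (inv l) (cj l t) = t" using tE Ec l by (simp add: group_simps)
      hence "f' (cj l t) = \<one>" unfolding f'_def using tE l by simp
      hence "f (cj e (cj l t)) = \<one>" using f'f ltE by simp
      moreover have "cj e (cj l t) \<in> E" using cj_E[OF Dc[OF e(1)] ltE] .
      ultimately show ?thesis using cj_cj[OF Dc[OF e(1)] l] tE Ec by (simp add: T_def)
    qed
    thus ?thesis using e(1) Dc l mem_normalizer_iff[OF fin subgroup.subset[OF sT]] by (intro bexI[of _ e]) auto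
  qed
  thus ?thesis using that[of T] sT DT dec by (auto simp: T_def)
qed

end

context group
begin

text \<open>A form of Gaschuetz' theorem: a complement of \<open>D\<close> in \<open>E\<close> would be normal by the Frattini argument.\<close>

lemma minimal_normal_not_Frattini:
  assumes fin: "finite (carrier G)" and D: "D \<lhd> G"
    and min: "\<And>N. N \<lhd> G \<Longrightarrow> N \<subseteq> D \<Longrightarrow> N = {\<one>} \<or> N = D"
    and \<Phi>: "\<And>M. maximal_subgroup G M \<Longrightarrow> D \<subseteq> M"
    and E: "E \<lhd> G" "D \<subseteq> E" and q: "Factorial_Ring.prime (q::nat)" "q dvd card D"
    and ED: "\<And>x. x \<in> E \<Longrightarrow> \<exists>m. \<not> q dvd m \<and> x [^] m \<in> D"
    and gen: "E \<subseteq> generate G {x \<in> E. pi_elt G (-{q}) x}"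
  shows False
proof -
  have sD: "subgroup D G" and sE: "subgroup E G" using D E(1) normal_imp_subgroup by auto
  note Dc = subgroup.mem_carrier[OF sD] and Ec = subgroup.mem_carrier[OF sE]
  have D1: "D \<noteq> {\<one>}" using q by auto
  obtain Q a m where Q: "subgroup Q G" "Q \<subseteq> D" "card Q = q ^ a" "card D = q ^ a * m" "\<not> q dvd m"
    "\<And>g. g \<in> carrier G \<Longrightarrow> \<exists>n\<in>D. n \<otimes> g \<in> normalizer G Q"
    using Frattini_argument[OF fin D q(1)] by blast
  \<comment> \<open>The normalizer of the Sylow subgroup Q supplements D, so it is all of G. Thus Q
    is normal, and minimality makes D equal to Q, a q-group.\<close>
  have "normalizer G Q = carrier G"
    by (rule Frattini_subgroup_supplement[OF fin \<Phi> subgroup.subset[OF sD]])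
      (use Q(6) subgroup_normalizer[OF subgroup.subset[OF Q(1)]] in auto)
  hence "Q \<lhd> G" using normal_of_normalizer[OF fin Q(1)] by simp
  moreover have "Q \<noteq> {\<one>}"
  proof
    assume "Q = {\<one>}"
    hence "card D = m" using Q(3,4) by simp
    thus False using Q(5) q(2) by simp
  qed
  ultimately have "Q = D" using min Q(2) by blast
  hence cardD: "card D = q ^ a" using Q(3) by simp
  \<comment> \<open>The centre of D is nontrivial and normal in G, so by minimality D is
    abelian.\<close>
  let ?Z = "{z \<in> D. \<forall>x\<in>D. x \<otimes> z \<otimes> inv x = z}"
  have sZ: "subgroup ?Z G"
  proof (rule subgroupI)
    fix a b assume ab: "a \<in> ?Z" "b \<in> ?Z"
    have "x \<otimes> (a \<otimes> b) \<otimes> inv x = a \<otimes> b" if "x \<in> D" for x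
    proof -
      have "x \<otimes> (a \<otimes> b) \<otimes> inv x = (x \<otimes> a \<otimes> inv x) \<otimes> (x \<otimes> b \<otimes> inv x)"
        using that ab Dc by (simp add: group_simps)
      thus ?thesis using ab that by simp
    qed
    thus "a \<otimes> b \<in> ?Z" using ab subgroup.m_closed[OF sD] by auto
  next
    fix a assume a: "a \<in> ?Z"
    have "x \<otimes> inv a \<otimes> inv x = inv a" if "x \<in> D" for x
    proof -
      have "x \<otimes> inv a \<otimes> inv x = inv (x \<otimes> a \<otimes> inv x)"
        using that a Dc by (simp add: group_simps)
      thus ?thesis using a that by simp
    qed
    thus "inv a \<in> ?Z" using a subgroup.m_inv_closed[OF sD] by auto
  qed (use Dc subgroup.one_closed[OF sD] in auto)
  have "?Z \<lhd> G"
  proof (rule normalI'[OF sZ])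
    fix g z assume g: "g \<in> carrier G" and z: "z \<in> ?Z"
    have "x \<otimes> (g \<otimes> z \<otimes> inv g) \<otimes> inv x = g \<otimes> z \<otimes> inv g" if x: "x \<in> D" for x
    proof -
      let ?y = "inv g \<otimes> x \<otimes> inv (inv g)"
      have "?y \<in> D" using normal_closed[OF D inv_closed[OF g] x] .
      hence "?y \<otimes> z \<otimes> inv ?y = z" using z by blast
      moreover have "x \<otimes> (g \<otimes> z \<otimes> inv g) \<otimes> inv x = g \<otimes> (?y \<otimes> z \<otimes> inv ?y) \<otimes> inv g"
        using x z g Dc by (simp add: group_simps)
      ultimately show ?thesis by simp
    qed
    thus "g \<otimes> z \<otimes> inv g \<in> ?Z" using z normal_closed[OF D g] by auto
  qed
  hence Z: "?Z = D" using min[of ?Z] p_group_centre_nontrivial[OF fin sD cardD D1 q(1)] by blast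
  have comm: "x \<otimes> y = y \<otimes> x" if "x \<in> D" "y \<in> D" for x y
  proof -
    have "y \<in> ?Z" using that Z by simp
    hence "x \<otimes> y \<otimes> inv x \<otimes> x = y \<otimes> x" using that by simp
    thus ?thesis using that Dc by (simp add: m_assoc)
  qed
  let ?E = "G\<lparr>carrier := E\<rparr>"
  interpret E: group ?E using sE subgroup_imp_group by blast
  have finE: "finite (carrier ?E)" using finite_subgroup[OF fin sE] by simp
  obtain P b where P: "subgroup P ?E" "card P = q ^ b" "\<not> q dvd card (rcosets\<^bsub>?E\<^esub> P)"
    using E.Sylow_exists[OF finE q(1)] by blast
  have sP: "subgroup P G" using incl_subgroup[OF sE P(1)] .
  \<comment> \<open>By \<open>ED\<close> the order of an element modulo D is prime to q, so a Sylow
    q-subgroup of E lies inside D. Hence |E:D| is prime to q and D has a complement in E.\<close>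
  have PD: "P \<subseteq> D"
  proof
    fix x assume x: "x \<in> P"
    have "x \<in> E" using subgroup.subset[OF P(1)] x by auto
    then obtain m where m: "\<not> q dvd m" "x [^] m \<in> D" using ED by blast
    have "pi_num {q} (card P)" using P(2) q by (simp add: pi_num_prime_power)
    hence "pi_elt G {q} x" using pi_elt_of_card[OF sP fin _ x] by blast
    moreover have "pi_num (-{q}) m" using m(1) pi_num_compl_singleton[OF q(1)] by (cases m) auto
    ultimately show "x \<in> D" using pi_elt_mem[OF sD Ec[OF \<open>x \<in> E\<close>] _ m(2)] by blast
  qed
  have PE: "card (rcosets\<^bsub>?E\<^esub> P) * card P = card E" using E.index_mult_card[OF finE P(1)] by simp
  have "card D dvd card E" using card_subgroup_dvd[OF sE sD E(2)] .
  then obtain j where j: "card E = card D * j" by auto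
  have "card P dvd card D" using card_subgroup_dvd[OF sD sP PD] .
  then obtain i where i: "card D = card P * i" by auto
  have "card P > 0" using card_subgroup_pos[OF fin sP] .
  hence "card (rcosets\<^bsub>?E\<^esub> P) = i * j" using PE i j by (simp add: mult.commute mult.left_commute)
  hence "\<not> q dvd j" using P(3) by auto
  moreover have "card E div card D = j" using j card_subgroup_pos[OF fin sD] by simp
  ultimately have cop: "coprime (card D) (card E div card D)"
    unfolding cardD using q(1) by (simp add: prime_imp_coprime)
  interpret coprime_abelian_normal G D E
    by (intro coprime_abelian_normal.intro coprime_abelian_normal_axioms.intro group_axioms fin D E comm cop)
  obtain T where T: "subgroup T G" "T \<subseteq> E" "D \<inter> T = {\<one>}" "\<And>x. x \<in> E \<Longrightarrow> \<exists>d\<in>D. \<exists>t\<in>T. x = d \<otimes> t"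
    "\<And>l. l \<in> carrier G \<Longrightarrow> \<exists>e\<in>D. e \<otimes> l \<in> normalizer G T"
    using complement_normalizer by blast
  have "normalizer G T = carrier G"
    by (rule Frattini_subgroup_supplement[OF fin \<Phi> subgroup.subset[OF sD]])
      (use T(5) subgroup_normalizer[OF subgroup.subset[OF T(1)]] in auto)
  hence nT: "T \<lhd> G" using normal_of_normalizer[OF fin T(1)] by simp
  note Tc = subgroup.mem_carrier[OF T(1)]
  \<comment> \<open>D and T are normal and meet trivially, so they commute elementwise, and for x =
    d t the |D|-th power lies in T. Since |D| is a power of q, a q'-element x lies in T itself. Then
    \<open>gen\<close> puts E, and so D, into the complement T of D.\<close>
  have "{x \<in> E. pi_elt G (-{q}) x} \<subseteq> T"
  proof clarify
    fix x assume x: "x \<in> E" "pi_elt G (-{q}) x"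
    then obtain d t where dt: "d \<in> D" "t \<in> T" "x = d \<otimes> t" using T(4) by blast
    have "d \<otimes> (t \<otimes> inv d \<otimes> inv t) \<in> D"
      using dt Tc normal_closed[OF D Tc[OF dt(2)], of "inv d"] D_closed by simp
    moreover have "(d \<otimes> t \<otimes> inv d) \<otimes> inv t \<in> T" 
      using normal_closed[OF nT Dc[OF dt(1)] dt(2)] dt T(1) by (simp add: subgroup.m_closed subgroup.m_inv_closed)
    moreover have "d \<otimes> (t \<otimes> inv d \<otimes> inv t) = (d \<otimes> t \<otimes> inv d) \<otimes> inv t" using dt Dc Tc by (simp add: m_assoc)
    ultimately have "(d \<otimes> t \<otimes> inv d) \<otimes> inv t = \<one>" using T(3) by auto
    hence "(d \<otimes> t) \<otimes> inv (t \<otimes> d) = \<one>" using dt Dc Tc by (simp add: group_simps)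
    hence "d \<otimes> t = t \<otimes> d" using dt Dc Tc by (metis m_closed inv_closed inv_equality inv_inv)
    hence "x [^] card D = d [^] card D \<otimes> t [^] card D"
      unfolding dt(3) by (rule pow_mult_distrib) (use dt Dc Tc in auto)
    also have "\<dots> = t [^] card D" using D_pow_card[OF dt(1)] dt Tc by simp
    finally have "x [^] card D \<in> T" using subgroup_nat_pow[OF T(1) dt(2)] by simp
    moreover have "pi_num (-(-{q})) (card D)" using cardD q(1) by (simp add: pi_num_prime_power)
    ultimately show "x \<in> T" using pi_elt_mem[OF T(1) Ec[OF x(1)] x(2)] by blast
  qed
  hence "generate G {x \<in> E. pi_elt G (-{q}) x} \<subseteq> T"
    using generate_subgroup_incl[OF _ T(1)] by blast
  hence "D \<subseteq> T" using gen DE by blast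
  thus False using T(3) D1 by blast
qed

end

section \<open>Residuals\<close>

definition pi_residual :: "('a, 'b) monoid_scheme \<Rightarrow> nat set \<Rightarrow> 'a set \<Rightarrow> 'a set" where
  "pi_residual G s L = generate G {x \<in> L. pi_elt G (-s) x}"

definition sigma_residual :: "nat set set \<Rightarrow> ('a, 'b) monoid_scheme \<Rightarrow> 'a set \<Rightarrow> 'a set" where
  "sigma_residual \<sigma> G L = L \<inter> (\<Inter>s\<in>\<sigma>. pi_residual G s L)"

abbreviation primes_partition :: "nat set set \<Rightarrow> bool" where
  "primes_partition \<sigma> \<equiv> partition_on {p::nat. Factorial_Ring.prime p} \<sigma>"

lemma block_exists:
  assumes "primes_partition \<sigma>" "Factorial_Ring.prime (p::nat)" obtains s where "s \<in> \<sigma>" "p \<in> s"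
  using assms by (auto simp: partition_on_def)

lemma block_disjoint:
  assumes "primes_partition \<sigma>" "s \<in> \<sigma>" "t \<in> \<sigma>" "s \<noteq> t" shows "s \<subseteq> -t"
  using assms unfolding partition_on_def disjoint_def by blast

lemma block_nonempty:
  assumes "primes_partition \<sigma>" shows "\<sigma> \<noteq> {}"
  using block_exists[OF assms two_is_prime_nat] by blast

context group
begin

lemma pi_residual_consistent:
  assumes "subgroup H G" "L \<subseteq> H" shows "pi_residual (G\<lparr>carrier := H\<rparr>) s L = pi_residual G s L"
  unfolding pi_residual_def using generate_consistent[of "{x \<in> L. pi_elt G (-s) x}" H] assms by auto

lemma sigma_residual_consistent:
  assumes "subgroup H G" "L \<subseteq> H" shows "sigma_residual \<sigma> (G\<lparr>carrier := H\<rparr>) L = sigma_residual \<sigma> G L"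
  unfolding sigma_residual_def using pi_residual_consistent[OF assms] by auto

lemma subgroup_pi_residual: "L \<subseteq> carrier G \<Longrightarrow> subgroup (pi_residual G s L) G"
  unfolding pi_residual_def by (rule generate_is_subgroup) auto

lemma pi_residual_mem: "x \<in> L \<Longrightarrow> pi_elt G (-s) x \<Longrightarrow> x \<in> pi_residual G s L"
  unfolding pi_residual_def by (rule generate.incl) auto

lemma pi_residual_least:
  "subgroup K G \<Longrightarrow> (\<And>x. x \<in> L \<Longrightarrow> pi_elt G (-s) x \<Longrightarrow> x \<in> K) \<Longrightarrow> pi_residual G s L \<subseteq> K"
  unfolding pi_residual_def by (rule generate_subgroup_incl) auto

lemma pi_residual_subset: "subgroup L G \<Longrightarrow> pi_residual G s L \<subseteq> L"
  by (rule pi_residual_least)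

lemma pi_residual_mono: "K \<subseteq> L \<Longrightarrow> pi_residual G s K \<subseteq> pi_residual G s L"
  unfolding pi_residual_def by (rule mono_generate) auto

lemma pi_residual_conj:
  assumes L: "L \<subseteq> carrier G" and g: "g \<in> carrier G" "\<And>x. x \<in> L \<Longrightarrow> g \<otimes> x \<otimes> inv g \<in> L"
    and x: "x \<in> pi_residual G s L"
  shows "g \<otimes> x \<otimes> inv g \<in> pi_residual G s L"
  using x unfolding pi_residual_def
proof (induction x rule: generate.induct)
  case one
  thus ?case using g by (simp add: generate.one)
next
  case (incl h)
  thus ?case using g L by (intro generate.incl) (auto intro: pi_elt_conj)
next
  case (inv h)
  hence h: "h \<in> carrier G" "g \<otimes> h \<otimes> inv g \<in> {x \<in> L. pi_elt G (-s) x}"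
    using g L by (auto intro: pi_elt_conj)
  have "inv (g \<otimes> h \<otimes> inv g) \<in> generate G {x \<in> L. pi_elt G (-s) x}" using h(2) by (rule generate.inv)
  thus ?case using h g by (simp add: group_simps)
next
  case (eng a b)
  have "{x \<in> L. pi_elt G (-s) x} \<subseteq> carrier G" using L by auto
  hence ab: "a \<in> carrier G" "b \<in> carrier G" using eng(1,2) generate_in_carrier by blast+
  have "g \<otimes> (a \<otimes> b) \<otimes> inv g = (g \<otimes> a \<otimes> inv g) \<otimes> (g \<otimes> b \<otimes> inv g)" using ab g by (simp add: group_simps)
  thus ?case using eng by (simp add: generate.eng)
qed

lemma normal_pi_residual:
  assumes "L \<lhd> G" shows "pi_residual G s L \<lhd> G"
proof (rule normalI')
  have L: "L \<subseteq> carrier G" using assms normal_imp_subgroup subgroup.subset by blast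
  show "subgroup (pi_residual G s L) G" using subgroup_pi_residual[OF L] .
  show "g \<otimes> x \<otimes> inv g \<in> pi_residual G s L" if "g \<in> carrier G" "x \<in> pi_residual G s L" for g x
    using pi_residual_conj[OF L that(1) _ that(2)] normal_closed[OF assms that(1)] by blast
qed

lemma subgroup_sigma_residual:
  assumes "subgroup L G" shows "subgroup (sigma_residual \<sigma> G L) G"
proof -
  have "sigma_residual \<sigma> G L = \<Inter> (insert L ((\<lambda>s. pi_residual G s L) ` \<sigma>))"
    by (auto simp: sigma_residual_def)
  moreover have "subgroup (\<Inter> (insert L ((\<lambda>s. pi_residual G s L) ` \<sigma>))) G"
    using assms subgroup_pi_residual[OF subgroup.subset[OF assms]] by (intro subgroups_Inter) auto
  ultimately show ?thesis by simp
qed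

lemma sigma_residual_subset: "sigma_residual \<sigma> G L \<subseteq> L"
  by (simp add: sigma_residual_def)

lemma sigma_residual_mono: "K \<subseteq> L \<Longrightarrow> sigma_residual \<sigma> G K \<subseteq> sigma_residual \<sigma> G L"
  unfolding sigma_residual_def using pi_residual_mono[of K L] by (intro Int_mono INT_anti_mono) auto

lemma normal_sigma_residual:
  assumes "L \<lhd> G" shows "sigma_residual \<sigma> G L \<lhd> G"
proof (rule normalI')
  have L: "subgroup L G" using assms normal_imp_subgroup by blast
  show "subgroup (sigma_residual \<sigma> G L) G" using subgroup_sigma_residual[OF L] .
  show "g \<otimes> x \<otimes> inv g \<in> sigma_residual \<sigma> G L" if "g \<in> carrier G" "x \<in> sigma_residual \<sigma> G L" for g x
    using that normal_closed[OF assms that(1)] pi_residual_conj[OF subgroup.subset[OF L] that(1)]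
    by (auto simp: sigma_residual_def)
qed

lemma one_in_sigma_residual: "subgroup L G \<Longrightarrow> \<one> \<in> sigma_residual \<sigma> G L"
  using subgroup_sigma_residual subgroup.one_closed by blast

text \<open>The s'-part of x is itself a generator of the residual, and a suitable s-number m kills
  the s-part. So L/O^s(L) is an s-group, expressed through powers.\<close>

lemma pow_in_pi_residual:
  assumes fin: "finite (carrier G)" and L: "subgroup L G" and x: "x \<in> L"
  obtains m where "pi_num s m" "x [^] m \<in> pi_residual G s L"
proof -
  have xc: "x \<in> carrier G" using x L subgroup.mem_carrier by metis
  obtain i j :: nat where ij: "x = x [^] i \<otimes> x [^] j" "pi_elt G s (x [^] i)" "pi_elt G (-s) (x [^] j)"
    "\<And>m::nat. x [^] m = (x [^] i) [^] m \<otimes> (x [^] j) [^] m"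
    using pi_elt_split[OF fin xc] by blast
  obtain m where m: "pi_num s m" "(x [^] i) [^] m = \<one>" using ij(2) unfolding pi_elt_def by blast
  have "x [^] m = (x [^] i) [^] m \<otimes> (x [^] j) [^] m" by (rule ij(4))
  also have "\<dots> = (x [^] j) [^] m" using m xc by simp
  finally have "x [^] m = (x [^] j) [^] m" .
  moreover have "x [^] j \<in> pi_residual G s L"
    using pi_residual_mem[of "x [^] j" L s] ij(3) subgroup_nat_pow[OF L x] by blast
  ultimately show ?thesis using that[OF m(1)] subgroup_nat_pow[OF subgroup_pi_residual[OF subgroup.subset[OF L]]] by simp
qed

text \<open>The s-part of x has order prime to every other block t, so it lies in each O^t(L); it
  lies in O^s(L) as a power of x. Killing the s'-part therefore lands in D(L): O^s(L)/D(L) is an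
  s'-group.\<close>

lemma pow_pi_residual_in_sigma_residual:
  assumes fin: "finite (carrier G)" and \<sigma>: "primes_partition \<sigma>" "s \<in> \<sigma>" and L: "subgroup L G"
    and x: "x \<in> pi_residual G s L"
  obtains m where "pi_num (-s) m" "x [^] m \<in> sigma_residual \<sigma> G L"
proof -
  have xL: "x \<in> L" using x pi_residual_subset[OF L] by blast
  have xc: "x \<in> carrier G" using xL L subgroup.mem_carrier by metis
  obtain i j :: nat where ij: "x = x [^] i \<otimes> x [^] j" "pi_elt G s (x [^] i)" "pi_elt G (-s) (x [^] j)"
    "\<And>m::nat. x [^] m = (x [^] i) [^] m \<otimes> (x [^] j) [^] m"
    using pi_elt_split[OF fin xc] by blast
  obtain m where m: "pi_num (-s) m" "(x [^] j) [^] m = \<one>" using ij(3) unfolding pi_elt_def by blast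
  have "x [^] m = (x [^] i) [^] m \<otimes> (x [^] j) [^] m" by (rule ij(4))
  also have "\<dots> = (x [^] i) [^] m" using m xc by simp
  finally have eq: "x [^] m = (x [^] i) [^] m" .
  have iL: "x [^] i \<in> L" using subgroup_nat_pow[OF L xL] .
  have "x [^] i \<in> pi_residual G t L" if t: "t \<in> \<sigma>" for t
  proof (cases "t = s")
    case True
    thus ?thesis using subgroup_nat_pow[OF subgroup_pi_residual[OF subgroup.subset[OF L]] x] by simp
  next
    case False
    hence "pi_elt G (-t) (x [^] i)" using pi_elt_mono[OF ij(2)] block_disjoint[OF \<sigma>(1,2) t] by blast
    thus ?thesis using pi_residual_mem iL by blast
  qed
  hence "x [^] i \<in> sigma_residual \<sigma> G L" using iL by (simp add: sigma_residual_def)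
  hence "x [^] m \<in> sigma_residual \<sigma> G L" unfolding eq
    using subgroup_nat_pow[OF subgroup_sigma_residual[OF L]] by blast
  thus ?thesis using that m by blast
qed

section \<open>Quotients: images, preimages and maximal subgroups\<close>

lemma group_hom_Mod: "N \<lhd> G \<Longrightarrow> group_hom G (G Mod N) (\<lambda>x. N #> x)"
  using normal.factorgroup_is_group normal.r_coset_hom_Mod 
  by (intro group_hom.intro group_hom_axioms.intro group_axioms)

lemma card_coset_image:
  assumes H: "subgroup H G" and N: "subgroup N G" "N \<subseteq> H"
  shows "card ((\<lambda>x. N #> x) ` H) * card N = card H"
proof -
  let ?H = "G\<lparr>carrier := H\<rparr>"
  interpret H: group ?H using H subgroup_imp_group by blast
  have "subgroup N ?H" using subgroup_incl[OF N(1) H N(2)] .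
  hence "card (rcosets\<^bsub>?H\<^esub> N) * card N = card H" using H.lagrange by (simp add: order_def)
  moreover have "rcosets\<^bsub>?H\<^esub> N = (\<lambda>x. N #> x) ` H" by (auto simp: RCOSETS_def)
  ultimately show ?thesis by simp
qed

lemma coset_image_mem_iff:
  assumes H: "subgroup H G" and N: "subgroup N G" "N \<subseteq> H" and x: "x \<in> carrier G"
  shows "N #> x \<in> (\<lambda>x. N #> x) ` H \<longleftrightarrow> x \<in> H"
proof
  assume "N #> x \<in> (\<lambda>x. N #> x) ` H"
  then obtain h where h: "h \<in> H" "N #> x = N #> h" by auto
  have hc: "h \<in> carrier G" using h(1) H subgroup.mem_carrier by metis
  have "x \<otimes> inv h \<in> H" using r_coset_eq_iff[OF N(1) x hc] h N(2) by auto
  hence "x \<otimes> inv h \<otimes> h \<in> H" using h(1) H subgroup.m_closed by metis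
  thus "x \<in> H" using x hc by (simp add: m_assoc)
qed auto

lemma preimage_subgroup:
  assumes N: "N \<lhd> G" and K: "subgroup K (G Mod N)"
  shows "subgroup {x \<in> carrier G. N #> x \<in> K} G" "N \<subseteq> {x \<in> carrier G. N #> x \<in> K}"
    "(\<lambda>x. N #> x) ` {x \<in> carrier G. N #> x \<in> K} = K"
    "K \<lhd> (G Mod N) \<Longrightarrow> {x \<in> carrier G. N #> x \<in> K} \<lhd> G"
proof -
  interpret h: group_hom G "G Mod N" "\<lambda>x. N #> x" using group_hom_Mod[OF N] .
  have sN: "subgroup N G" using N normal_imp_subgroup by blast
  let ?P = "{x \<in> carrier G. N #> x \<in> K}"
  show s: "subgroup ?P G"
  proof (rule subgroupI)
    show "?P \<noteq> {}" using subgroup.one_closed[OF K] h.hom_one by (auto intro!: exI[of _ \<one>])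
    fix a assume a: "a \<in> ?P"
    have "N #> inv a = inv\<^bsub>G Mod N\<^esub> (N #> a)" using a h.hom_inv[of a] by simp
    thus "inv a \<in> ?P" using a subgroup.m_inv_closed[OF K] by simp
    fix b assume b: "b \<in> ?P"
    have "N #> (a \<otimes> b) = (N #> a) \<otimes>\<^bsub>G Mod N\<^esub> (N #> b)" using a b h.hom_mult by auto
    thus "a \<otimes> b \<in> ?P" using a b subgroup.m_closed[OF K] by simp
  qed auto
  have "N #> x = N" if "x \<in> N" for x using coset_join2[OF _ sN that] subgroup.mem_carrier[OF sN that] by simp
  moreover have "N \<in> K" using subgroup.one_closed[OF K] by simp
  ultimately show "N \<subseteq> ?P" using subgroup.mem_carrier[OF sN] by auto
  show "(\<lambda>x. N #> x) ` ?P = K"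
    using subgroup.subset[OF K] by (auto simp: carrier_FactGroup)
  assume K': "K \<lhd> (G Mod N)"
  show "?P \<lhd> G"
  proof (rule normalI'[OF s])
    fix g x assume g: "g \<in> carrier G" and x: "x \<in> ?P"
    have "N #> (g \<otimes> x \<otimes> inv g) = (N #> g) \<otimes>\<^bsub>G Mod N\<^esub> (N #> x) \<otimes>\<^bsub>G Mod N\<^esub> inv\<^bsub>G Mod N\<^esub> (N #> g)"
      using g x h.hom_mult h.hom_inv by simp
    thus "g \<otimes> x \<otimes> inv g \<in> ?P" using h.H.normal_closed[OF K', of "N #> g" "N #> x"] g x h.hom_closed by auto
  qed
qed

lemma image_normal:
  assumes N: "N \<lhd> G" and H: "H \<lhd> G"
  shows "(\<lambda>x. N #> x) ` H \<lhd> (G Mod N)"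
proof -
  interpret h: group_hom G "G Mod N" "\<lambda>x. N #> x" using group_hom_Mod[OF N] .
  have sH: "subgroup H G" using H normal_imp_subgroup by blast
  show ?thesis
  proof (rule h.H.normalI')
    show "subgroup ((\<lambda>x. N #> x) ` H) (G Mod N)" using h.subgroup_img_is_subgroup[OF sH] .
    fix g x assume "g \<in> carrier (G Mod N)" and "x \<in> (\<lambda>x. N #> x) ` H"
    then obtain a b where ab: "a \<in> carrier G" "g = N #> a" "b \<in> H" "x = N #> b" by (auto simp: carrier_FactGroup)
    have bc: "b \<in> carrier G" using ab sH subgroup.mem_carrier by metis
    have "N #> (a \<otimes> b \<otimes> inv a) = g \<otimes>\<^bsub>G Mod N\<^esub> x \<otimes>\<^bsub>G Mod N\<^esub> inv\<^bsub>G Mod N\<^esub> g"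
      using ab bc h.hom_mult h.hom_inv by simp
    thus "g \<otimes>\<^bsub>G Mod N\<^esub> x \<otimes>\<^bsub>G Mod N\<^esub> inv\<^bsub>G Mod N\<^esub> g \<in> (\<lambda>x. N #> x) ` H"
      using normal_closed[OF H ab(1,3)] by (metis imageI)
  qed
qed

lemma maximal_preimage:
  assumes N: "N \<lhd> G" and M: "maximal_subgroup (G Mod N) M"
  shows "maximal_subgroup G {x \<in> carrier G. N #> x \<in> M}"
proof -
  interpret h: group_hom G "G Mod N" "\<lambda>x. N #> x" using group_hom_Mod[OF N] .
  have sN: "subgroup N G" using N normal_imp_subgroup by blast
  have sM: "subgroup M (G Mod N)" and Mp: "M \<subset> carrier (G Mod N)" and
    max: "\<And>L. subgroup L (G Mod N) \<Longrightarrow> M \<subset> L \<Longrightarrow> \<not> L \<subset> carrier (G Mod N)"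
    using M unfolding maximal_subgroup_def by auto
  note pre = preimage_subgroup[OF N sM]
  let ?P = "{x \<in> carrier G. N #> x \<in> M}"
  have "?P \<noteq> carrier G" using pre(3) Mp by (auto simp: carrier_FactGroup)
  moreover have "\<not> (\<exists>L. subgroup L G \<and> ?P \<subset> L \<and> L \<subset> carrier G)"
  proof
    assume "\<exists>L. subgroup L G \<and> ?P \<subset> L \<and> L \<subset> carrier G"
    then obtain L where L: "subgroup L G" "?P \<subset> L" "L \<subset> carrier G" by blast
    have NL: "N \<subseteq> L" using pre(2) L(2) by blast
    let ?L = "(\<lambda>x. N #> x) ` L"
    have sL: "subgroup ?L (G Mod N)" using h.subgroup_img_is_subgroup[OF L(1)] .
    obtain x where x: "x \<in> L" "x \<notin> ?P" using L(2) by blast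
    hence "N #> x \<notin> M" using subgroup.mem_carrier[OF L(1)] by blast
    hence "M \<subset> ?L" using pre(3) L(2) x(1) by blast
    moreover obtain y where y: "y \<in> carrier G" "y \<notin> L" using L(3) by blast
    hence "N #> y \<notin> ?L" using coset_image_mem_iff[OF L(1) sN NL y(1)] by blast
    hence "?L \<subset> carrier (G Mod N)" using y(1) L(3) by (auto simp: carrier_FactGroup)
    ultimately show False using max[OF sL] by blast
  qed
  ultimately show ?thesis unfolding maximal_subgroup_def using pre(1) by auto
qed

lemma hom_pow_Mod: "N \<lhd> G \<Longrightarrow> x \<in> carrier G \<Longrightarrow> (N #> x) [^]\<^bsub>G Mod N\<^esub> (n::nat) = N #> (x [^] n)"
  using group_hom.hom_nat_pow[OF group_hom_Mod] by metis

text \<open>This contains the saturation of the formation of \<open>\<sigma>\<close>-nilpotent groups, stated through elements.\<close>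

lemma sigma_residual_trivial:
  assumes fin: "finite (carrier G)" and \<sigma>: "primes_partition \<sigma>"
    and good: "\<And>M. maximal_subgroup G M \<Longrightarrow> \<exists>s\<in>\<sigma>. \<forall>x\<in>carrier G. pi_elt G (-s) x \<longrightarrow> x \<in> M"
  shows "sigma_residual \<sigma> G (carrier G) = {\<one>}"
proof (rule ccontr)
  let ?D = "sigma_residual \<sigma> G (carrier G)"
  assume D1: "?D \<noteq> {\<one>}"
  have nD: "?D \<lhd> G" using normal_sigma_residual[OF normal_self] .
  have sD: "subgroup ?D G" using nD normal_imp_subgroup by blast
  \<comment> \<open>Factoring out a largest normal subgroup of G properly inside D(G) makes the
    image of D(G) a minimal normal subgroup, as \<open>minimal_normal_not_Frattini\<close>
    requires.\<close>
  let ?S = "{N. N \<lhd> G \<and> N \<subset> ?D}"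
  have "{\<one>} \<in> ?S" using one_is_normal D1 subgroup.one_closed[OF sD] by auto
  moreover have "?S \<subseteq> Pow ?D" by auto
  hence "finite ?S" using finite_subgroup[OF fin sD] by (meson finite_Pow_iff finite_subset)
  ultimately obtain N where N: "N \<in> ?S" "\<And>L. L \<in> ?S \<Longrightarrow> N \<subseteq> L \<Longrightarrow> N = L"
    using finite_has_maximal[of ?S] by auto
  hence nN: "N \<lhd> G" and ND: "N \<subset> ?D" by auto
  have sN: "subgroup N G" using nN normal_imp_subgroup by blast
  let ?\<phi> = "\<lambda>x. N #> x"
  interpret h: group_hom G "G Mod N" ?\<phi> using group_hom_Mod[OF nN] .
  have card: "card (?\<phi> ` ?D) * card N = card ?D" using card_coset_image[OF sD sN] ND by blast
  have "card N < card ?D" using psubset_card_mono[OF finite_subgroup[OF fin sD] ND] .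
  hence "card (?\<phi> ` ?D) \<noteq> 1" using card by auto
  then obtain q where q: "Factorial_Ring.prime q" "q dvd card (?\<phi> ` ?D)" using prime_factor_nat by blast
  \<comment> \<open>For the block s of q, \<open>?E\<close> meets both requirements: elements of
    \<open>?E\<close> have powers with exponent prime to q in D(G), and \<open>?E\<close> is
    generated by s'-elements, which are q'-elements.\<close>
  obtain s where s: "s \<in> \<sigma>" "q \<in> s" using block_exists[OF \<sigma> q(1)] .
  let ?E = "pi_residual G s (carrier G)"
  have nE: "?E \<lhd> G" using normal_pi_residual[OF normal_self] .
  have sE: "subgroup ?E G" using nE normal_imp_subgroup by blast
  have DE: "?D \<subseteq> ?E" using s(1) by (auto simp: sigma_residual_def)
  show False
  proof (rule h.H.minimal_normal_not_Frattini[of "?\<phi> ` ?D" "?\<phi> ` ?E" q])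
    show "finite (carrier (G Mod N))" using fin by (simp add: carrier_FactGroup)
    show "?\<phi> ` ?D \<lhd> G Mod N" using image_normal[OF nN nD] .
    show "?\<phi> ` ?E \<lhd> G Mod N" using image_normal[OF nN nE] .
    show "?\<phi> ` ?D \<subseteq> ?\<phi> ` ?E" using DE by blast
    show "Factorial_Ring.prime q" "q dvd card (?\<phi> ` ?D)" using q by auto
  next
    fix K assume K: "K \<lhd> G Mod N" "K \<subseteq> ?\<phi> ` ?D"
    have sK: "subgroup K (G Mod N)" using K normal_imp_subgroup by blast
    note pre = preimage_subgroup[OF nN sK]
    let ?P = "{x \<in> carrier G. N #> x \<in> K}"
    have "?P \<subseteq> ?D" using coset_image_mem_iff[OF sD sN] K(2) ND by blast
    hence "?P = ?D \<or> ?P \<in> ?S" using pre(4)[OF K(1)] by blast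
    hence PDN: "?P = ?D \<or> ?P = N" using N(2)[of ?P] pre(2) by auto
    have phiN: "?\<phi> ` N = {\<one>\<^bsub>G Mod N\<^esub>}"
      using subgroup.one_closed[OF sN] coset_join2[OF _ sN] subgroup.mem_carrier[OF sN] by auto
    from PDN show "K = {\<one>\<^bsub>G Mod N\<^esub>} \<or> K = ?\<phi> ` ?D"
    proof
      assume "?P = ?D" thus ?thesis using pre(3) by simp
    next
      assume "?P = N" thus ?thesis using pre(3) phiN by simp
    qed
  next
    fix M assume M: "maximal_subgroup (G Mod N) M"
    let ?P = "{x \<in> carrier G. N #> x \<in> M}"
    have mP: "maximal_subgroup G ?P" using maximal_preimage[OF nN M] .
    obtain t where t: "t \<in> \<sigma>" "\<And>x. x \<in> carrier G \<Longrightarrow> pi_elt G (-t) x \<Longrightarrow> x \<in> ?P" using good[OF mP] by blast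
    have "pi_residual G t (carrier G) \<subseteq> ?P"
      by (rule pi_residual_least) (use mP t(2) in \<open>auto simp: maximal_subgroup_def\<close>)
    hence "?D \<subseteq> ?P" using t(1) by (auto simp: sigma_residual_def)
    thus "?\<phi> ` ?D \<subseteq> M" by blast
  next
    fix y assume "y \<in> ?\<phi> ` ?E"
    then obtain x where x: "x \<in> ?E" "y = ?\<phi> x" by auto
    obtain m where m: "pi_num (-s) m" "x [^] m \<in> ?D"
      using pow_pi_residual_in_sigma_residual[OF fin \<sigma> s(1) subgroup_self x(1)] .
    have "\<not> q dvd m" using m(1) s(2) q(1) by (auto simp: pi_num_def)
    moreover have "y [^]\<^bsub>G Mod N\<^esub> m = ?\<phi> (x [^] m)" 
      using x hom_pow_Mod[OF nN] subgroup.mem_carrier[OF sE] by simp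
    ultimately show "\<exists>m. \<not> q dvd m \<and> y [^]\<^bsub>G Mod N\<^esub> m \<in> ?\<phi> ` ?D" using m(2) by auto
  next
    let ?X = "{x \<in> carrier G. pi_elt G (-s) x}"
    have "?\<phi> ` ?E = generate (G Mod N) (?\<phi> ` ?X)"
      unfolding pi_residual_def using h.generate_img[of ?X] by auto
    also have "\<dots> \<subseteq> generate (G Mod N) {x \<in> ?\<phi> ` ?E. pi_elt (G Mod N) (-{q}) x}"
    proof (rule h.H.mono_generate, clarify)
      fix x assume x: "x \<in> carrier G" "pi_elt G (-s) x"
      then obtain m where m: "pi_num (-s) m" "x [^] m = \<one>" unfolding pi_elt_def by blast
      have "pi_num (-{q}) m" using pi_num_mono[OF m(1)] s(2) by auto
      moreover have "(?\<phi> x) [^]\<^bsub>G Mod N\<^esub> m = \<one>\<^bsub>G Mod N\<^esub>" 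
        using hom_pow_Mod[OF nN x(1)] m(2) h.hom_one by simp
      ultimately show "?\<phi> x \<in> ?\<phi> ` ?E \<and> pi_elt (G Mod N) (-{q}) (?\<phi> x)"
        using x pi_residual_mem[of x "carrier G" s] unfolding pi_elt_def by blast
    qed
    finally show "?\<phi> ` ?E \<subseteq> generate (G Mod N) {x \<in> ?\<phi> ` ?E. pi_elt (G Mod N) (-{q}) x}" .
  qed
qed

end

section \<open>Maximal subgroups with a permutability or subnormality condition\<close>

lemma sigma_of_finite:
  assumes "primes_partition \<sigma>" "n > 0" shows "finite (sigma_of \<sigma> n)"
proof -
  have "sigma_of \<sigma> n \<subseteq> (\<lambda>p. THE s. s \<in> \<sigma> \<and> p \<in> s) ` prime_factors n"
  proof
    fix s assume s: "s \<in> sigma_of \<sigma> n"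
    then obtain p where p: "p \<in> s" "p \<in> prime_factors n" "s \<in> \<sigma>" by (auto simp: sigma_of_def)
    have "(THE s. s \<in> \<sigma> \<and> p \<in> s) = s"
      using p block_disjoint[OF assms(1)] by (intro the_equality) blast+
    thus "s \<in> (\<lambda>p. THE s. s \<in> \<sigma> \<and> p \<in> s) ` prime_factors n" using p by force
  qed
  thus ?thesis using finite_subset by blast
qed

lemma sigma_primary_num:
  assumes \<sigma>: "primes_partition \<sigma>" and n: "n > 0" and c: "card (sigma_of \<sigma> n) \<le> 1"
  obtains s where "s \<in> \<sigma>" "pi_num s n"
proof (cases "sigma_of \<sigma> n = {}")
  case True
  \<comment> \<open>Here no prime divides n, so any block serves.\<close>
  obtain s where s: "s \<in> \<sigma>" using block_nonempty[OF \<sigma>] by blast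
  have "pi_num s n" unfolding pi_num_def
  proof (intro conjI allI impI n)
    fix p :: nat assume p: "Factorial_Ring.prime p" "p dvd n"
    obtain t where t: "t \<in> \<sigma>" "p \<in> t" using block_exists[OF \<sigma> p(1)] .
    hence "t \<in> sigma_of \<sigma> n" using p n by (auto simp: sigma_of_def prime_factors_dvd)
    thus "p \<in> s" using True by simp
  qed
  thus ?thesis using that s by blast
next
  case False
  then obtain s where s: "s \<in> sigma_of \<sigma> n" by blast
  have uniq: "t = s" if "t \<in> sigma_of \<sigma> n" for t
    using c card_le_Suc0_iff_eq[OF sigma_of_finite[OF \<sigma> n]] s that by auto
  have "pi_num s n" unfolding pi_num_def
  proof (intro conjI allI impI n)
    fix p :: nat assume p: "Factorial_Ring.prime p" "p dvd n"
    obtain t where t: "t \<in> \<sigma>" "p \<in> t" using block_exists[OF \<sigma> p(1)] .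
    hence "t \<in> sigma_of \<sigma> n" using p n by (auto simp: sigma_of_def prime_factors_dvd)
    thus "p \<in> s" using uniq t by blast
  qed
  moreover have "s \<in> \<sigma>" using s by (simp add: sigma_of_def)
  ultimately show ?thesis using that by blast
qed

lemma sigma_of_num:
  assumes \<sigma>: "primes_partition \<sigma>" and "s \<in> \<sigma>" "pi_num s n"
  shows "card (sigma_of \<sigma> n) \<le> 1"
proof -
  have "sigma_of \<sigma> n \<subseteq> {s}"
  proof
    fix t assume "t \<in> sigma_of \<sigma> n"
    then obtain p where p: "p \<in> t" "t \<in> \<sigma>" "p \<in> prime_factors n" by (auto simp: sigma_of_def)
    hence "p \<in> s" using assms(3) by (auto simp: pi_num_def prime_factors_dvd)
    thus "t \<in> {s}" using p block_disjoint[OF \<sigma> p(2) assms(2)] by blast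
  qed
  thus ?thesis using card_mono[of "{s}"] by fastforce
qed

context group
begin

lemma order_Mod: "order (G Mod N) = card (rcosets N)"
  by (simp add: order_def FactGroup_def)

lemma index_pos: "finite (carrier G) \<Longrightarrow> subgroup H G \<Longrightarrow> card (rcosets H) > 0"
  using index_mult_card[of H] card_subgroup_pos[OF _ subgroup_self] by (metis mult_is_0 not_gr_zero)

lemma pow_index_mem:
  assumes "N \<lhd> G" "x \<in> carrier G" shows "x [^] card (rcosets N) \<in> N"
proof -
  interpret h: group_hom G "G Mod N" "\<lambda>x. N #> x" using group_hom_Mod[OF assms(1)] .
  have sN: "subgroup N G" using assms normal_imp_subgroup by blast
  have "(N #> x) [^]\<^bsub>G Mod N\<^esub> card (rcosets N) = \<one>\<^bsub>G Mod N\<^esub>"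
    using h.H.pow_order_eq_1[of "N #> x"] assms(2) h.hom_closed by (simp add: order_Mod)
  hence "N #> x [^] card (rcosets N) = N" using hom_pow_Mod[OF assms] by simp
  thus ?thesis using coset_join1 assms(2) sN by (metis nat_pow_closed rcos_self)
qed

lemma subgroup_set_mult:
  assumes A: "subgroup A G" and B: "subgroup B G" and AB: "A <#> B = B <#> A"
  shows "subgroup (A <#> B) G"
proof (rule subgroupI)
  note Ac = subgroup.mem_carrier[OF A] and Bc = subgroup.mem_carrier[OF B]
  show "A <#> B \<subseteq> carrier G" using Ac Bc by (auto simp: set_mult_def)
  show "A <#> B \<noteq> {}" using subgroup.one_closed[OF A] subgroup.one_closed[OF B] by (auto simp: set_mult_def)
  fix x assume "x \<in> A <#> B"
  then obtain a b where ab: "a \<in> A" "b \<in> B" "x = a \<otimes> b" by (auto simp: set_mult_def)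
  have "inv x = inv b \<otimes> inv a" using ab Ac Bc by (simp add: inv_mult_group)
  hence "inv x \<in> B <#> A" using ab A B by (auto simp: set_mult_def subgroup.m_inv_closed intro!: bexI)
  thus "inv x \<in> A <#> B" using AB by simp
  fix y assume "y \<in> A <#> B"
  then obtain a' b' where ab': "a' \<in> A" "b' \<in> B" "y = a' \<otimes> b'" by (auto simp: set_mult_def)
  have "b \<otimes> a' \<in> A <#> B" using ab ab' unfolding AB by (auto simp: set_mult_def)
  then obtain a'' b'' where ab'': "a'' \<in> A" "b'' \<in> B" "b \<otimes> a' = a'' \<otimes> b''" by (auto simp: set_mult_def)
  have "x \<otimes> y = a \<otimes> (b \<otimes> a') \<otimes> b'" using ab ab' Ac Bc by (simp add: m_assoc)
  also have "\<dots> = (a \<otimes> a'') \<otimes> (b'' \<otimes> b')" unfolding ab''(3) using ab ab' ab'' Ac Bc by (simp add: m_assoc)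
  finally show "x \<otimes> y \<in> A <#> B" using ab ab' ab'' A B by (auto simp: set_mult_def subgroup.m_closed intro!: bexI)
qed

lemma subgroup_set_mult_normalized:
  assumes Q: "subgroup Q G" and P: "subgroup P G"
    and norm: "\<And>x y. x \<in> P \<Longrightarrow> y \<in> Q \<Longrightarrow> x \<otimes> y \<otimes> inv x \<in> Q"
  shows "subgroup (Q <#> P) G"
proof (rule subgroup_set_mult[OF Q P], intro equalityI subsetI)
  note Qc = subgroup.mem_carrier[OF Q] and Pc = subgroup.mem_carrier[OF P]
  fix z assume "z \<in> Q <#> P"
  then obtain y x where yx: "y \<in> Q" "x \<in> P" "z = y \<otimes> x" by (auto simp: set_mult_def)
  have "inv x \<otimes> y \<otimes> inv (inv x) \<in> Q" using norm[OF subgroup.m_inv_closed[OF P yx(2)] yx(1)] .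
  moreover have "z = x \<otimes> (inv x \<otimes> y \<otimes> inv (inv x))" using yx Qc Pc by (simp add: group_simps)
  ultimately show "z \<in> P <#> Q" using yx(2) unfolding set_mult_def by blast
next
  note Qc = subgroup.mem_carrier[OF Q] and Pc = subgroup.mem_carrier[OF P]
  fix z assume "z \<in> P <#> Q"
  then obtain y x where yx: "y \<in> Q" "x \<in> P" "z = x \<otimes> y" by (auto simp: set_mult_def)
  have "x \<otimes> y \<otimes> inv x \<in> Q" using norm[OF yx(2,1)] .
  moreover have "z = (x \<otimes> y \<otimes> inv x) \<otimes> x" using yx Qc Pc by (simp add: group_simps)
  ultimately show "z \<in> Q <#> P" using yx(2) unfolding set_mult_def by blast
qed

lemma set_mult_superset:
  assumes "subgroup A G" "subgroup B G" shows "A \<subseteq> A <#> B" "B \<subseteq> A <#> B"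
proof -
  show "A \<subseteq> A <#> B"
  proof
    fix a assume a: "a \<in> A"
    have "a = a \<otimes> \<one>" using a assms subgroup.mem_carrier by fastforce
    thus "a \<in> A <#> B" using a assms subgroup.one_closed[of B G] unfolding set_mult_def by blast
  qed
  show "B \<subseteq> A <#> B"
  proof
    fix a assume a: "a \<in> B"
    have "a = \<one> \<otimes> a" using a assms subgroup.mem_carrier by fastforce
    thus "a \<in> A <#> B" using a assms subgroup.one_closed[of A G] unfolding set_mult_def by blast
  qed
qed

lemma set_mult_normal_commute:
  assumes N: "N \<lhd> G" and H: "subgroup H G" shows "N <#> H = H <#> N"
  using commut_normal[OF H N] by simp

text \<open>The index of M is a prime power: if p divides it, a Sylow p-subgroup P is not inside M,
  so MP = G and |G:M| divides |P|. The block of p is the required one.\<close>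

lemma normal_maximal_good:
  assumes fin: "finite (carrier G)" and \<sigma>: "primes_partition \<sigma>" and M: "maximal_subgroup G M" "M \<lhd> G"
  shows "\<exists>s\<in>\<sigma>. \<forall>x\<in>carrier G. pi_elt G (-s) x \<longrightarrow> x \<in> M"
proof -
  have sM: "subgroup M G" "M \<subset> carrier G" and max: "\<And>L. subgroup L G \<Longrightarrow> M \<subset> L \<Longrightarrow> \<not> L \<subset> carrier G"
    using M by (auto simp: maximal_subgroup_def)
  let ?m = "card (rcosets M)"
  have m: "?m * card M = card (carrier G)" using index_mult_card[OF fin sM(1)] .
  have "card M < card (carrier G)" using psubset_card_mono[OF fin sM(2)] .
  hence "?m \<noteq> 1" using m by auto
  then obtain p where p: "Factorial_Ring.prime p" "p dvd ?m" using prime_factor_nat by blast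
  obtain P a where P: "subgroup P G" "card P = p ^ a" "\<not> p dvd card (rcosets P)"
    using Sylow_exists[OF fin p(1)] .
  have "\<not> P \<subseteq> M" using index_dvd[OF fin sM(1) P(1)] p(2) P(3) dvd_trans by blast
  have sMP: "subgroup (M <#> P) G"
    using subgroup_set_mult[OF sM(1) P(1) set_mult_normal_commute[OF M(2) P(1)]] .
  moreover have "M \<subset> M <#> P" using set_mult_superset[OF sM(1) P(1)] \<open>\<not> P \<subseteq> M\<close> by blast
  ultimately have "M <#> P = carrier G" using max[of "M <#> P"] subgroup.subset[OF sMP] by blast
  hence "?m * card M * card (M \<inter> P) = card M * card P"
    using card_set_mult[OF sM(1) P(1)] unfolding m by simp
  hence "(?m * card (M \<inter> P)) * card M = card P * card M"
    by (metis mult.assoc mult.commute)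
  hence "?m * card (M \<inter> P) = card P" using card_subgroup_pos[OF fin sM(1)] by simp
  hence "?m dvd p ^ a" using P(2) by (metis dvd_triv_left)
  obtain s where s: "s \<in> \<sigma>" "p \<in> s" using block_exists[OF \<sigma> p(1)] .
  hence "pi_num s ?m" using pi_num_dvd[OF pi_num_prime_power[OF p(1) s(2)] \<open>?m dvd p ^ a\<close>] by blast
  hence "\<forall>x\<in>carrier G. pi_elt G (-s) x \<longrightarrow> x \<in> M"
    using pi_elt_mem[OF sM(1) _ _ pow_index_mem[OF M(2)]] by auto
  thus ?thesis using s by blast
qed

lemma sigma_primary_good:
  assumes fin: "finite (carrier G)" and \<sigma>: "primes_partition \<sigma>" and N: "N \<lhd> G" and pr: "sigma_primary \<sigma> (G Mod N)"
  shows "\<exists>s\<in>\<sigma>. \<forall>x\<in>carrier G. pi_elt G (-s) x \<longrightarrow> x \<in> N"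
proof -
  have sN: "subgroup N G" using N normal_imp_subgroup by blast
  obtain s where s: "s \<in> \<sigma>" "pi_num s (card (rcosets N))"
    using sigma_primary_num[OF \<sigma> index_pos[OF fin sN]] pr by (auto simp: sigma_primary_def order_Mod)
  hence "\<forall>x\<in>carrier G. pi_elt G (-s) x \<longrightarrow> x \<in> N"
    using pi_elt_mem[OF sN _ _ pow_index_mem[OF N]] by auto
  thus ?thesis using s by blast
qed

text \<open>\<open>GREATEST\<close> has a value only once a largest candidate is exhibited; it is
  the intersection of all conjugates of A, written elementwise as \<open>?C\<close>.\<close>

lemma core_normal:
  assumes A: "subgroup A G" shows "core G A \<lhd> G" "core G A \<subseteq> A"
proof -
  let ?C = "{x \<in> carrier G. \<forall>g\<in>carrier G. g \<otimes> x \<otimes> inv g \<in> A}"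
  have sC: "subgroup ?C G"
  proof (rule subgroupI)
    show "?C \<noteq> {}" using subgroup.one_closed[OF A] by (auto intro!: exI[of _ \<one>])
    fix a assume a: "a \<in> ?C"
    have "g \<otimes> inv a \<otimes> inv g \<in> A" if g: "g \<in> carrier G" for g
    proof -
      have "inv (g \<otimes> a \<otimes> inv g) \<in> A" using a g subgroup.m_inv_closed[OF A] by blast
      thus ?thesis using a g by (simp add: group_simps)
    qed
    thus "inv a \<in> ?C" using a by simp
    fix b assume b: "b \<in> ?C"
    have "g \<otimes> (a \<otimes> b) \<otimes> inv g \<in> A" if g: "g \<in> carrier G" for g
    proof -
      have "(g \<otimes> a \<otimes> inv g) \<otimes> (g \<otimes> b \<otimes> inv g) \<in> A" using a b g subgroup.m_closed[OF A] by blast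
      thus ?thesis using a b g by (simp add: group_simps)
    qed
    thus "a \<otimes> b \<in> ?C" using a b by simp
  qed auto
  have C: "?C \<lhd> G"
  proof (rule normalI'[OF sC])
    fix g x assume g: "g \<in> carrier G" and x: "x \<in> ?C"
    have "h \<otimes> (g \<otimes> x \<otimes> inv g) \<otimes> inv h \<in> A" if h: "h \<in> carrier G" for h
    proof -
      have "(h \<otimes> g) \<otimes> x \<otimes> inv (h \<otimes> g) \<in> A" using x g h by blast
      thus ?thesis using x g h by (simp add: group_simps)
    qed
    thus "g \<otimes> x \<otimes> inv g \<in> ?C" using g x by simp
  qed
  have CA: "?C \<subseteq> A"
  proof
    fix x assume "x \<in> ?C"
    hence "\<one> \<otimes> x \<otimes> inv \<one> \<in> A" "x \<in> carrier G" by blast+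
    thus "x \<in> A" by simp
  qed
  have "core G A = ?C" unfolding core_def
  proof (rule Greatest_equality)
    show "?C \<lhd> G \<and> ?C \<subseteq> A" using C CA by blast
    fix N assume N: "N \<lhd> G \<and> N \<subseteq> A"
    thus "N \<subseteq> ?C" using normal_closed[of N] subgroup.mem_carrier[OF normal_imp_subgroup, of N] by blast
  qed
  thus "core G A \<lhd> G" "core G A \<subseteq> A" using C CA by simp_all
qed

lemma sigma_subnormal_good:
  assumes fin: "finite (carrier G)" and \<sigma>: "primes_partition \<sigma>" and L: "subgroup L G"
    and M: "maximal_subgroup (G\<lparr>carrier := L\<rparr>) M" and sn: "sigma_subnormal \<sigma> G M"
  shows "\<exists>s\<in>\<sigma>. \<forall>x\<in>L. pi_elt G (-s) x \<longrightarrow> x \<in> M"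
proof -
  let ?L = "G\<lparr>carrier := L\<rparr>"
  interpret L: group ?L using L subgroup_imp_group by blast
  have finL: "finite (carrier ?L)" using finite_subgroup[OF fin L] by simp
  have M': "subgroup M ?L" "M \<subset> L" and max: "\<And>K. subgroup K ?L \<Longrightarrow> M \<subset> K \<Longrightarrow> \<not> K \<subset> L"
    using M by (auto simp: maximal_subgroup_def)
  obtain t A where A: "A 0 = M" "A t = carrier G" "\<And>i. i \<le> t \<Longrightarrow> subgroup (A i) G"
    "\<And>i. i < t \<Longrightarrow> A i \<subseteq> A (Suc i)"
    "\<And>i. i < t \<Longrightarrow> A i \<lhd> G\<lparr>carrier := A (Suc i)\<rparr> \<or>
      sigma_primary \<sigma> (G\<lparr>carrier := A (Suc i)\<rparr> Mod core (G\<lparr>carrier := A (Suc i)\<rparr>) (A i))"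
    using sn unfolding sigma_subnormal_def Let_def by blast
  \<comment> \<open>The first chain member containing L. Its predecessor \<open>A j\<close> contains
    M but not L, so by maximality it meets L exactly in M, and the chain step from
    \<open>A j\<close> to \<open>A i\<close> restricts to the inclusion of M in L.\<close>
  define i where "i = (LEAST i. L \<subseteq> A i)"
  have "L \<subseteq> A t" using A(2) subgroup.subset[OF L] by simp
  hence i: "L \<subseteq> A i" "i \<le> t" unfolding i_def by (rule LeastI, rule Least_le)
  have "i \<noteq> 0"
  proof
    assume "i = 0"
    thus False using i(1) A(1) M'(2) by auto
  qed
  then obtain j where j: "i = Suc j" by (cases i) auto
  have jt: "j < t" using i j by simp
  have nLj: "\<not> L \<subseteq> A j" using not_less_Least[of j "\<lambda>i. L \<subseteq> A i"] j by (simp add: i_def)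
  have "M \<subseteq> A k" if "k \<le> t" for k using that
  proof (induction k)
    case (Suc k)
    thus ?case using A(4)[of k] by auto
  qed (use A in simp)
  hence MA: "M \<subseteq> A j \<inter> L" using jt M'(2) by auto
  have sj: "subgroup (A j) G" using A(3) jt by simp
  have "subgroup (A j \<inter> L) ?L"
    by (rule subgroup_incl[OF subgroups_Inter_pair[OF sj L] L]) auto
  hence eq: "A j \<inter> L = M" using max[of "A j \<inter> L"] MA nLj by auto
  let ?T = "G\<lparr>carrier := A i\<rparr>"
  have si: "subgroup (A i) G" using A(3) i by simp
  interpret T: group ?T using si subgroup_imp_group by blast
  have finT: "finite (carrier ?T)" using finite_subgroup[OF fin si] by simp
  have sjT: "subgroup (A j) ?T" using subgroup_incl[OF sj si] A(4)[OF jt] j by simp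
  from A(5)[OF jt] consider "A j \<lhd> ?T" | "sigma_primary \<sigma> (?T Mod core ?T (A j))" using j by auto
  thus ?thesis
  proof cases
    case 1
    have "M \<lhd> ?L"
    proof (rule L.normalI'[OF M'(1)])
      fix g x assume g: "g \<in> carrier ?L" and x: "x \<in> M"
      hence gx: "g \<in> L" "g \<in> A i" "x \<in> A j" "x \<in> L" using i eq by auto
      have "g \<otimes> x \<otimes> inv g \<in> A j"
        using T.normal_closed[OF 1, of g x] gx m_inv_consistent[OF si gx(2)] by simp
      moreover have "g \<otimes> x \<otimes> inv g \<in> L" using gx L by (simp add: subgroup.m_closed subgroup.m_inv_closed)
      ultimately show "g \<otimes>\<^bsub>?L\<^esub> x \<otimes>\<^bsub>?L\<^esub> inv\<^bsub>?L\<^esub> g \<in> M"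
        using eq m_inv_consistent[OF L gx(1)] by auto
    qed
    thus ?thesis using L.normal_maximal_good[OF finL \<sigma> M] by simp
  next
    case 2
    obtain s where s: "s \<in> \<sigma>" "\<And>x. x \<in> A i \<Longrightarrow> pi_elt G (-s) x \<Longrightarrow> x \<in> core ?T (A j)"
      using T.sigma_primary_good[OF finT \<sigma> T.core_normal(1)[OF sjT] 2] by auto
    have "\<forall>x\<in>L. pi_elt G (-s) x \<longrightarrow> x \<in> M"
      using s(2) T.core_normal(2)[OF sjT] i(1) eq by blast
    thus ?thesis using s(1) by blast
  qed
qed

section \<open>Permutability with conjugates of Hall subgroups\<close>

lemma pi_elt_inv: "x \<in> carrier G \<Longrightarrow> pi_elt G s x \<Longrightarrow> pi_elt G s (inv x)"
  unfolding pi_elt_def by (metis inv_one nat_pow_inv)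

lemma Sylow_embedding_elt:
  assumes fin: "finite (carrier G)" and q: "Factorial_Ring.prime q" and z: "z \<in> carrier G" "pi_elt G {q} z"
    and H: "subgroup H G" "\<not> q dvd card (rcosets H)"
  obtains g where "g \<in> carrier G" "g \<otimes> z \<otimes> inv g \<in> H"
proof -
  let ?P = "generate G {z}"
  have sP: "subgroup ?P G" using generate_is_subgroup[of "{z}"] z by simp
  have "pi_elt G {q} x" if x: "x \<in> ?P" for x
  proof -
    obtain k :: int where k: "x = z [^] k" using x unfolding generate_pow[OF z(1)] by blast
    show ?thesis
    proof (cases "k < 0")
      case True
      hence k': "x = inv (z [^] nat (-k))" unfolding k int_pow_def2 by simp
      show ?thesis unfolding k' by (rule pi_elt_inv[OF nat_pow_closed[OF z(1)] pi_elt_pow[OF z]])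
    next
      case False
      hence k': "x = z [^] nat k" unfolding k int_pow_def2 by simp
      show ?thesis unfolding k' by (rule pi_elt_pow[OF z])
    qed
  qed
  hence "pi_num {q} (card ?P)" using pi_num_card_of_pi_elt[OF sP fin] by blast
  then obtain a where "card ?P = q ^ a" using pi_num_singleton_power q by blast
  then obtain g where "g \<in> carrier G" "\<And>x. x \<in> ?P \<Longrightarrow> g \<otimes> x \<otimes> inv g \<in> H"
    using Sylow_embedding[OF fin sP _ q H] by metis
  thus ?thesis using that generate.incl[of z "{z}" G] by blast
qed

text \<open>An element is a product of powers of itself of prime power order.\<close>

lemma mem_of_prime_power_elts:
  assumes fin: "finite (carrier G)" and H: "subgroup H G" and L: "subgroup L G"
    and pp: "\<And>q y. Factorial_Ring.prime q \<Longrightarrow> q \<notin> s \<Longrightarrow> y \<in> L \<Longrightarrow> pi_elt G {q} y \<Longrightarrow> y \<in> H"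
    and x: "x \<in> L" "pi_elt G (-s) x"
  shows "x \<in> H"
proof (rule ccontr)
  assume xH: "x \<notin> H"
  have xc: "x \<in> carrier G" using x(1) L subgroup.mem_carrier by metis
  obtain k where k: "pi_num (-s) k" "x [^] k = \<one>" using x(2) unfolding pi_elt_def by blast
  let ?Q = "\<lambda>m. m > 0 \<and> x [^] (m::nat) \<in> H"
  define m0 where "m0 = (LEAST m. ?Q m)"
  have "?Q k" using k pi_num_pos subgroup.one_closed[OF H] by simp
  hence m0: "?Q m0" unfolding m0_def by (rule LeastI)
  \<comment> \<open>\<open>m0\<close> plays the role of the order of x modulo H. A prime q dividing
    it leads to a contradiction: the q-part of x lies in H by \<open>pp\<close>, so some exponent
    prime to q already brings x into H.\<close>
  have dvd: "m0 dvd m" if "x [^] m \<in> H" for m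
  proof -
    have "?Q (gcd m m0)" using pow_gcd_mem[OF H xc that] m0 by simp
    hence "m0 \<le> gcd m m0" unfolding m0_def by (rule Least_le)
    hence "gcd m m0 = m0" using m0 by (metis dvd_imp_le gcd_dvd2 le_antisym)
    thus ?thesis by (metis gcd_dvd1)
  qed
  have "m0 \<noteq> 1" using m0 xH xc by auto
  then obtain q where q: "Factorial_Ring.prime q" "q dvd m0" using prime_factor_nat by blast
  have "q dvd k" using dvd[of k] q(2) k subgroup.one_closed[OF H] by (auto intro: dvd_trans)
  hence qs: "q \<notin> s" using k(1) q(1) by (auto simp: pi_num_def)
  obtain i j :: nat where ij: "x = x [^] i \<otimes> x [^] j" "pi_elt G {q} (x [^] i)" "pi_elt G (-{q}) (x [^] j)"
    "\<And>m::nat. x [^] m = (x [^] i) [^] m \<otimes> (x [^] j) [^] m"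
    using pi_elt_split[OF fin xc] by blast
  have iH: "x [^] i \<in> H" using pp[OF q(1) qs subgroup_nat_pow[OF L x(1)] ij(2)] .
  obtain l where l: "pi_num (-{q}) l" "(x [^] j) [^] l = \<one>" using ij(3) unfolding pi_elt_def by blast
  have "x [^] l = (x [^] i) [^] l \<otimes> (x [^] j) [^] l" by (rule ij(4))
  hence "x [^] l \<in> H" using l xc subgroup_nat_pow[OF H iH] by simp
  hence "q dvd l" using dvd q(2) dvd_trans by blast
  thus False using l(1) q(1) by (auto simp: pi_num_def)
qed

lemma mem_conjugate_iff:
  assumes "A \<subseteq> carrier G" "g \<in> carrier G" "z \<in> carrier G"
  shows "z \<in> conjugate G A g \<longleftrightarrow> g \<otimes> z \<otimes> inv g \<in> A"
proof
  assume "z \<in> conjugate G A g"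
  then obtain a where "a \<in> A" "z = inv g \<otimes> a \<otimes> g" by (auto simp: conjugate_def l_coset_def r_coset_def)
  thus "g \<otimes> z \<otimes> inv g \<in> A" using assms by (auto simp: group_simps subset_iff)
next
  assume a: "g \<otimes> z \<otimes> inv g \<in> A"
  have "z = inv g \<otimes> (g \<otimes> z \<otimes> inv g) \<otimes> g" using assms by (simp add: group_simps)
  thus "z \<in> conjugate G A g" using a unfolding conjugate_def l_coset_def r_coset_def by blast
qed

lemma conjugate_subgroup:
  assumes "subgroup A G" "g \<in> carrier G"
  shows "subgroup (conjugate G A g) G" "card (conjugate G A g) = card A"
proof -
  have "conjugate G A g = (\<lambda>x. inv g \<otimes> x \<otimes> inv (inv g)) ` A"
    using assms by (auto simp: conjugate_def l_coset_def r_coset_def)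
  thus "subgroup (conjugate G A g) G" "card (conjugate G A g) = card A"
    using conj_subgroup[OF assms(1) inv_closed[OF assms(2)]] by simp_all
qed

lemma Hall_num:
  assumes fin: "finite (carrier G)" and "Hall_subgroup s G A"
  shows "pi_num s (card A)" "pi_num (-s) (card (rcosets A))"
proof -
  have A: "subgroup A G" using assms(2) by (simp add: Hall_subgroup_def)
  show "pi_num s (card A)" "pi_num (-s) (card (rcosets A))"
    using assms card_subgroup_pos[OF fin A] index_pos[OF fin A]
    by (auto simp: Hall_subgroup_def pi_num_def prime_factors_dvd)
qed

text \<open>A nontrivial q-element forces q to divide the order of G, so the block s is represented
  in \<open>\<H>\<close>. The index of a Hall s-subgroup is prime to q, and Sylow embedding
  applies.\<close>

lemma complete_Hall_conj:
  assumes fin: "finite (carrier G)" and H: "complete_Hall_set \<sigma> G \<H>" and s: "s \<in> \<sigma>"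
    and q: "Factorial_Ring.prime q" "q \<in> s" and z: "z \<in> carrier G" "pi_elt G {q} z" "z \<noteq> \<one>"
  obtains A g where "A \<in> \<H>" "Hall_subgroup s G A" "g \<in> carrier G" "z \<in> conjugate G A g"
proof -
  have "q dvd order G"
  proof (rule ccontr)
    assume "\<not> q dvd order G"
    hence "pi_num (-{q}) (order G)" using q(1) fin by (simp add: pi_num_compl_singleton order_gt_0_iff_finite)
    hence "pi_elt G (-{q}) z" using pow_order_eq_1[OF z(1)] unfolding pi_elt_def by blast
    thus False using pi_elt_both z by blast
  qed
  moreover have "order G > 0" using fin order_gt_0_iff_finite by blast
  ultimately have "s \<in> sigma_of \<sigma> (order G)" using s q by (auto simp: sigma_of_def prime_factors_dvd)
  moreover have "\<forall>s \<in> sigma_of \<sigma> (order G). \<exists>!A. A \<in> \<H> \<and> Hall_subgroup s G A"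
    using H by (simp add: complete_Hall_set_def)
  ultimately obtain A where A: "A \<in> \<H>" "Hall_subgroup s G A" by blast
  have sA: "subgroup A G" using A(2) by (simp add: Hall_subgroup_def)
  have "\<not> q dvd card (rcosets A)" using Hall_num(2)[OF fin A(2)] q by (auto simp: pi_num_def)
  then obtain g where g: "g \<in> carrier G" "g \<otimes> z \<otimes> inv g \<in> A"
    using Sylow_embedding_elt[OF fin q(1) z(1,2) sA] by blast
  hence "z \<in> conjugate G A g" using mem_conjugate_iff[OF subgroup.subset[OF sA] g(1) z(1)] by simp
  thus ?thesis using that[OF A g(1)] by simp
qed

text \<open>M permutes with a conjugate B of a Hall s-subgroup that contains z. The subgroup MB
  meets L in more than M, hence contains L by maximality; so |L| divides |M||B|, and |L:M| divides
  |B|.\<close>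

lemma sigma_quasinormal_index:
  assumes fin: "finite (carrier G)" and H: "complete_Hall_set \<sigma> G \<H>" and L: "subgroup L G"
    and M: "maximal_subgroup (G\<lparr>carrier := L\<rparr>) M" 
    and perm: "\<And>A x. A \<in> \<H> \<Longrightarrow> x \<in> carrier G \<Longrightarrow> M <#> conjugate G A x = conjugate G A x <#> M"
    and s: "s \<in> \<sigma>" and q: "Factorial_Ring.prime q" "q \<in> s" and z: "z \<in> L" "pi_elt G {q} z" "z \<notin> M"
  shows "pi_num s (card L div card M)"
proof -
  let ?L = "G\<lparr>carrier := L\<rparr>"
  have M': "subgroup M ?L" "M \<subset> L" and max: "\<And>K. subgroup K ?L \<Longrightarrow> M \<subset> K \<Longrightarrow> \<not> K \<subset> L"
    using M by (auto simp: maximal_subgroup_def)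
  have sM: "subgroup M G" using incl_subgroup[OF L M'(1)] .
  have zc: "z \<in> carrier G" using z(1) L subgroup.mem_carrier by metis
  have "z \<noteq> \<one>" using z(3) subgroup.one_closed[OF sM] by auto
  then obtain A g where A: "A \<in> \<H>" "Hall_subgroup s G A" "g \<in> carrier G" "z \<in> conjugate G A g"
    using complete_Hall_conj[OF fin H s q zc z(2)] by blast
  have sA: "subgroup A G" using A(2) by (simp add: Hall_subgroup_def)
  let ?B = "conjugate G A g"
  note B = conjugate_subgroup[OF sA A(3)]
  have sMB: "subgroup (M <#> ?B) G" using subgroup_set_mult[OF sM B(1) perm[OF A(1,3)]] .
  have "subgroup ((M <#> ?B) \<inter> L) ?L"
    by (rule subgroup_incl[OF subgroups_Inter_pair[OF sMB L] L]) auto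
  moreover have "M \<subset> (M <#> ?B) \<inter> L"
    using set_mult_superset[OF sM B(1)] M'(2) z A(4) by blast
  ultimately have "L \<subseteq> M <#> ?B" using max[of "(M <#> ?B) \<inter> L"] by auto
  hence "card L dvd card (M <#> ?B)" using card_subgroup_dvd[OF sMB L] by blast
  hence "card L dvd card M * card A" using card_set_mult[OF sM B(1)] B(2) by (metis dvd_mult2)
  moreover obtain j where j: "card L = card M * j" using card_subgroup_dvd[OF L sM] M'(2) by auto
  ultimately have "j dvd card A" using card_subgroup_pos[OF fin sM] by simp
  hence "pi_num s j" using Hall_num(1)[OF fin A(2)] pi_num_dvd by blast
  moreover have "card L div card M = j" using j card_subgroup_pos[OF fin sM] by simp
  ultimately show ?thesis by simp
qed

text \<open>Every element of prime power order in L outside M forces |L:M| to be a number of its own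
  block. As the index is not 1, all these elements belong to one block.\<close>

lemma sigma_quasinormal_good:
  assumes fin: "finite (carrier G)" and \<sigma>: "primes_partition \<sigma>" and L: "subgroup L G"
    and M: "maximal_subgroup (G\<lparr>carrier := L\<rparr>) M" and qn: "sigma_quasinormal \<sigma> G M"
  shows "\<exists>s\<in>\<sigma>. \<forall>x\<in>L. pi_elt G (-s) x \<longrightarrow> x \<in> M"
proof -
  have MsL: "subgroup M (G\<lparr>carrier := L\<rparr>)" "M \<subset> L" using M by (auto simp: maximal_subgroup_def)
  have sM: "subgroup M G" using incl_subgroup[OF L MsL(1)] .
  obtain \<H> where H: "complete_Hall_set \<sigma> G \<H>"
    "\<And>A x. A \<in> \<H> \<Longrightarrow> x \<in> carrier G \<Longrightarrow> M <#> conjugate G A x = conjugate G A x <#> M"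
    using qn unfolding sigma_quasinormal_def by blast
  note index = sigma_quasinormal_index[OF fin H(1) L M H(2)]
  have i1: "card L div card M \<noteq> 1"
  proof
    assume "card L div card M = 1"
    moreover obtain j where j: "card L = card M * j" using card_subgroup_dvd[OF L sM] MsL(2) by auto
    ultimately have "card L = card M" using card_subgroup_pos[OF fin sM] by simp
    thus False using psubset_card_mono[OF finite_subgroup[OF fin L] MsL(2)] by simp
  qed
  show ?thesis
  proof (cases "\<forall>q z. Factorial_Ring.prime q \<and> z \<in> L \<and> pi_elt G {q} z \<longrightarrow> z \<in> M")
    case True
    \<comment> \<open>No element of prime power order leaves M, so no block is singled out and any
      one serves.\<close>
    obtain s where s: "s \<in> \<sigma>" using block_nonempty[OF \<sigma>] by blast
    have "\<forall>x\<in>L. pi_elt G (-s) x \<longrightarrow> x \<in> M"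
      using mem_of_prime_power_elts[OF fin sM L, of s] True by blast
    thus ?thesis using s by blast
  next
    case False
    then obtain q z where q: "Factorial_Ring.prime q" and z: "z \<in> L" "pi_elt G {q} z" "z \<notin> M" by blast
    obtain s where s: "s \<in> \<sigma>" "q \<in> s" using block_exists[OF \<sigma> q] .
    have 1: "pi_num s (card L div card M)" using index[OF _ _ s(1) q s(2) z] by blast
    have "y \<in> M" if y: "Factorial_Ring.prime p" "p \<notin> s" "y \<in> L" "pi_elt G {p} y" for p y
    proof (rule ccontr)
      assume yM: "y \<notin> M"
      obtain t where t: "t \<in> \<sigma>" "p \<in> t" using block_exists[OF \<sigma> y(1)] .
      have "pi_num t (card L div card M)" using index[OF _ _ t(1) y(1) t(2) y(3,4) yM] by blast
      hence "pi_num (-s) (card L div card M)" using pi_num_mono block_disjoint[OF \<sigma> t(1) s(1)] t(2) y(2) by blast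
      thus False using pi_num_both[OF 1] i1 by blast
    qed
    hence "\<forall>x\<in>L. pi_elt G (-s) x \<longrightarrow> x \<in> M"
      using mem_of_prime_power_elts[OF fin sM L, of s] by blast
    thus ?thesis using s by blast
  qed
qed

lemma n_maximal_subgroup: "n_maximal G n L \<Longrightarrow> subgroup L G"
proof (induction n arbitrary: L)
  case 0
  thus ?case using subgroup_self by simp
next
  case (Suc n)
  then obtain K where K: "n_maximal G n K" "maximal_subgroup (G\<lparr>carrier := K\<rparr>) L" by auto
  thus ?case using incl_subgroup[OF Suc.IH[OF K(1)]] by (simp add: maximal_subgroup_def)
qed

lemma sigma_residual_trivial_subgroup:
  assumes fin: "finite (carrier G)" and \<sigma>: "primes_partition \<sigma>" and L: "subgroup L G"
    and P: "\<And>M. maximal_subgroup (G\<lparr>carrier := L\<rparr>) M \<Longrightarrow> sigma_subnormal \<sigma> G M \<or> sigma_quasinormal \<sigma> G M"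
  shows "sigma_residual \<sigma> G L = {\<one>}"
proof -
  let ?L = "G\<lparr>carrier := L\<rparr>"
  interpret L: group ?L using L subgroup_imp_group by blast
  have "sigma_residual \<sigma> ?L (carrier ?L) = {\<one>\<^bsub>?L\<^esub>}"
  proof (rule L.sigma_residual_trivial[OF _ \<sigma>])
    show "finite (carrier ?L)" using finite_subgroup[OF fin L] by simp
    fix M assume M: "maximal_subgroup ?L M"
    thus "\<exists>s\<in>\<sigma>. \<forall>x\<in>carrier ?L. pi_elt ?L (- s) x \<longrightarrow> x \<in> M"
      using P[OF M] sigma_subnormal_good[OF fin \<sigma> L M] sigma_quasinormal_good[OF fin \<sigma> L M] by auto
  qed
  thus ?thesis using sigma_residual_consistent[OF L] by simp
qed

end

section \<open>Groups with trivial residual are \<open>\<sigma>\<close>-nilpotent\<close>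

lemma prod_dvd_coprime:
  fixes f :: "'i \<Rightarrow> nat"
  assumes "finite J" "\<And>i. i \<in> J \<Longrightarrow> f i dvd n" "\<And>i j. i \<in> J \<Longrightarrow> j \<in> J \<Longrightarrow> i \<noteq> j \<Longrightarrow> coprime (f i) (f j)"
  shows "prod f J dvd n"
  using assms
proof (induction J rule: finite_induct)
  case (insert x F)
  have "coprime (f x) (prod f F)" using insert by (intro prod_coprime_right) auto
  thus ?case using insert by (simp add: divides_mult)
qed simp

context group
begin

lemma pi_residual_index:
  assumes fin: "finite (carrier G)"
  shows "pi_num s (order (G Mod pi_residual G s (carrier G)))"
proof -
  let ?E = "pi_residual G s (carrier G)"
  have nE: "?E \<lhd> G" using normal_pi_residual[OF normal_self] .
  interpret h: group_hom G "G Mod ?E" "\<lambda>x. ?E #> x" using group_hom_Mod[OF nE] .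
  have sE: "subgroup ?E G" using nE normal_imp_subgroup by blast
  have "pi_num s (card (carrier (G Mod ?E)))"
  proof (rule h.H.pi_num_card_of_pi_elt[OF h.H.subgroup_self])
    show "finite (carrier (G Mod ?E))" using fin by (simp add: carrier_FactGroup)
    fix y assume "y \<in> carrier (G Mod ?E)"
    then obtain x where x: "x \<in> carrier G" "y = ?E #> x" by (auto simp: carrier_FactGroup)
    obtain m where m: "pi_num s m" "x [^] m \<in> ?E" using pow_in_pi_residual[OF fin subgroup_self x(1)] .
    have "y [^]\<^bsub>G Mod ?E\<^esub> m = \<one>\<^bsub>G Mod ?E\<^esub>"
      using hom_pow_Mod[OF nE x(1)] coset_join2[OF _ sE m(2)] x by simp
    thus "pi_elt (G Mod ?E) s y" using m(1) unfolding pi_elt_def by blast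
  qed
  thus ?thesis by (simp add: order_def)
qed

text \<open>\<open>sigma_nilpotent\<close> wants the factors on the element type of the group
  itself, whereas the natural factors G/O^s(G) consist of cosets. The injections \<open>f s\<close>
  transport them: the identity for the quotient G/D(G), a choice of representatives for G. The map
  into the product has kernel D(G), and is onto because the factors have pairwise coprime orders,
  each dividing |G:D(G)|.\<close>

lemma quotient_sigma_nilpotent_aux:
  fixes f :: "nat set \<Rightarrow> 'a set \<Rightarrow> 'c"
  assumes fin: "finite (carrier G)" and \<sigma>: "primes_partition \<sigma>"
    and inj: "\<And>s. inj_on (f s) (carrier (G Mod pi_residual G s (carrier G)))"
  shows "\<exists>(J :: nat set) (K :: nat \<Rightarrow> 'c monoid). finite J \<and>
      (\<forall>j\<in>J. group (K j) \<and> sigma_primary \<sigma> (K j)) \<and>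
      G Mod sigma_residual \<sigma> G (carrier G) \<cong> product_group J K"
proof -
  let ?E = "\<lambda>s. pi_residual G s (carrier G)" and ?N = "sigma_residual \<sigma> G (carrier G)"
  let ?S = "sigma_of \<sigma> (order G)"
  have og: "order G > 0" using fin order_gt_0_iff_finite by blast
  have finS: "finite ?S" using sigma_of_finite[OF \<sigma> og] .
  have S\<sigma>: "s \<in> ?S \<Longrightarrow> s \<in> \<sigma>" for s by (simp add: sigma_of_def)
  obtain b where b: "bij_betw b {0..<card ?S} ?S" using ex_bij_betw_nat_finite[OF finS] by blast
  let ?J = "{0..<card ?S}"
  define K where "K = (\<lambda>j. image_group (f (b j)) (G Mod ?E (b j)))"
  have bS: "b j \<in> ?S" if "j \<in> ?J" for j using b that by (auto simp: bij_betw_def)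
  have nE: "?E s \<lhd> G" for s using normal_pi_residual[OF normal_self] .
  have sE: "subgroup (?E s) G" for s using nE normal_imp_subgroup by blast
  have gE: "group (G Mod ?E s)" for s using nE normal.factorgroup_is_group by blast
  have finE: "finite (carrier (G Mod ?E s))" for s using fin by (simp add: carrier_FactGroup)
  have iso: "f s \<in> iso (G Mod ?E s) (image_group (f s) (G Mod ?E s))" for s
    using inj_imp_image_group_iso[OF inj] .
  have gK: "group (K j)" for j unfolding K_def by (rule group.inj_imp_image_group_is_group[OF gE inj])
  have cardK: "card (carrier (K j)) = order (G Mod ?E (b j))" for j
    unfolding K_def image_group_carrier order_def by (rule card_image[OF inj])
  have finK: "finite (carrier (K j))" for j
    unfolding K_def image_group_carrier using finE by simp
  have numK: "pi_num (b j) (card (carrier (K j)))" for j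
    unfolding cardK using pi_residual_index[OF fin] .
  have primK: "sigma_primary \<sigma> (K j)" if "j \<in> ?J" for j
    unfolding sigma_primary_def order_def using finK sigma_of_num[OF \<sigma> S\<sigma>[OF bS[OF that]] numK] by blast
  let ?P = "product_group ?J K"
  have gP: "group ?P" using gK by simp
  define \<psi> where "\<psi> = (\<lambda>x. \<lambda>j\<in>?J. f (b j) (?E (b j) #> x))"
  have fhom: "(\<lambda>x. f s (?E s #> x)) \<in> hom G (image_group (f s) (G Mod ?E s))" for s
    using Group.hom_compose[OF normal.r_coset_hom_Mod[OF nE] iso_imp_homomorphism[OF iso]] by (simp add: comp_def)
  have \<psi>_hom: "\<psi> \<in> hom G ?P"
  proof (rule homI)
    fix x assume "x \<in> carrier G"
    thus "\<psi> x \<in> carrier ?P" using hom_in_carrier[OF fhom] by (auto simp: \<psi>_def K_def)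
  next
    fix x y assume "x \<in> carrier G" "y \<in> carrier G"
    thus "\<psi> (x \<otimes> y) = \<psi> x \<otimes>\<^bsub>?P\<^esub> \<psi> y"
      using hom_mult[OF fhom] by (auto simp: \<psi>_def K_def)
  qed
  interpret \<psi>: group_hom G ?P \<psi>
    by (intro group_hom.intro group_hom_axioms.intro group_axioms gP \<psi>_hom)
  have fone: "f s (?E s #> x) = \<one>\<^bsub>image_group (f s) (G Mod ?E s)\<^esub> \<longleftrightarrow> x \<in> ?E s" if x: "x \<in> carrier G" for s x
  proof -
    have "?E s #> x \<in> carrier (G Mod ?E s)" "?E s \<in> carrier (G Mod ?E s)"
      using x subgroup.subgroup_in_rcosets[OF sE group_axioms] by (simp_all add: carrier_FactGroup RCOSETS_def FactGroup_def) blast+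
    hence "f s (?E s #> x) = f s (?E s) \<longleftrightarrow> ?E s #> x = ?E s"
      by (rule inj_on_eq_iff[OF inj])
    also have "\<dots> \<longleftrightarrow> x \<in> ?E s" using coset_join1[OF _ x sE] coset_join2[OF x sE] rcos_self[OF x sE] by metis
    finally show ?thesis by (simp add: image_group_one)
  qed
  \<comment> \<open>A block containing no prime divisor of |G| has O^s(G) = G, so the finitely many
    blocks in \<open>?S\<close> already cut out D(G).\<close>
  have Etriv: "?E s = carrier G" if s: "s \<in> \<sigma>" "s \<notin> ?S" for s
  proof -
    have "pi_num (-s) (order G)"
      using s og by (auto simp: sigma_of_def pi_num_def prime_factors_dvd)
    hence "x \<in> ?E s" if "x \<in> carrier G" for x
      using pi_residual_mem[OF that] pow_order_eq_1[OF that] unfolding pi_elt_def by blast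
    thus ?thesis using subgroup.subset[OF sE] by blast
  qed
  have ker: "kernel G ?P \<psi> = ?N"
  proof (intro equalityI subsetI)
    fix x assume "x \<in> kernel G ?P \<psi>"
    hence x: "x \<in> carrier G" "\<psi> x = \<one>\<^bsub>?P\<^esub>" by (auto simp: kernel_def)
    have "x \<in> ?E s" if s: "s \<in> \<sigma>" for s
    proof (cases "s \<in> ?S")
      case True
      then obtain j where j: "j \<in> ?J" "s = b j" using b unfolding bij_betw_def by blast
      have "\<psi> x j = \<one>\<^bsub>?P\<^esub> j" using x(2) by simp
      hence "f s (?E s #> x) = \<one>\<^bsub>image_group (f s) (G Mod ?E s)\<^esub>" using j by (simp add: \<psi>_def K_def)
      thus ?thesis using fone[OF x(1)] by blast
    qed (use Etriv s x in auto)
    thus "x \<in> ?N" using x(1) by (simp add: sigma_residual_def)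
  next
    fix x assume "x \<in> ?N"
    hence x: "x \<in> carrier G" "\<And>s. s \<in> \<sigma> \<Longrightarrow> x \<in> ?E s" by (auto simp: sigma_residual_def)
    have "\<psi> x = \<one>\<^bsub>?P\<^esub>"
      unfolding \<psi>_def using fone[OF x(1)] x(2) S\<sigma> bS by (auto simp: K_def intro!: restrict_ext)
    thus "x \<in> kernel G ?P \<psi>" using x(1) by (simp add: kernel_def)
  qed
  have nN: "?N \<lhd> G" using normal_sigma_residual[OF normal_self] .
  have sN: "subgroup ?N G" using nN normal_imp_subgroup by blast
  have finP: "finite (carrier ?P)" using finK by (auto intro: finite_PiE)
  have surj: "\<psi> ` carrier G = carrier ?P"
  proof (rule card_seteq[OF finP])
    show "\<psi> ` carrier G \<subseteq> carrier ?P" using \<psi>.hom_closed by blast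
    have sI: "subgroup (\<psi> ` carrier G) ?P" using \<psi>.img_is_subgroup .
    have "G Mod kernel G ?P \<psi> \<cong> (?P\<lparr>carrier := \<psi> ` carrier G\<rparr>)"
    proof -
      have "group (?P\<lparr>carrier := \<psi> ` carrier G\<rparr>)" using group.subgroup_imp_group[OF gP sI] .
      moreover have "\<psi> \<in> hom G (?P\<lparr>carrier := \<psi> ` carrier G\<rparr>)" using \<psi>_hom by (auto simp: hom_def)
      ultimately interpret I: group_hom G "?P\<lparr>carrier := \<psi> ` carrier G\<rparr>" \<psi>
        by (intro group_hom.intro group_hom_axioms.intro group_axioms)
      have "kernel G (?P\<lparr>carrier := \<psi> ` carrier G\<rparr>) \<psi> = kernel G ?P \<psi>" by (simp add: kernel_def)
      thus ?thesis using I.FactGroup_iso by simp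
    qed
    hence "card (\<psi> ` carrier G) = card (rcosets ?N)"
      using iso_same_card[of "G Mod kernel G ?P \<psi>" "?P\<lparr>carrier := \<psi> ` carrier G\<rparr>"]
      by (simp add: ker FactGroup_def)
    moreover have "card (carrier ?P) dvd card (rcosets ?N)"
    proof -
      have "card (carrier (K j)) dvd card (rcosets ?N)" if j: "j \<in> ?J" for j
      proof -
        have "?N \<subseteq> ?E (b j)" using S\<sigma>[OF bS[OF j]] by (auto simp: sigma_residual_def)
        thus ?thesis unfolding cardK order_Mod by (rule index_dvd[OF fin sE sN])
      qed
      moreover have "coprime (card (carrier (K i))) (card (carrier (K j)))"
        if "i \<in> ?J" "j \<in> ?J" "i \<noteq> j" for i j
      proof -
        have "b i \<noteq> b j" using b that by (auto simp: bij_betw_def inj_on_def)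
        hence "b j \<subseteq> - b i" using block_disjoint[OF \<sigma> S\<sigma>[OF bS[OF that(2)]] S\<sigma>[OF bS[OF that(1)]]] by auto
        thus ?thesis using pi_num_coprime[OF numK] pi_num_mono[OF numK] by blast
      qed
      ultimately have "(\<Prod>j\<in>?J. card (carrier (K j))) dvd card (rcosets ?N)"
        by (intro prod_dvd_coprime) auto
      thus ?thesis by (simp add: card_PiE)
    qed
    hence "card (carrier ?P) \<le> card (rcosets ?N)" using index_pos[OF fin sN] by (intro dvd_imp_le)
    ultimately show "card (carrier ?P) \<le> card (\<psi> ` carrier G)" by simp
  qed
  have "G Mod ?N \<cong> ?P" using \<psi>.FactGroup_iso[OF surj] ker by simp
  thus ?thesis using gK primK by (intro exI[of _ ?J] exI[of _ K]) auto
qed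

lemma quotient_sigma_nilpotent:
  assumes "finite (carrier G)" "primes_partition \<sigma>"
  shows "sigma_nilpotent \<sigma> (G Mod sigma_residual \<sigma> G (carrier G))"
  unfolding sigma_nilpotent_def
  using quotient_sigma_nilpotent_aux[OF assms, of "\<lambda>_. id"] by simp

lemma sigma_nilpotent_of_trivial_residual:
  assumes fin: "finite (carrier G)" and \<sigma>: "primes_partition \<sigma>"
    and "sigma_residual \<sigma> G (carrier G) = {\<one>}"
  shows "sigma_nilpotent \<sigma> G"
proof -
  \<comment> \<open>A coset is recovered from any of its elements, so choosing representatives moves
    the factors to the element type of G.\<close>
  have "inj_on (\<lambda>C. SOME x. x \<in> C) (carrier (G Mod pi_residual G s (carrier G)))" for s
  proof (rule inj_onI)
    let ?E = "pi_residual G s (carrier G)"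
    have sE: "subgroup ?E G" by (rule subgroup_pi_residual) simp
    have *: "?E #> (SOME x. x \<in> C) = C" if C: "C \<in> carrier (G Mod ?E)" for C
    proof -
      obtain x where x: "x \<in> carrier G" "C = ?E #> x" using C by (auto simp: carrier_FactGroup)
      have "x \<in> C" using rcos_self[OF x(1) sE] x(2) by simp
      hence "(SOME x. x \<in> C) \<in> C" by (rule someI)
      thus ?thesis using repr_independence[OF _ x(1) sE] x(2) by simp
    qed
    fix C C' assume "C \<in> carrier (G Mod ?E)" "C' \<in> carrier (G Mod ?E)" "(SOME x. x \<in> C) = (SOME x. x \<in> C')"
    thus "C = C'" using * by metis
  qed
  from quotient_sigma_nilpotent_aux[OF fin \<sigma> this] assms(3)
  obtain J :: "nat set" and K :: "nat \<Rightarrow> 'a monoid" where JK: "finite J"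
    "\<forall>j\<in>J. group (K j) \<and> sigma_primary \<sigma> (K j)" "G Mod {\<one>} \<cong> product_group J K" by auto
  have "G \<cong> G Mod {\<one>}"
    using trivial_factor_iso iso_set_sym group.iso_sym[OF normal.factorgroup_is_group[OF one_is_normal]] unfolding is_iso_def by blast
  hence "G \<cong> product_group J K" using iso_trans JK(3) by blast
  thus ?thesis unfolding sigma_nilpotent_def using JK by blast
qed

end

section \<open>The nilpotent length\<close>

context group
begin

lemma n_maximal_trans:
  "n_maximal G m T \<Longrightarrow> n_maximal (G\<lparr>carrier := T\<rparr>) n K \<Longrightarrow> n_maximal G (m + n) K"
  by (induction n arbitrary: K) auto

lemma n_maximal_of_maximal:
  assumes "maximal_subgroup (G\<lparr>carrier := L\<rparr>) M" "n_maximal (G\<lparr>carrier := M\<rparr>) n K" "subgroup L G"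
  shows "n_maximal (G\<lparr>carrier := L\<rparr>) (Suc n) K"
proof -
  interpret L: group "G\<lparr>carrier := L\<rparr>" using assms(3) subgroup_imp_group by blast
  have "n_maximal (G\<lparr>carrier := L\<rparr>) 1 M" using assms(1) by simp
  from L.n_maximal_trans[OF this, of n K] show ?thesis using assms(2) by simp
qed

lemma n_maximal_card:
  assumes "finite (carrier G)" shows "n_maximal G n L \<Longrightarrow> card L + n \<le> card (carrier G)"
proof (induction n arbitrary: L)
  case (Suc n)
  then obtain K where K: "n_maximal G n K" "maximal_subgroup (G\<lparr>carrier := K\<rparr>) L" by auto
  have "L \<subset> K" using K(2) by (simp add: maximal_subgroup_def)
  hence "card L < card K" using psubset_card_mono[OF finite_subgroup[OF assms n_maximal_subgroup[OF K(1)]]] by blast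
  thus ?case using Suc.IH[OF K(1)] by simp
qed simp

text \<open>For n > |G| there are no n-maximal subgroups, so \<open>?Q\<close> holds vacuously
  there; its least solution meets the threshold condition, which gives the \<open>LEAST\<close> in
  \<open>m_sigma\<close> and \<open>m_sigma_q\<close> a genuine value.\<close>

lemma threshold_least:
  assumes fin: "finite (carrier G)"
  obtains k where "(LEAST n. n_maximal_threshold P G n) = Suc k" "\<And>M. n_maximal G (Suc k) M \<Longrightarrow> P M"
proof -
  let ?Q = "\<lambda>n. n > 0 \<and> (\<forall>M. n_maximal G n M \<longrightarrow> P M)"
  have "?Q (Suc (card (carrier G)))"
    using n_maximal_card[OF fin, of "Suc (card (carrier G))"] by fastforce
  define n0 where "n0 = (LEAST n. ?Q n)"
  have n0: "?Q n0" unfolding n0_def by (rule LeastI[of ?Q]) fact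
  have "\<exists>M. n_maximal G (n0 - 1) M \<and> \<not> P M" if "n0 > 1"
    using not_less_Least[of "n0 - 1" ?Q] that unfolding n0_def[symmetric] by auto
  hence "n_maximal_threshold P G n0" using n0 by (simp add: n_maximal_threshold_def)
  hence th: "\<exists>n. n_maximal_threshold P G n" by blast
  define m where "m = (LEAST n. n_maximal_threshold P G n)"
  have "n_maximal_threshold P G m" unfolding m_def by (rule LeastI_ex[OF th])
  hence m: "0 < m" "\<forall>M. n_maximal G m M \<longrightarrow> P M" unfolding n_maximal_threshold_def by simp_all
  obtain k where "m = Suc k" using gr0_implies_Suc[OF m(1)] by blast
  thus ?thesis using that[of k] m(2) unfolding m_def by simp
qed

lemma threshold_residual_trivial:
  assumes fin: "finite (carrier G)" and \<sigma>: "primes_partition \<sigma>"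
    and P: "\<And>M. P M \<Longrightarrow> sigma_subnormal \<sigma> G M \<or> sigma_quasinormal \<sigma> G M"
    and k: "\<And>M. n_maximal G (Suc k) M \<Longrightarrow> P M" and L: "n_maximal G k L"
  shows "sigma_residual \<sigma> G L = {\<one>}"
  using sigma_residual_trivial_subgroup[OF fin \<sigma> n_maximal_subgroup[OF L]] P k L by auto

lemma chief_below:
  assumes fin: "finite (carrier G)" and R: "R \<lhd> G" "R \<noteq> {\<one>}"
  obtains K where "chief_factor G R K"
proof -
  let ?S = "{K. K \<lhd> G \<and> K \<subset> R}"
  have sR: "subgroup R G" using R normal_imp_subgroup by blast
  have "?S \<subseteq> Pow R" by auto
  hence "finite ?S" using finite_subgroup[OF fin sR] by (meson finite_Pow_iff finite_subset)
  moreover have "{\<one>} \<in> ?S" using one_is_normal subgroup.one_closed[OF sR] R(2) by auto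
  ultimately obtain K where K: "K \<in> ?S" "\<And>L. L \<in> ?S \<Longrightarrow> K \<subseteq> L \<Longrightarrow> K = L"
    using finite_has_maximal[of ?S] by auto
  have "chief_factor G R K" unfolding chief_factor_def using K R(1) by auto
  thus ?thesis using that by blast
qed

lemma minimal_normal_with:
  assumes fin: "finite (carrier G)" and Q: "Q (carrier G)"
  obtains R where "R \<lhd> G" "Q R" "\<And>K. K \<lhd> G \<Longrightarrow> K \<subset> R \<Longrightarrow> \<not> Q K"
proof -
  let ?S = "{R. R \<lhd> G \<and> Q R}"
  have "?S \<subseteq> Pow (carrier G)" using subgroup.subset[OF normal_imp_subgroup] by auto
  hence "finite ?S" using fin by (meson finite_Pow_iff finite_subset)
  moreover have "carrier G \<in> ?S" using Q normal_self by simp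
  ultimately obtain R where R: "R \<in> ?S" "\<And>K. K \<in> ?S \<Longrightarrow> K \<subseteq> R \<Longrightarrow> R = K"
    using finite_has_minimal[of ?S] by auto
  show ?thesis using that[of R] R by blast
qed

text \<open>Take a chief factor R/K below a minimal normal subgroup R of G containing L. Then L
  \<inter> K is a proper normal subgroup of L with \<sigma>-primary quotient, obtained from the
  chief factors of G without asking whether L is \<sigma>-soluble.\<close>

lemma sigma_soluble_subgroup:
  assumes fin: "finite (carrier G)" and \<sigma>: "primes_partition \<sigma>" and sol: "sigma_soluble \<sigma> G"
    and L: "subgroup L G" "L \<noteq> {\<one>}"
  obtains K s where "K \<lhd> G" "\<not> L \<subseteq> K" "s \<in> \<sigma>" "\<And>x. x \<in> L \<Longrightarrow> pi_elt G (-s) x \<Longrightarrow> x \<in> K"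
proof -
  obtain R where R: "R \<lhd> G" "L \<subseteq> R" "\<And>K. K \<lhd> G \<Longrightarrow> K \<subset> R \<Longrightarrow> \<not> L \<subseteq> K"
    using minimal_normal_with[OF fin, of "\<lambda>R. L \<subseteq> R"] subgroup.subset[OF L(1)] by blast
  have "R \<noteq> {\<one>}" using L(2) R(2) subgroup.one_closed[OF L(1)] by blast
  then obtain K where K: "chief_factor G R K" using chief_below[OF fin R(1)] by blast
  have K': "K \<lhd> G" "K \<subset> R" using K by (auto simp: chief_factor_def)
  have sR: "subgroup R G" using R(1) normal_imp_subgroup by blast
  let ?R = "G\<lparr>carrier := R\<rparr>"
  interpret T: group ?R using sR subgroup_imp_group by blast
  have "sigma_primary \<sigma> (?R Mod K)" using sol K by (auto simp: sigma_soluble_def)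
  moreover have "K \<lhd> ?R" using normal_restrict_supergroup[OF sR K'(1)] K'(2) by blast
  moreover have "finite (carrier ?R)" using finite_subgroup[OF fin sR] by simp
  ultimately obtain s where "s \<in> \<sigma>" "\<forall>x\<in>R. pi_elt G (-s) x \<longrightarrow> x \<in> K"
    using T.sigma_primary_good[OF _ \<sigma>] by auto
  thus ?thesis using that[OF K'(1) R(3)[OF K'] ] R(2) by blast
qed

lemma residual_iterate_subgroup:
  "subgroup L G \<Longrightarrow> subgroup ((sigma_residual \<sigma> G ^^ n) L) G"
  by (induction n) (auto intro: subgroup_sigma_residual)

lemma residual_iterate_normal:
  "L \<lhd> G \<Longrightarrow> (sigma_residual \<sigma> G ^^ n) L \<lhd> G"
  by (induction n) (auto intro: normal_sigma_residual)

lemma residual_iterate_mono: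
  "K \<subseteq> L \<Longrightarrow> (sigma_residual \<sigma> G ^^ n) K \<subseteq> (sigma_residual \<sigma> G ^^ n) L"
  by (induction n) (auto intro!: sigma_residual_mono)

text \<open>D(L) \<subseteq> O^s(L) \<subseteq> L \<inter> K, so a maximal subgroup M of L above L
  \<inter> K contains D(L). One application of D thus descends into M, and monotonicity transfers
  the induction hypothesis from M to D(L). At n = 0 one iteration is already needed, hence
  \<open>Suc n\<close>.\<close>

lemma residual_iterate_trivial:
  assumes fin: "finite (carrier G)" and \<sigma>: "primes_partition \<sigma>" and sol: "sigma_soluble \<sigma> G"
    and "subgroup L G" "\<And>K. n_maximal (G\<lparr>carrier := L\<rparr>) n K \<Longrightarrow> sigma_residual \<sigma> G K = {\<one>}"
  shows "(sigma_residual \<sigma> G ^^ Suc n) L = {\<one>}"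
  using assms(4,5)
proof (induction n arbitrary: L)
  case 0
  thus ?case by simp
next
  case (Suc n)
  note L = Suc.prems(1)
  have one: "\<one> \<in> (sigma_residual \<sigma> G ^^ Suc (Suc n)) L"
    using subgroup.one_closed[OF residual_iterate_subgroup[OF L]] .
  show ?case
  proof (cases "L = {\<one>}")
    case True
    \<comment> \<open>The trivial group has no maximal subgroup to descend to.\<close>
    have "(sigma_residual \<sigma> G ^^ j) L \<subseteq> L" for j
      by (induction j) (use sigma_residual_subset in \<open>auto intro: subset_trans\<close>)
    thus ?thesis using one unfolding True by blast
  next
    case False
    obtain K s where K: "K \<lhd> G" "\<not> L \<subseteq> K" "s \<in> \<sigma>" "\<And>x. x \<in> L \<Longrightarrow> pi_elt G (-s) x \<Longrightarrow> x \<in> K"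
      using sigma_soluble_subgroup[OF fin \<sigma> sol L False] by blast
    let ?L = "G\<lparr>carrier := L\<rparr>"
    interpret L: group ?L using L subgroup_imp_group by blast
    have sK: "subgroup K G" using K(1) normal_imp_subgroup by blast
    have sN: "subgroup (L \<inter> K) G" using subgroups_Inter_pair[OF L sK] .
    have "subgroup (L \<inter> K) ?L" by (rule subgroup_incl[OF sN L]) auto
    moreover have "L \<inter> K \<noteq> carrier ?L" using K(2) by auto
    moreover have "finite (carrier ?L)" using finite_subgroup[OF fin L] by simp
    ultimately obtain M where M: "maximal_subgroup ?L M" "L \<inter> K \<subseteq> M"
      using L.maximal_subgroup_exists by blast
    have sM: "subgroup M G" using incl_subgroup[OF L] M(1) by (simp add: maximal_subgroup_def)
    have "(sigma_residual \<sigma> G ^^ Suc n) M = {\<one>}"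
      by (rule Suc.IH[OF sM]) (use Suc.prems(2) n_maximal_of_maximal[OF M(1) _ L] in blast)
    moreover have "sigma_residual \<sigma> G L \<subseteq> M"
    proof -
      have "sigma_residual \<sigma> G L \<subseteq> pi_residual G s L" using K(3) by (auto simp: sigma_residual_def)
      also have "\<dots> \<subseteq> L \<inter> K" by (rule pi_residual_least[OF sN]) (use K(4) in auto)
      finally show ?thesis using M(2) by blast
    qed
    ultimately have "(sigma_residual \<sigma> G ^^ Suc n) (sigma_residual \<sigma> G L) \<subseteq> {\<one>}"
      using residual_iterate_mono by metis
    thus ?thesis using one by (simp only: funpow_Suc_right o_apply) blast
  qed
qed

lemma sigma_nilpotent_length_le:
  assumes fin: "finite (carrier G)" and \<sigma>: "primes_partition \<sigma>"
    and triv: "(sigma_residual \<sigma> G ^^ t) (carrier G) = {\<one>}"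
  shows "sigma_nilpotent_length \<sigma> G \<le> t"
proof -
  \<comment> \<open>The iterated residuals descend from G; the exponent \<open>t - i\<close>
    reverses them into an ascending chain.\<close>
  define A where "A = (\<lambda>i. (sigma_residual \<sigma> G ^^ (t - i)) (carrier G))"
  have nA: "A i \<lhd> G" for i unfolding A_def using residual_iterate_normal[OF normal_self] .
  have sA: "subgroup (A i) G" for i using nA normal_imp_subgroup by blast
  have step: "A i = sigma_residual \<sigma> G (A (Suc i))" if "i < t" for i
  proof -
    have "t - i = Suc (t - Suc i)" using that by simp
    thus ?thesis unfolding A_def by (simp only: funpow.simps o_apply)
  qed
  have "sigma_nilpotent_chain \<sigma> G A t" unfolding sigma_nilpotent_chain_def
  proof (intro conjI allI impI)
    show "A 0 = {\<one>}" "A t = carrier G" using triv by (simp_all add: A_def)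
    fix i assume i: "i < t"
    show "A i \<subseteq> A (Suc i)" unfolding step[OF i] by (rule sigma_residual_subset)
    let ?H = "G\<lparr>carrier := A (Suc i)\<rparr>"
    interpret H: group ?H using sA subgroup_imp_group by blast
    have "sigma_nilpotent \<sigma> (?H Mod sigma_residual \<sigma> ?H (carrier ?H))"
      by (rule H.quotient_sigma_nilpotent[OF _ \<sigma>]) (use finite_subgroup[OF fin sA] in simp)
    thus "sigma_nilpotent \<sigma> (?H Mod A i)"
      using sigma_residual_consistent[OF sA, of "A (Suc i)" "Suc i"] step[OF i] by simp
  qed (rule nA)
  thus ?thesis unfolding sigma_nilpotent_length_def by (intro Least_le) blast
qed

theorem sigma_nilpotent_length_le_m_sigma:
  assumes fin: "finite (carrier G)" and \<sigma>: "primes_partition \<sigma>" and sol: "sigma_soluble \<sigma> G"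
  shows "sigma_nilpotent_length \<sigma> G \<le> m_sigma \<sigma> G"
proof -
  obtain k where k: "m_sigma \<sigma> G = Suc k" "\<And>M. n_maximal G (Suc k) M \<Longrightarrow> sigma_subnormal \<sigma> G M"
    using threshold_least[OF fin, of "sigma_subnormal \<sigma> G"] unfolding m_sigma_def by metis
  have "n_maximal G k L \<Longrightarrow> sigma_residual \<sigma> G L = {\<one>}" for L
    using threshold_residual_trivial[OF fin \<sigma>, of "sigma_subnormal \<sigma> G" k L] k(2) by blast
  hence "(sigma_residual \<sigma> G ^^ Suc k) (carrier G) = {\<one>}"
    by (intro residual_iterate_trivial[OF fin \<sigma> sol subgroup_self]) simp
  thus ?thesis using sigma_nilpotent_length_le[OF fin \<sigma>] k(1) by metis
qed

text \<open>If R' were not inside K, the chief condition would give K R' = R, so R/K would be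
  perfect, against solubility. For p dividing |R/K|, the x in R with x^p in K form a normal
  subgroup, larger than K by Cauchy, hence all of R. The conclusions speak of elements of G so that
  no quotient group has to be carried along.\<close>

lemma chief_factor_elementary:
  assumes fin: "finite (carrier G)" and sol: "solvable G" and RK: "chief_factor G R K"
  obtains p where "Factorial_Ring.prime (p::nat)" "\<And>x. x \<in> R \<Longrightarrow> x [^] p \<in> K"
    "\<And>x y. x \<in> R \<Longrightarrow> y \<in> R \<Longrightarrow> x \<otimes> y \<otimes> inv x \<otimes> inv y \<in> K"
    "pi_num {p} (card R div card K)" "card R div card K \<noteq> 1"
proof -
  have R: "R \<lhd> G" and K: "K \<lhd> G" "K \<subset> R" and min: "\<And>L. L \<lhd> G \<Longrightarrow> K \<subset> L \<Longrightarrow> \<not> L \<subset> R"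
    using RK by (auto simp: chief_factor_def)
  have sR: "subgroup R G" and sK: "subgroup K G" using R K normal_imp_subgroup by auto
  note Rc = subgroup.mem_carrier[OF sR] and Kc = subgroup.mem_carrier[OF sK]
  let ?\<phi> = "\<lambda>x. K #> x"
  interpret h: group_hom G "G Mod K" ?\<phi> using group_hom_Mod[OF K(1)] .
  have \<phi>_one: "?\<phi> x = \<one>\<^bsub>G Mod K\<^esub> \<longleftrightarrow> x \<in> K" if "x \<in> carrier G" for x
    using coset_join1[OF _ that sK] coset_join2[OF that sK] rcos_self[OF that sK] by auto
  let ?R' = "derived G R"
  have nR': "?R' \<lhd> G" using derived_is_normal[OF R] .
  have R'R: "?R' \<subseteq> R" using derived_incl[OF subset_refl sR] .
  have sR': "subgroup ?R' G" using nR' normal_imp_subgroup by blast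
  have R'K: "?R' \<subseteq> K"
  proof (rule ccontr)
    assume "\<not> ?R' \<subseteq> K"
    have nKR: "K <#> ?R' \<lhd> G" using normal_subgroup_set_mult_closed[OF K(1) nR'] .
    have "K <#> ?R' \<subseteq> R" using K(2) R'R subgroup.m_closed[OF sR] by (auto simp: set_mult_def)
    moreover have "K \<subset> K <#> ?R'" using set_mult_superset[OF sK sR'] \<open>\<not> ?R' \<subseteq> K\<close> by blast
    ultimately have eq: "K <#> ?R' = R" using min[OF nKR] by blast
    have "?\<phi> ` R \<subseteq> ?\<phi> ` ?R'"
    proof
      fix y assume "y \<in> ?\<phi> ` R"
      then obtain r0 where r0: "r0 \<in> K <#> ?R'" "y = ?\<phi> r0" using eq by auto
      then obtain k r where kr: "k \<in> K" "r \<in> ?R'" "y = ?\<phi> (k \<otimes> r)" unfolding set_mult_def by blast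
      have "?\<phi> (k \<otimes> r) = ?\<phi> r"
        using r_coset_eq_iff[OF sK, of "k \<otimes> r" r] kr Kc subgroup.mem_carrier[OF sR'] by (simp add: m_assoc)
      thus "y \<in> ?\<phi> ` ?R'" using kr by blast
    qed
    hence "?\<phi> ` R = ?\<phi> ` ?R'" using R'R by blast
    hence "derived (G Mod K) (?\<phi> ` R) = ?\<phi> ` R" using h.derived_img[OF subgroup.subset[OF sR]] by simp
    hence "(derived (G Mod K) ^^ n) (?\<phi> ` R) = ?\<phi> ` R" for n by (induction n) auto
    hence img: "?\<phi> ` ((derived G ^^ n) R) = ?\<phi> ` R" for n
      using h.exp_of_derived_img[OF subgroup.subset[OF sR]] by metis
    obtain n where n: "(derived G ^^ n) (carrier G) = {\<one>}"
      using sol solvable_iff_trivial_derived_seq by blast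
    have "(derived G ^^ n) R \<subseteq> {\<one>}"
      using mono_exp_of_derived[OF subgroup.subset[OF sR], of n] n by simp
    hence R1: "?\<phi> ` R \<subseteq> {?\<phi> \<one>}" using img[of n] by blast
    have "R \<subseteq> K"
    proof
      fix x assume x: "x \<in> R"
      hence "?\<phi> x = ?\<phi> \<one>" using R1 by blast
      thus "x \<in> K" using \<phi>_one[OF Rc[OF x]] h.hom_one by simp
    qed
    thus False using K(2) by blast
  qed
  have comm: "x \<otimes> y \<otimes> inv x \<otimes> inv y \<in> K" if "x \<in> R" "y \<in> R" for x y
    using that R'K unfolding derived_def by (auto intro!: generate.incl)
  have card: "card (?\<phi> ` R) * card K = card R" using card_coset_image[OF sR sK] K(2) by blast
  hence cd: "card R div card K = card (?\<phi> ` R)"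
    using card_subgroup_pos[OF fin sK] by (metis nonzero_mult_div_cancel_right less_irrefl)
  have "card K < card R" using psubset_card_mono[OF finite_subgroup[OF fin sR] K(2)] .
  hence c1: "card (?\<phi> ` R) \<noteq> 1" using card by auto
  then obtain p where p: "Factorial_Ring.prime p" "p dvd card (?\<phi> ` R)" using prime_factor_nat by blast
  have s\<phi>R: "subgroup (?\<phi> ` R) (G Mod K)" using h.subgroup_img_is_subgroup[OF sR] .
  have finM: "finite (carrier (G Mod K))" using fin by (simp add: carrier_FactGroup)
  interpret I: group "(G Mod K)\<lparr>carrier := ?\<phi> ` R\<rparr>" using h.H.subgroup_imp_group[OF s\<phi>R] .
  obtain y where y: "y \<in> ?\<phi> ` R" "y \<noteq> \<one>\<^bsub>G Mod K\<^esub>" "y [^]\<^bsub>(G Mod K)\<lparr>carrier := ?\<phi> ` R\<rparr>\<^esub> p = \<one>\<^bsub>G Mod K\<^esub>"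
    using I.Cauchy[of p] p finite_subgroup[OF fin sR] by (auto simp: order_def)
  then obtain x0 where x0: "x0 \<in> R" "y = ?\<phi> x0" by auto
  have "y [^]\<^bsub>G Mod K\<^esub> p = \<one>\<^bsub>G Mod K\<^esub>" using y(3) by (simp add: nat_pow_def)
  hence x0': "x0 [^] p \<in> K" "x0 \<notin> K" using y(2) x0 hom_pow_Mod[OF K(1)] \<phi>_one Rc by auto
  let ?U = "{x \<in> R. x [^] p \<in> K}"
  have sU: "subgroup ?U G"
  proof (rule subgroupI)
    show "?U \<noteq> {}" using subgroup.one_closed[OF sR] subgroup.one_closed[OF sK] by (auto intro!: exI[of _ \<one>])
    fix a assume a: "a \<in> ?U"
    have "(inv a) [^] p = inv (a [^] p)" using a Rc by (simp add: nat_pow_inv)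
    thus "inv a \<in> ?U" using a subgroup.m_inv_closed[OF sR] subgroup.m_inv_closed[OF sK] by auto
    fix b assume b: "b \<in> ?U"
    have ab: "a \<in> carrier G" "b \<in> carrier G" using a b Rc by auto
    have "?\<phi> (a \<otimes> b) = ?\<phi> (b \<otimes> a)"
      using r_coset_eq_iff[OF sK, of "a \<otimes> b" "b \<otimes> a"] comm[of a b] a b ab by (simp add: group_simps)
    hence "?\<phi> a \<otimes>\<^bsub>G Mod K\<^esub> ?\<phi> b = ?\<phi> b \<otimes>\<^bsub>G Mod K\<^esub> ?\<phi> a" using ab h.hom_mult by metis
    hence "(?\<phi> a \<otimes>\<^bsub>G Mod K\<^esub> ?\<phi> b) [^]\<^bsub>G Mod K\<^esub> p = ?\<phi> a [^]\<^bsub>G Mod K\<^esub> p \<otimes>\<^bsub>G Mod K\<^esub> ?\<phi> b [^]\<^bsub>G Mod K\<^esub> p"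
      by (rule h.H.pow_mult_distrib) (use ab h.hom_closed in auto)
    also have "?\<phi> a [^]\<^bsub>G Mod K\<^esub> p = \<one>\<^bsub>G Mod K\<^esub>"
      using a ab hom_pow_Mod[OF K(1) ab(1), of p] \<phi>_one[of "a [^] p"] by simp
    also have "?\<phi> b [^]\<^bsub>G Mod K\<^esub> p = \<one>\<^bsub>G Mod K\<^esub>"
      using b ab hom_pow_Mod[OF K(1) ab(2), of p] \<phi>_one[of "b [^] p"] by simp
    also have "\<one>\<^bsub>G Mod K\<^esub> \<otimes>\<^bsub>G Mod K\<^esub> \<one>\<^bsub>G Mod K\<^esub> = \<one>\<^bsub>G Mod K\<^esub>"
      by (rule h.H.l_one[OF h.H.one_closed])
    finally have "?\<phi> ((a \<otimes> b) [^] p) = \<one>\<^bsub>G Mod K\<^esub>" using ab hom_pow_Mod[OF K(1), of "a \<otimes> b" p] h.hom_mult[of a b] by simp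
    thus "a \<otimes> b \<in> ?U" using \<phi>_one ab a b subgroup.m_closed[OF sR] by auto
  qed (use Rc in auto)
  have nU: "?U \<lhd> G"
  proof (rule normalI'[OF sU])
    fix g x assume g: "g \<in> carrier G" and x: "x \<in> ?U"
    thus "g \<otimes> x \<otimes> inv g \<in> ?U" using normal_closed[OF R g] normal_closed[OF K(1) g] conj_pow[OF _ g] Rc by auto
  qed
  have "K \<subset> ?U" using x0' x0 K(2) subgroup_nat_pow[OF sK] by blast
  hence "?U = R" using min[OF nU] by blast
  hence pow: "x [^] p \<in> K" if "x \<in> R" for x using that by blast
  have "pi_num {p} (card (?\<phi> ` R))"
  proof (rule h.H.pi_num_card_of_pi_elt[OF s\<phi>R finM])
    fix y assume "y \<in> ?\<phi> ` R"
    then obtain x where x: "x \<in> R" "y = ?\<phi> x" by auto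
    have "y [^]\<^bsub>G Mod K\<^esub> p = \<one>\<^bsub>G Mod K\<^esub>" using x pow hom_pow_Mod[OF K(1)] \<phi>_one Rc by auto
    thus "pi_elt (G Mod K) {p} y" using p(1) unfolding pi_elt_def by (intro exI[of _ p]) (simp add: pi_num_prime)
  qed
  thus ?thesis using that[OF p(1) pow comm] cd c1 by simp
qed

text \<open>Let R be minimal among the normal subgroups not inside M, with chief factor R/K. Then RM
  = G and K \<subseteq> M, so |G:M| = |R : R \<inter> M| divides |R/K|, a power of one prime.
  Passing to M loses at most this prime.\<close>

lemma maximal_subgroup_primes:
  assumes fin: "finite (carrier G)" and sol: "solvable G" and M: "maximal_subgroup G M"
  obtains p where "prime_factors (order G) \<subseteq> insert p (prime_factors (card M))"
proof -
  have sM: "subgroup M G" "M \<subset> carrier G" and max: "\<And>L. subgroup L G \<Longrightarrow> M \<subset> L \<Longrightarrow> \<not> L \<subset> carrier G"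
    using M by (auto simp: maximal_subgroup_def)
  obtain R where R: "R \<lhd> G" "\<not> R \<subseteq> M" "\<And>K. K \<lhd> G \<Longrightarrow> K \<subset> R \<Longrightarrow> K \<subseteq> M"
    using minimal_normal_with[OF fin, of "\<lambda>R. \<not> R \<subseteq> M"] sM(2) by (metis psubset_eq subset_antisym)
  have "R \<noteq> {\<one>}" using R(2) subgroup.one_closed[OF sM(1)] by blast
  then obtain K where RK: "chief_factor G R K" using chief_below[OF fin R(1)] by blast
  have K: "K \<lhd> G" "K \<subset> R" using RK by (auto simp: chief_factor_def)
  have sR: "subgroup R G" and sK: "subgroup K G" using R K normal_imp_subgroup by auto
  obtain p where p: "Factorial_Ring.prime p" "pi_num {p} (card R div card K)"
    using chief_factor_elementary[OF fin sol RK] by metis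
  have sRM: "subgroup (R <#> M) G" using subgroup_set_mult[OF sR sM(1) set_mult_normal_commute[OF R(1) sM(1)]] .
  have "M \<subset> R <#> M" using set_mult_superset[OF sR sM(1)] R(2) by blast
  hence "R <#> M = carrier G" using max[OF sRM] subgroup.subset[OF sRM] by blast
  hence c: "order G * card (R \<inter> M) = card R * card M" using card_set_mult[OF sR sM(1)] by (simp add: order_def)
  have sI: "subgroup (R \<inter> M) G" using subgroups_Inter_pair[OF sR sM(1)] .
  obtain i where i: "card R = card (R \<inter> M) * i" using card_subgroup_dvd[OF sR sI] by auto
  have "K \<subseteq> R \<inter> M" using R(3)[OF K] K(2) by blast
  then obtain j where j: "card (R \<inter> M) = card K * j" using card_subgroup_dvd[OF sI sK] by (auto elim!: dvdE)
  have "card R div card K = j * i" using i j card_subgroup_pos[OF fin sK] by (simp add: mult.assoc)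
  hence "pi_num {p} i" using p(2) by (simp add: pi_num_mult)
  moreover have "order G = i * card M" using c i card_subgroup_pos[OF fin sI] by simp
  ultimately have "prime_factors (order G) \<subseteq> insert p (prime_factors (card M))"
    using card_subgroup_pos[OF fin sM(1)]
    by (auto simp: prime_factors_dvd pi_num_def prime_dvd_mult_iff)
  thus ?thesis using that by blast
qed

text \<open>The commutator of x and y lies in every O^r(H): for r = s because y does, for r \<noteq>
  s because x does.\<close>

lemma commute_of_trivial_residual:
  assumes \<sigma>: "primes_partition \<sigma>" "s \<in> \<sigma>" and H: "subgroup H G" "sigma_residual \<sigma> G H = {\<one>}"
    and x: "x \<in> H" "pi_elt G s x" and y: "y \<in> H" "pi_elt G (-s) y"
  shows "x \<otimes> y = y \<otimes> x"
proof -
  have c: "x \<in> carrier G" "y \<in> carrier G" using x y subgroup.mem_carrier[OF H(1)] by auto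
  have "x \<otimes> y \<otimes> inv x \<otimes> inv y \<in> pi_residual G r H" if r: "r \<in> \<sigma>" for r
  proof -
    have sE: "subgroup (pi_residual G r H) G" using subgroup_pi_residual[OF subgroup.subset[OF H(1)]] .
    have norm: "g \<otimes> z \<otimes> inv g \<in> pi_residual G r H" if "g \<in> H" "z \<in> pi_residual G r H" for g z
      using pi_residual_conj[OF subgroup.subset[OF H(1)] _ _ that(2)] that(1) H(1)
      by (simp add: subgroup.mem_carrier subgroup.m_closed subgroup.m_inv_closed)
    show ?thesis
    proof (cases "r = s")
      case True
      hence yE: "y \<in> pi_residual G r H" using pi_residual_mem y by blast
      have "(x \<otimes> y \<otimes> inv x) \<otimes> inv y \<in> pi_residual G r H"
        using norm[OF x(1) yE] yE sE by (simp add: subgroup.m_closed subgroup.m_inv_closed)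
      thus ?thesis .
    next
      case False
      hence "pi_elt G (-r) x" using pi_elt_mono[OF x(2)] block_disjoint[OF \<sigma> r] by blast
      hence xE: "x \<in> pi_residual G r H" using pi_residual_mem x by blast
      have "x \<otimes> (y \<otimes> inv x \<otimes> inv y) \<in> pi_residual G r H"
        using norm[OF y(1), of "inv x"] xE sE by (simp add: subgroup.m_closed subgroup.m_inv_closed)
      thus ?thesis using c by (simp add: m_assoc)
    qed
  qed
  moreover have "x \<otimes> y \<otimes> inv x \<otimes> inv y \<in> H" using x y H(1) by (simp add: subgroup.m_closed subgroup.m_inv_closed)
  ultimately have "x \<otimes> y \<otimes> inv x \<otimes> inv y \<in> sigma_residual \<sigma> G H" by (simp add: sigma_residual_def)
  hence "(x \<otimes> y) \<otimes> inv (y \<otimes> x) = \<one>" using H(2) c by (simp add: group_simps)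
  thus ?thesis using c by (metis m_closed inv_closed inv_equality inv_inv)
qed

end

section \<open>The number of primes\<close>

context group
begin

text \<open>By the Frattini argument the index of the normalizer of Q divides |A|, so it is prime to
  p, and a conjugate of P lies in that normalizer. Conjugating Q back gives a Sylow subgroup
  normalized by P itself.\<close>

lemma p_group_normalizes_Sylow:
  assumes fin: "finite (carrier G)" and A: "A \<lhd> G" and q: "Factorial_Ring.prime (q::nat)"
    and P: "subgroup P G" "card P = p ^ a" and p: "Factorial_Ring.prime (p::nat)" "\<not> p dvd card A"
  obtains Q b m where "subgroup Q G" "Q \<subseteq> A" "card Q = q ^ b" "card A = q ^ b * m" "\<not> q dvd m"
    "\<And>x y. x \<in> P \<Longrightarrow> y \<in> Q \<Longrightarrow> x \<otimes> y \<otimes> inv x \<in> Q"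
proof -
  have sA: "subgroup A G" using A normal_imp_subgroup by blast
  obtain Q b m where Q: "subgroup Q G" "Q \<subseteq> A" "card Q = q ^ b" "card A = q ^ b * m" "\<not> q dvd m"
    "\<And>g. g \<in> carrier G \<Longrightarrow> \<exists>n\<in>A. n \<otimes> g \<in> normalizer G Q"
    using Frattini_argument[OF fin A q] by blast
  note Qc = subgroup.mem_carrier[OF Q(1)] and Ac = subgroup.mem_carrier[OF sA] and Pc = subgroup.mem_carrier[OF P(1)]
  let ?N = "normalizer G Q"
  have sN: "subgroup ?N G" using subgroup_normalizer[OF subgroup.subset[OF Q(1)]] .
  note Nc = subgroup.mem_carrier[OF sN]
  have "g \<in> A <#> ?N" if g: "g \<in> carrier G" for g
  proof -
    obtain n where n: "n \<in> A" "n \<otimes> g \<in> ?N" using Q(6)[OF g] by blast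
    have "g = inv n \<otimes> (n \<otimes> g)" using n(1) Ac g by (simp add: group_simps)
    thus ?thesis using n subgroup.m_inv_closed[OF sA n(1)] unfolding set_mult_def by blast
  qed
  hence "A <#> ?N = carrier G" using Ac Nc by (auto simp: set_mult_def)
  hence "card (carrier G) * card (A \<inter> ?N) = card A * card ?N"
    using card_set_mult[OF sA sN] by simp
  hence "card (rcosets ?N) * card (A \<inter> ?N) * card ?N = card A * card ?N"
    unfolding index_mult_card[OF fin sN, symmetric] by (simp add: mult_ac)
  hence "card (rcosets ?N) * card (A \<inter> ?N) = card A" using card_subgroup_pos[OF fin sN] by simp
  hence "\<not> p dvd card (rcosets ?N)" using p(2) by (metis dvd_mult2)
  then obtain g where g: "g \<in> carrier G" "\<And>x. x \<in> P \<Longrightarrow> g \<otimes> x \<otimes> inv g \<in> ?N"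
    using Sylow_embedding[OF fin P p(1) sN] by metis
  let ?Q = "(\<lambda>x. inv g \<otimes> x \<otimes> inv (inv g)) ` Q"
  have gi: "inv g \<in> carrier G" using g by simp
  have "x \<otimes> y \<otimes> inv x \<in> ?Q" if x: "x \<in> P" and y: "y \<in> ?Q" for x y
  proof -
    obtain z where z: "z \<in> Q" "y = inv g \<otimes> z \<otimes> inv (inv g)" using y by auto
    have "(g \<otimes> x \<otimes> inv g) \<otimes> z \<otimes> inv (g \<otimes> x \<otimes> inv g) \<in> Q"
      using g(2)[OF x] mem_normalizer_iff[OF fin subgroup.subset[OF Q(1)]] z(1) by blast
    moreover have "x \<otimes> y \<otimes> inv x = inv g \<otimes> ((g \<otimes> x \<otimes> inv g) \<otimes> z \<otimes> inv (g \<otimes> x \<otimes> inv g)) \<otimes> inv (inv g)"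
      using z x g(1) Pc Qc by (simp add: group_simps)
    ultimately show ?thesis by blast
  qed
  moreover have "?Q \<subseteq> A" using normal_closed[OF A gi] Q(2) by auto
  ultimately show ?thesis using that[of ?Q b m] conj_subgroup[OF Q(1) gi] Q(3,4,5) by simp
qed

text \<open>A prime dividing |A:C| would contradict a full Sylow subgroup of A for that prime being
  inside C.\<close>

lemma card_dvd_of_Sylow:
  assumes fin: "finite (carrier G)" and A: "subgroup A G" and C: "subgroup C G" "C \<subseteq> A"
    and S: "\<And>q. Factorial_Ring.prime q \<Longrightarrow> q dvd card A \<Longrightarrow>
      \<exists>Q b m. subgroup Q G \<and> Q \<subseteq> C \<and> card Q = q ^ b \<and> card A = q ^ b * m \<and> \<not> q dvd m"
  shows "C = A"
proof -
  obtain j where j: "card A = card C * j" using card_subgroup_dvd[OF A C(1,2)] by (auto elim!: dvdE)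
  have "j = 1"
  proof (rule ccontr)
    assume "j \<noteq> 1"
    then obtain q where q: "Factorial_Ring.prime q" "q dvd j" using prime_factor_nat by blast
    hence "q dvd card A" using j by simp
    then obtain Q b m where Q: "subgroup Q G" "Q \<subseteq> C" "card Q = q ^ b" "card A = q ^ b * m" "\<not> q dvd m"
      using S[OF q(1)] by blast
    obtain i where i: "card C = q ^ b * i" using card_subgroup_dvd[OF C(1) Q(1,2)] Q(3) by (auto elim!: dvdE)
    have "q ^ b * m = q ^ b * (i * j)" using Q(4) j i by (metis mult.assoc)
    hence "m = i * j" using prime_gt_0_nat[OF q(1)] by auto
    thus False using Q(5) q(2) by simp
  qed
  thus ?thesis using subgroup_eqI[OF A C fin] j by simp
qed

text \<open>Take a chief factor G/N, of exponent p, and the block s of p. As D(N) = 1, N is the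
  product of its s-part S and its s'-part A = O^s(N). A Sylow p-subgroup P of G normalizes a Sylow
  q-subgroup of A for each q; their product is proper thanks to a third prime, so P centralizes that
  subgroup and in the end all of A. Then H = SP is an s-group centralizing A, G = A x H, and D(G)
  falls into D(N) = 1.\<close>

lemma two_primes_of_minimal:
  assumes fin: "finite (carrier G)" and \<sigma>: "primes_partition \<sigma>" and sol: "solvable G"
    and max: "\<And>M. maximal_subgroup G M \<Longrightarrow> sigma_residual \<sigma> G M = {\<one>}"
    and three: "card (prime_factors (order G)) > 2"
  shows "sigma_residual \<sigma> G (carrier G) = {\<one>}"
proof -
  have proper: "sigma_residual \<sigma> G H = {\<one>}" if H: "subgroup H G" "H \<noteq> carrier G" for H
  proof -
    obtain M where M: "maximal_subgroup G M" "H \<subseteq> M" using maximal_subgroup_exists[OF fin H] .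
    thus ?thesis using sigma_residual_mono[OF M(2), of \<sigma>] max[OF M(1)] one_in_sigma_residual[OF H(1), of \<sigma>] by blast
  qed
  have "carrier G \<noteq> {\<one>}" using three by (auto simp: order_def)
  then obtain N where GN: "chief_factor G (carrier G) N" using chief_below[OF fin normal_self] by blast
  have N: "N \<lhd> G" "N \<subset> carrier G" using GN by (auto simp: chief_factor_def)
  have sN: "subgroup N G" using N normal_imp_subgroup by blast
  note Nc = subgroup.mem_carrier[OF sN]
  obtain p where p: "Factorial_Ring.prime (p::nat)" and pN: "\<And>x. x \<in> carrier G \<Longrightarrow> x [^] p \<in> N"
    and comm: "\<And>x y. x \<in> carrier G \<Longrightarrow> y \<in> carrier G \<Longrightarrow> x \<otimes> y \<otimes> inv x \<otimes> inv y \<in> N"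
    using chief_factor_elementary[OF fin sol GN] by metis
  obtain s where s: "s \<in> \<sigma>" "p \<in> s" using block_exists[OF \<sigma> p] .
  have DN: "sigma_residual \<sigma> G N = {\<one>}" using proper[OF sN] N(2) by blast
  let ?A = "pi_residual G s N"
  have nA: "?A \<lhd> G" using normal_pi_residual[OF N(1)] .
  have sA: "subgroup ?A G" using nA normal_imp_subgroup by blast
  have AN: "?A \<subseteq> N" using pi_residual_subset[OF sN] .
  note Ac = subgroup.mem_carrier[OF sA]
  have A_elt: "pi_elt G (-s) x" if x: "x \<in> ?A" for x
  proof -
    obtain m where "pi_num (-s) m" "x [^] m \<in> sigma_residual \<sigma> G N"
      using pow_pi_residual_in_sigma_residual[OF fin \<sigma> s(1) sN x] .
    thus ?thesis using DN unfolding pi_elt_def by blast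
  qed
  hence A_num: "pi_num (-s) (card ?A)" using pi_num_card_of_pi_elt[OF sA fin] by blast
  \<comment> \<open>This is the s-part of N: an element has an s-power in \<open>?A\<close>, and
    \<open>S\<close> meets \<open>?A\<close> in D(N) = 1. As an intersection of normal subgroups it
    is normal in G.\<close>
  define S where "S = \<Inter> (insert N ((\<lambda>r. pi_residual G r N) ` (\<sigma> - {s})))"
  have sS: "subgroup S G" unfolding S_def
    by (rule subgroups_Inter) (use sN subgroup_pi_residual[OF subgroup.subset[OF sN]] in auto)
  have SN: "S \<subseteq> N" by (auto simp: S_def)
  note Sc = subgroup.mem_carrier[OF sS]
  have nS: "S \<lhd> G"
    by (rule normalI'[OF sS])
      (auto simp: S_def intro: normal_closed[OF N(1)] normal_closed[OF normal_pi_residual[OF N(1)]])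
  have S_mem: "x \<in> S" if "x \<in> N" "pi_elt G s x" for x
  proof -
    have "x \<in> pi_residual G r N" if "r \<in> \<sigma>" "r \<noteq> s" for r
      using pi_residual_mem[OF \<open>x \<in> N\<close>] pi_elt_mono[OF \<open>pi_elt G s x\<close>] block_disjoint[OF \<sigma> s(1) that(1)] that(2) by blast
    thus ?thesis using \<open>x \<in> N\<close> by (auto simp: S_def)
  qed
  have S_elt: "pi_elt G s x" if x: "x \<in> S" for x
  proof -
    obtain m where m: "pi_num s m" "x [^] m \<in> ?A" using pow_in_pi_residual[OF fin sN] x SN by blast
    have "x [^] m \<in> S" using subgroup_nat_pow[OF sS x] .
    hence "x [^] m \<in> sigma_residual \<sigma> G N" using m(2) by (auto simp: sigma_residual_def S_def)
    thus ?thesis using DN m(1) unfolding pi_elt_def by blast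
  qed
  hence S_num: "pi_num s (card S)" using pi_num_card_of_pi_elt[OF sS fin] by blast
  obtain P a where P: "subgroup P G" "card P = p ^ a" "\<not> p dvd card (rcosets P)"
    using Sylow_exists[OF fin p] .
  note Pc = subgroup.mem_carrier[OF P(1)]
  have P_num: "pi_num s (card P)" unfolding P(2) using pi_num_prime_power[OF p s(2)] .
  have pA: "\<not> p dvd card ?A" using A_num p s(2) by (auto simp: pi_num_def)
  define C where "C = {y \<in> ?A. \<forall>x\<in>P. x \<otimes> y = y \<otimes> x}"
  have sC: "subgroup C G"
  proof (rule subgroupI)
    show "C \<subseteq> carrier G" "C \<noteq> {}" using Ac Pc subgroup.one_closed[OF sA] by (auto simp: C_def intro!: exI[of _ \<one>])
    fix c assume c: "c \<in> C"
    have "x \<otimes> inv c = inv c \<otimes> x" if "x \<in> P" for x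
    proof -
      have xc: "c \<otimes> x = x \<otimes> c" "c \<in> carrier G" "x \<in> carrier G" using c that Ac Pc by (auto simp: C_def)
      have "x \<otimes> inv c = inv c \<otimes> (c \<otimes> x) \<otimes> inv c" using xc(2,3) by (simp add: group_simps)
      thus ?thesis unfolding xc(1) using xc(2,3) by (simp add: group_simps)
    qed
    thus "inv c \<in> C" using c subgroup.m_inv_closed[OF sA] by (simp add: C_def)
    fix d assume d: "d \<in> C"
    have "x \<otimes> (c \<otimes> d) = c \<otimes> d \<otimes> x" if "x \<in> P" for x
    proof -
      have cd: "x \<otimes> c = c \<otimes> x" "x \<otimes> d = d \<otimes> x" "c \<in> carrier G" "d \<in> carrier G" "x \<in> carrier G"
        using c d that Ac Pc by (auto simp: C_def)
      have "x \<otimes> (c \<otimes> d) = (x \<otimes> c) \<otimes> d" using cd(3-5) by (simp add: m_assoc)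
      also have "\<dots> = c \<otimes> (x \<otimes> d)" unfolding cd(1) using cd(3-5) by (simp add: m_assoc)
      also have "\<dots> = c \<otimes> d \<otimes> x" unfolding cd(2) using cd(3-5) by (simp add: m_assoc)
      finally show ?thesis .
    qed
    thus "c \<otimes> d \<in> C" using c d subgroup.m_closed[OF sA] by (simp add: C_def)
  qed
  have "C = ?A"
  proof (rule card_dvd_of_Sylow[OF fin sA sC])
    show "C \<subseteq> ?A" by (auto simp: C_def)
    fix q assume q: "Factorial_Ring.prime q" "q dvd card ?A"
    obtain Q b m where Q: "subgroup Q G" "Q \<subseteq> ?A" "card Q = q ^ b" "card ?A = q ^ b * m" "\<not> q dvd m"
      "\<And>x y. x \<in> P \<Longrightarrow> y \<in> Q \<Longrightarrow> x \<otimes> y \<otimes> inv x \<in> Q"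
      using p_group_normalizes_Sylow[OF fin nA q(1) P(1,2) p pA] by blast
    have sQP: "subgroup (Q <#> P) G" by (rule subgroup_set_mult_normalized[OF Q(1) P(1) Q(6)])
    \<comment> \<open>Only p and q divide |QP|, while |G| has at least three prime divisors. So QP
      is proper with trivial residual, and the s-group P centralizes the s'-group Q.\<close>
    have "Q <#> P \<noteq> carrier G"
    proof
      assume "Q <#> P = carrier G"
      hence "order G dvd q ^ b * p ^ a" using card_set_mult[OF Q(1) P(1)] Q(3) P(2)
        unfolding order_def by (metis dvd_triv_left)
      have "prime_factors (order G) \<subseteq> {p, q}"
      proof
        fix r assume "r \<in> prime_factors (order G)"
        hence r: "Factorial_Ring.prime r" "r dvd order G" by auto
        hence "r dvd q ^ b * p ^ a" using \<open>order G dvd q ^ b * p ^ a\<close> dvd_trans by blast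
        hence "r dvd q \<or> r dvd p" using r(1) prime_dvd_mult_iff prime_dvd_power by blast
        thus "r \<in> {p, q}" using r(1) p q(1) primes_dvd_imp_eq by blast
      qed
      hence "card (prime_factors (order G)) \<le> card {p, q}" by (intro card_mono) auto
      also have "\<dots> \<le> 2" by (simp add: card_insert_if)
      finally show False using three by simp
    qed
    hence DQP: "sigma_residual \<sigma> G (Q <#> P) = {\<one>}" using proper[OF sQP] by blast
    have "Q \<subseteq> C"
    proof
      fix y assume y: "y \<in> Q"
      have "x \<otimes> y = y \<otimes> x" if x: "x \<in> P" for x
      proof (rule commute_of_trivial_residual[OF \<sigma> s(1) sQP DQP])
        show "x \<in> Q <#> P" "y \<in> Q <#> P" using set_mult_superset[OF Q(1) P(1)] x y by auto
        show "pi_elt G s x" using pi_elt_of_card[OF P(1) fin P_num x] .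
        show "pi_elt G (-s) y" using A_elt y Q(2) by blast
      qed
      thus "y \<in> C" using y Q(2) by (auto simp: C_def)
    qed
    thus "\<exists>Q b m. subgroup Q G \<and> Q \<subseteq> C \<and> card Q = q ^ b \<and> card ?A = q ^ b * m \<and> \<not> q dvd m"
      using Q by blast
  qed
  hence PA: "x \<otimes> y = y \<otimes> x" if "x \<in> P" "y \<in> ?A" for x y using that by (auto simp: C_def)
  have SA: "x \<otimes> y = y \<otimes> x" if "x \<in> S" "y \<in> ?A" for x y
    using commute_of_trivial_residual[OF \<sigma> s(1) sN DN _ S_elt _ A_elt] that SN AN by blast
  define H where "H = S <#> P"
  have sH: "subgroup H G" unfolding H_def using subgroup_set_mult[OF sS P(1) set_mult_normal_commute[OF nS P(1)]] .
  note Hc = subgroup.mem_carrier[OF sH]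
  have SH: "S \<subseteq> H" "P \<subseteq> H" unfolding H_def using set_mult_superset[OF sS P(1)] by auto
  have "card H dvd card S * card P" using card_set_mult[OF sS P(1)] unfolding H_def by (metis dvd_triv_left)
  hence H_num: "pi_num s (card H)" using pi_num_dvd S_num P_num pi_num_mult by blast
  have HA: "h \<otimes> y = y \<otimes> h" if h: "h \<in> H" and y: "y \<in> ?A" for h y
  proof -
    obtain x z where xz: "x \<in> S" "z \<in> P" "h = x \<otimes> z" using h by (auto simp: H_def set_mult_def)
    note c = Sc[OF xz(1)] Pc[OF xz(2)] Ac[OF y]
    have "h \<otimes> y = x \<otimes> (z \<otimes> y)" unfolding xz(3) using c by (simp add: m_assoc)
    also have "\<dots> = (x \<otimes> y) \<otimes> z" unfolding PA[OF xz(2) y] using c by (simp add: m_assoc)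
    also have "\<dots> = y \<otimes> h" unfolding SA[OF xz(1) y] xz(3) using c by (simp add: m_assoc)
    finally show ?thesis .
  qed
  have HiA: "x = \<one>" if "x \<in> H" "x \<in> ?A" for x
    using pi_elt_both[OF Hc[OF that(1)] pi_elt_of_card[OF sH fin H_num that(1)] A_elt[OF that(2)]] .
  define W where "W = ?A <#> H"
  have sW: "subgroup W G" unfolding W_def using subgroup_set_mult[OF sA sH set_mult_normal_commute[OF nA sH]] .
  have AW: "?A \<subseteq> W" "H \<subseteq> W" unfolding W_def using set_mult_superset[OF sA sH] by auto
  have NW: "N \<subseteq> W"
  proof
    fix x assume x: "x \<in> N"
    obtain i j :: nat where ij: "x = x [^] i \<otimes> x [^] j" "pi_elt G s (x [^] i)" "pi_elt G (-s) (x [^] j)"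
      using pi_elt_split[OF fin Nc[OF x]] by blast
    have "x [^] i \<in> W" using S_mem[OF subgroup_nat_pow[OF sN x] ij(2)] SH AW by blast
    moreover have "x [^] j \<in> W" using pi_residual_mem[OF subgroup_nat_pow[OF sN x] ij(3)] AW by blast
    ultimately show "x \<in> W" using ij(1) subgroup.m_closed[OF sW] by metis
  qed
  \<comment> \<open>W contains N and G/N is abelian.\<close>
  have nW: "W \<lhd> G"
  proof (rule normalI'[OF sW])
    fix g x assume g: "g \<in> carrier G" and x: "x \<in> W"
    have xc: "x \<in> carrier G" using subgroup.mem_carrier[OF sW x] .
    have "g \<otimes> x \<otimes> inv g \<otimes> inv x \<otimes> x \<in> W" using comm[OF g xc] NW x subgroup.m_closed[OF sW] by blast
    thus "g \<otimes> x \<otimes> inv g \<in> W" using g xc by (simp add: group_simps)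
  qed
  have pW: "\<not> p dvd card (rcosets W)"
    using index_dvd[OF fin sW P(1) subset_trans[OF SH(2) AW(2)]] P(3) dvd_trans by blast
  \<comment> \<open>G/N has exponent p, while P \<subseteq> W makes |G:W| prime to p.\<close>
  have WG: "W = carrier G"
  proof -
    have "x \<in> W" if x: "x \<in> carrier G" for x
    proof -
      have "x [^] gcd p (card (rcosets W)) \<in> W"
        using pow_gcd_mem[OF sW x] pN[OF x] NW pow_index_mem[OF nW x] by blast
      moreover have "gcd p (card (rcosets W)) = 1"
        using prime_imp_coprime[OF p pW] by simp
      ultimately show ?thesis using x by simp
    qed
    thus ?thesis using subgroup.subset[OF sW] by blast
  qed
  have dec: "\<exists>y h. y \<in> ?A \<and> h \<in> H \<and> x = y \<otimes> h \<and> h \<otimes> y = y \<otimes> h" if "x \<in> carrier G" for x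
    using that HA unfolding WG[symmetric] W_def set_mult_def by blast
  have pow_dec: "h [^] m = \<one> \<and> y [^] m = \<one>" if "y \<in> ?A" "h \<in> H" "(y \<otimes> h) [^] (m::nat) = \<one>" for y h m
  proof -
    have c: "y \<in> carrier G" "h \<in> carrier G" using that Ac Hc by auto
    have eq: "y [^] m \<otimes> h [^] m = \<one>"
      using that(3) pow_mult_distrib[OF _ c, of m] HA[OF that(2,1)] by simp
    hence "h [^] m = inv (y [^] m)" using c by (metis inv_equality inv_inv nat_pow_closed)
    hence "h [^] m \<in> ?A" using subgroup.m_inv_closed[OF sA subgroup_nat_pow[OF sA that(1)]] by simp
    hence "h [^] m = \<one>" using HiA subgroup_nat_pow[OF sH that(2)] by blast
    thus ?thesis using eq c by simp
  qed
  have EsA: "pi_residual G s (carrier G) \<subseteq> ?A"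
  proof (rule pi_residual_least[OF sA])
    fix x assume x: "x \<in> carrier G" "pi_elt G (-s) x"
    obtain y h where yh: "y \<in> ?A" "h \<in> H" "x = y \<otimes> h" using dec[OF x(1)] by blast
    obtain m where m: "pi_num (-s) m" "x [^] m = \<one>" using x(2) unfolding pi_elt_def by blast
    have "h [^] m = \<one>" using pow_dec[OF yh(1,2)] m(2) yh(3) by blast
    hence "pi_elt G (-s) h" using m(1) unfolding pi_elt_def by blast
    hence "h = \<one>" using pi_elt_both[OF Hc[OF yh(2)] pi_elt_of_card[OF sH fin H_num yh(2)]] by blast
    thus "x \<in> ?A" using yh Ac by simp
  qed
  have "sigma_residual \<sigma> G (carrier G) \<subseteq> {\<one>}"
  proof
    fix d assume d: "d \<in> sigma_residual \<sigma> G (carrier G)"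
    have dA: "d \<in> ?A" using d EsA s(1) by (auto simp: sigma_residual_def)
    \<comment> \<open>In G = A x H the A-component of a t'-element is a t'-element of N, so for t
      \<noteq> s the subgroup O^t(G) lies in (O^t(N) \<inter> A) H. As d lies in A, its H-component
      vanishes, which leaves d in O^t(N).\<close>
    have "d \<in> pi_residual G t N" if t: "t \<in> \<sigma>" for t
    proof (cases "t = s")
      case True
      thus ?thesis using dA by simp
    next
      case False
      let ?B = "pi_residual G t N \<inter> ?A"
      have nB: "?B \<lhd> G" using normal_subgroup_intersect[OF normal_pi_residual[OF N(1)] nA] .
      have sB: "subgroup ?B G" using nB normal_imp_subgroup by blast
      have sBH: "subgroup (?B <#> H) G" using subgroup_set_mult[OF sB sH set_mult_normal_commute[OF nB sH]] .
      have "pi_residual G t (carrier G) \<subseteq> ?B <#> H"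
      proof (rule pi_residual_least[OF sBH])
        fix x assume x: "x \<in> carrier G" "pi_elt G (-t) x"
        obtain y h where yh: "y \<in> ?A" "h \<in> H" "x = y \<otimes> h" using dec[OF x(1)] by blast
        obtain m where m: "pi_num (-t) m" "x [^] m = \<one>" using x(2) unfolding pi_elt_def by blast
        have "y [^] m = \<one>" using pow_dec[OF yh(1,2)] m(2) yh(3) by blast
        hence "pi_elt G (-t) y" using m(1) unfolding pi_elt_def by blast
        hence "y \<in> ?B" using pi_residual_mem[of y N t] yh(1) AN by blast
        thus "x \<in> ?B <#> H" using yh(2,3) unfolding set_mult_def by blast
      qed
      hence "d \<in> ?B <#> H" using d t by (auto simp: sigma_residual_def)
      then obtain y h where yh: "y \<in> ?B" "h \<in> H" "d = y \<otimes> h" unfolding set_mult_def by blast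
      have c: "y \<in> carrier G" "h \<in> carrier G" using yh Ac Hc by auto
      have "inv y \<otimes> d \<in> ?A" using dA yh(1) sA by (simp add: subgroup.m_closed subgroup.m_inv_closed)
      hence "h \<in> ?A" using yh(3) c by (simp add: group_simps)
      hence "h = \<one>" using HiA yh(2) by blast
      thus ?thesis using yh c by simp
    qed
    hence "d \<in> sigma_residual \<sigma> G N" using dA AN by (auto simp: sigma_residual_def)
    thus "d \<in> {\<one>}" using DN by simp
  qed
  thus ?thesis using one_in_sigma_residual[OF subgroup_self, of \<sigma>] by blast
qed

lemma solvable_of_subgroup:
  assumes "solvable G" "subgroup H G" shows "solvable (G\<lparr>carrier := H\<rparr>)"
proof -
  interpret H: group "G\<lparr>carrier := H\<rparr>" using assms(2) subgroup_imp_group by blast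
  interpret h: group_hom "G\<lparr>carrier := H\<rparr>" G "\<lambda>x. x"
    by (intro group_hom.intro group_hom_axioms.intro H.group_axioms group_axioms)
      (auto simp: hom_def subgroup.mem_carrier[OF assms(2)])
  show ?thesis using h.inj_hom_imp_solvable assms(1) by simp
qed

lemma card_primes_le:
  assumes fin: "finite (carrier G)" and \<sigma>: "primes_partition \<sigma>" and sol: "solvable G"
    and "subgroup L G" "sigma_residual \<sigma> G L \<noteq> {\<one>}"
    and "\<And>K. n_maximal (G\<lparr>carrier := L\<rparr>) n K \<Longrightarrow> sigma_residual \<sigma> G K = {\<one>}"
  shows "card (prime_factors (card L)) \<le> Suc n"
  using assms(4,5,6)
proof (induction n arbitrary: L)
  case 0
  \<comment> \<open>L is 0-maximal in itself, so two of the hypotheses contradict each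
    other.\<close>
  thus ?case using "0.prems"(3)[of L] by simp
next
  case (Suc n)
  note L = Suc.prems(1)
  let ?L = "G\<lparr>carrier := L\<rparr>"
  interpret L: group ?L using L subgroup_imp_group by blast
  have finL: "finite (carrier ?L)" using finite_subgroup[OF fin L] by simp
  have solL: "solvable ?L" using solvable_of_subgroup[OF sol L] .
  show ?case
  proof (cases "\<exists>M. maximal_subgroup ?L M \<and> sigma_residual \<sigma> G M \<noteq> {\<one>}")
    case True
    then obtain M where M: "maximal_subgroup ?L M" "sigma_residual \<sigma> G M \<noteq> {\<one>}" by blast
    have sM: "subgroup M G" using incl_subgroup[OF L] M(1) by (simp add: maximal_subgroup_def)
    have "card (prime_factors (card M)) \<le> Suc n"
      by (rule Suc.IH[OF sM M(2)]) (use Suc.prems(3) n_maximal_of_maximal[OF M(1) _ L] in blast)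
    moreover obtain p where "prime_factors (card L) \<subseteq> insert p (prime_factors (card M))"
      using L.maximal_subgroup_primes[OF finL solL M(1)] unfolding order_subgroup by blast
    hence "card (prime_factors (card L)) \<le> card (insert p (prime_factors (card M)))"
      by (intro card_mono) auto
    moreover have "card (insert p (prime_factors (card M))) \<le> Suc (card (prime_factors (card M)))"
      by (rule card_insert_le_m1) auto
    ultimately show ?thesis by linarith
  next
    case False
    \<comment> \<open>The descent may stop at any stage; the bound 2 suffices because
      \<open>Suc (Suc n)\<close> is at least 2.\<close>
    have "card (prime_factors (card L)) \<le> 2"
    proof (rule ccontr)
      assume "\<not> card (prime_factors (card L)) \<le> 2"
      hence three: "card (prime_factors (order ?L)) > 2" by (simp add: order_subgroup)
      have "sigma_residual \<sigma> ?L (carrier ?L) = {\<one>\<^bsub>?L\<^esub>}"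
      proof (rule L.two_primes_of_minimal[OF finL \<sigma> solL _ three])
        fix M assume M: "maximal_subgroup ?L M"
        hence "M \<subseteq> L" by (auto simp: maximal_subgroup_def)
        thus "sigma_residual \<sigma> ?L M = {\<one>\<^bsub>?L\<^esub>}" using sigma_residual_consistent[OF L] False M by auto
      qed
      thus False using Suc.prems(2) sigma_residual_consistent[OF L, of L] by simp
    qed
    thus ?thesis by simp
  qed
qed

theorem card_primes_le_m_sigma:
  assumes fin: "finite (carrier G)" and \<sigma>: "primes_partition \<sigma>" and sol: "solvable G"
    and nil: "\<not> sigma_nilpotent \<sigma> G"
  shows "card (prime_factors (order G)) \<le> m_sigma \<sigma> G"
proof -
  obtain k where k: "m_sigma \<sigma> G = Suc k" "\<And>M. n_maximal G (Suc k) M \<Longrightarrow> sigma_subnormal \<sigma> G M"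
    using threshold_least[OF fin, of "sigma_subnormal \<sigma> G"] unfolding m_sigma_def by metis
  have "n_maximal G k L \<Longrightarrow> sigma_residual \<sigma> G L = {\<one>}" for L
    using threshold_residual_trivial[OF fin \<sigma>, of "sigma_subnormal \<sigma> G" k L] k(2) by blast
  moreover have "sigma_residual \<sigma> G (carrier G) \<noteq> {\<one>}"
    using sigma_nilpotent_of_trivial_residual[OF fin \<sigma>] nil by blast
  ultimately have "card (prime_factors (card (carrier G))) \<le> Suc k"
    by (intro card_primes_le[OF fin \<sigma> sol subgroup_self]) simp_all
  thus ?thesis using k(1) by (simp add: order_def)
qed

end

section \<open>The rank\<close>

context group
begin

lemma generate_singleton_pow:
  assumes "finite (carrier G)" "y \<in> carrier G" "u \<in> generate G {y}"
  obtains i :: nat where "u = y [^] i"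
  using generate_pow_on_finite_carrier[OF assms(1,2)] assms(3) by auto

lemma subgroup_generate_singleton: "y \<in> carrier G \<Longrightarrow> subgroup (generate G {y}) G"
  by (rule generate_is_subgroup) simp

lemma mem_generate_singleton: "y \<in> generate G {y}"
  by (simp add: generate.incl)

lemma n_maximal_exists:
  assumes fin: "finite (carrier G)" and S: "subgroup S G" obtains m where "n_maximal G m S"
proof -
  have "\<exists>m. n_maximal G m S"
    using S
  proof (induction "card (carrier G) - card S" arbitrary: S rule: less_induct)
    case less
    show ?case
    proof (cases "S = carrier G")
      case True
      thus ?thesis by (intro exI[of _ 0]) simp
    next
      case False
      let ?X = "{L. subgroup L G \<and> S \<subset> L}"
      have "?X \<subseteq> Pow (carrier G)" using subgroup.subset by auto
      hence "finite ?X" using fin by (meson finite_Pow_iff finite_subset)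
      moreover have "carrier G \<in> ?X" using False subgroup_self subgroup.subset[OF less.prems] by auto
      ultimately obtain L where L: "L \<in> ?X" "\<And>K. K \<in> ?X \<Longrightarrow> K \<subseteq> L \<Longrightarrow> L = K"
        using finite_has_minimal[of ?X] by auto
      have L': "subgroup L G" "S \<subset> L" using L(1) by auto
      have "card S < card L" using psubset_card_mono[OF finite_subgroup[OF fin L'(1)] L'(2)] .
      moreover have "card L \<le> card (carrier G)" using card_mono[OF fin subgroup.subset[OF L'(1)]] .
      ultimately obtain m where m: "n_maximal G m L" using less.hyps[OF _ L'(1)] by fastforce
      have "\<not> (\<exists>K. subgroup K (G\<lparr>carrier := L\<rparr>) \<and> S \<subset> K \<and> K \<subset> L)"
      proof
        assume "\<exists>K. subgroup K (G\<lparr>carrier := L\<rparr>) \<and> S \<subset> K \<and> K \<subset> L"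
        then obtain K where K: "subgroup K (G\<lparr>carrier := L\<rparr>)" "S \<subset> K" "K \<subset> L" by blast
        have "K \<in> ?X" using incl_subgroup[OF L'(1) K(1)] K(2) by simp
        thus False using L(2)[of K] K(3) by auto
      qed
      hence "maximal_subgroup (G\<lparr>carrier := L\<rparr>) S"
        unfolding maximal_subgroup_def using subgroup_incl[OF less.prems L'(1)] L'(2) by auto
      thus ?thesis using m by (intro exI[of _ "Suc m"]) auto
    qed
  qed
  thus ?thesis using that by blast
qed

lemma n_maximal_above:
  "n_maximal G m S \<Longrightarrow> k \<le> m \<Longrightarrow> \<exists>L. n_maximal G k L \<and> S \<subseteq> L"
proof (induction m arbitrary: S)
  case (Suc m)
  show ?case
  proof (cases "k = Suc m")
    case False
    obtain L where L: "n_maximal G m L" "maximal_subgroup (G\<lparr>carrier := L\<rparr>) S" using Suc.prems by auto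
    hence "S \<subseteq> L" by (auto simp: maximal_subgroup_def)
    thus ?thesis using Suc.IH[OF L(1)] False Suc.prems(2) by fastforce
  qed (use Suc.prems in blast)
qed auto

end

section \<open>R/K as a space over the field with p elements\<close>

locale elementary_section = group G for G (structure) +
  fixes R K and p :: nat
  assumes fin: "finite (carrier G)" and R: "R \<lhd> G" and K: "K \<lhd> G" and KR: "K \<subseteq> R"
    and p: "Factorial_Ring.prime p" and R_pow: "\<And>x. x \<in> R \<Longrightarrow> x [^] p \<in> K"
    and R_comm: "\<And>x y. x \<in> R \<Longrightarrow> y \<in> R \<Longrightarrow> x \<otimes> y \<otimes> inv x \<otimes> inv y \<in> K"
begin

text \<open>The subspaces of R/K, represented by their preimages in G so that hypotheses on
  subgroups of G apply to them directly.\<close>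

definition between :: "'a set \<Rightarrow> bool" where
  "between W \<longleftrightarrow> subgroup W G \<and> K \<subseteq> W \<and> W \<subseteq> R"

text \<open>This is C_G(R/K), the kernel of the action of G on R/K.\<close>

definition centralizing :: "'a set" where
  "centralizing = {g \<in> carrier G. \<forall>a\<in>R. g \<otimes> a \<otimes> inv g \<otimes> inv a \<in> K}"

lemma sR: "subgroup R G" and sK: "subgroup K G"
  using R K normal_imp_subgroup by auto

lemma Rc: "x \<in> R \<Longrightarrow> x \<in> carrier G" and Kc: "x \<in> K \<Longrightarrow> x \<in> carrier G"
  using subgroup.mem_carrier[OF sR] subgroup.mem_carrier[OF sK] by auto

lemma betweenD: "between W \<Longrightarrow> subgroup W G" "between W \<Longrightarrow> K \<subseteq> W" "between W \<Longrightarrow> W \<subseteq> R"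
  by (auto simp: between_def)

lemma centralizing_normalizes:
  assumes W: "between W" and g: "g \<in> centralizing" and w: "w \<in> W"
  shows "g \<otimes> w \<otimes> inv g \<in> W"
proof -
  have c: "g \<in> carrier G" "w \<in> carrier G" using g w betweenD[OF W] Rc by (auto simp: centralizing_def)
  have "g \<otimes> w \<otimes> inv g \<otimes> inv w \<in> W" using g w betweenD[OF W] by (auto simp: centralizing_def)
  hence "g \<otimes> w \<otimes> inv g \<otimes> inv w \<otimes> w \<in> W" using w subgroup.m_closed[OF betweenD(1)[OF W]] by blast
  thus ?thesis using c by (simp add: group_simps)
qed

lemma subgroup_centralizing: "subgroup centralizing G"
proof (rule subgroupI)
  show "centralizing \<subseteq> carrier G" "centralizing \<noteq> {}"
    using Rc subgroup.one_closed[OF sK] by (auto simp: centralizing_def intro!: exI[of _ \<one>])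
  fix g assume g: "g \<in> centralizing"
  hence gc: "g \<in> carrier G" by (simp add: centralizing_def)
  have "inv g \<otimes> a \<otimes> inv (inv g) \<otimes> inv a \<in> K" if a: "a \<in> R" for a
  proof -
    let ?b = "inv g \<otimes> a \<otimes> inv (inv g)"
    have b: "?b \<in> R" using normal_closed[OF R inv_closed[OF gc] a] .
    hence "g \<otimes> ?b \<otimes> inv g \<otimes> inv ?b \<in> K" using g unfolding centralizing_def by blast
    hence "inv (g \<otimes> ?b \<otimes> inv g \<otimes> inv ?b) \<in> K" using subgroup.m_inv_closed[OF sK] by blast
    thus ?thesis using gc Rc[OF a] by (simp add: group_simps)
  qed
  thus "inv g \<in> centralizing" using gc by (simp add: centralizing_def)
  fix h assume h: "h \<in> centralizing"
  hence hc: "h \<in> carrier G" by (simp add: centralizing_def)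
  have "g \<otimes> h \<otimes> a \<otimes> inv (g \<otimes> h) \<otimes> inv a \<in> K" if a: "a \<in> R" for a
  proof -
    let ?b = "h \<otimes> a \<otimes> inv h"
    have b: "?b \<in> R" using normal_closed[OF R hc a] .
    hence "g \<otimes> ?b \<otimes> inv g \<otimes> inv ?b \<in> K" using g unfolding centralizing_def by blast
    moreover have "?b \<otimes> inv a \<in> K" using h a unfolding centralizing_def by blast
    ultimately have "(g \<otimes> ?b \<otimes> inv g \<otimes> inv ?b) \<otimes> (?b \<otimes> inv a) \<in> K" using subgroup.m_closed[OF sK] by blast
    thus ?thesis using gc hc Rc[OF a] by (simp add: group_simps)
  qed
  thus "g \<otimes> h \<in> centralizing" using gc hc by (simp add: centralizing_def)
qed

lemma R_centralizing: "R \<subseteq> centralizing"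
  using R_comm Rc by (auto simp: centralizing_def)

lemma p'_elt_in_K:
  assumes "x \<in> R" "pi_elt G (-{p}) x" shows "x \<in> K"
  using pi_elt_mem[OF sK Rc[OF assms(1)] assms(2) R_pow[OF assms(1)]] p by (simp add: pi_num_prime)

text \<open>R acts trivially on R/K, so W is normal in V, and V/W has exponent dividing p; i is the
  dimension of V/W.\<close>

lemma section_index:
  assumes W: "between W" and V: "between V" "W \<subseteq> V"
  obtains i where "card V = card W * p ^ i"
proof -
  have sW: "subgroup W G" and sV: "subgroup V G" using betweenD W V by auto
  let ?V = "G\<lparr>carrier := V\<rparr>"
  interpret V: group ?V using sV subgroup_imp_group by blast
  have "W \<lhd> ?V"
  proof (rule V.normalI')
    show "subgroup W ?V" using subgroup_incl[OF sW sV V(2)] .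
    fix g x assume g: "g \<in> carrier ?V" and x: "x \<in> W"
    hence "g \<in> centralizing" using R_centralizing betweenD(3)[OF V(1)] by auto
    thus "g \<otimes>\<^bsub>?V\<^esub> x \<otimes>\<^bsub>?V\<^esub> inv\<^bsub>?V\<^esub> g \<in> W"
      using centralizing_normalizes[OF W _ x] m_inv_consistent[OF sV] g by simp
  qed
  let ?\<phi> = "\<lambda>x. W #>\<^bsub>?V\<^esub> x"
  interpret h: group_hom ?V "?V Mod W" ?\<phi> using V.group_hom_Mod[OF \<open>W \<lhd> ?V\<close>] .
  have finV: "finite (carrier ?V)" using finite_subgroup[OF fin sV] by simp
  have sW': "subgroup W ?V" using subgroup_incl[OF sW sV V(2)] .
  have "pi_num {p} (card (carrier (?V Mod W)))"
  proof (rule h.H.pi_num_card_of_pi_elt[OF h.H.subgroup_self])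
    show "finite (carrier (?V Mod W))" using finV by (simp add: carrier_FactGroup)
    fix y assume "y \<in> carrier (?V Mod W)"
    then obtain x where x: "x \<in> V" "y = ?\<phi> x" by (auto simp: carrier_FactGroup)
    have "x [^]\<^bsub>?V\<^esub> p \<in> W" using R_pow[of x] x(1) betweenD[OF W] betweenD[OF V(1)] by (auto simp: nat_pow_def)
    hence "y [^]\<^bsub>?V Mod W\<^esub> p = \<one>\<^bsub>?V Mod W\<^esub>"
      using V.hom_pow_Mod[OF \<open>W \<lhd> ?V\<close>, of x p] x V.coset_join2[OF _ sW'] V(2) by auto
    thus "pi_elt (?V Mod W) {p} y" using p unfolding pi_elt_def by (intro exI[of _ p]) (simp add: pi_num_prime)
  qed
  then obtain i where i: "card (carrier (?V Mod W)) = p ^ i" using pi_num_singleton_power p by blast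
  have "card (carrier (?V Mod W)) * card W = card V"
    using V.index_mult_card[OF finV sW'] by (simp add: FactGroup_def)
  thus ?thesis using that[of i] i by (simp add: mult.commute)
qed

text \<open>One vector adjoined raises the dimension by one: modulo W the new elements are the
  powers a^j with j < p, because a^p lies in K.\<close>

lemma extend:
  assumes W: "between W" and a: "a \<in> R" "a \<notin> W"
  obtains W1 where "between W1" "W \<subseteq> W1" "a \<in> W1" "card W1 = card W * p"
proof -
  have sW: "subgroup W G" using betweenD W by auto
  note Wc = subgroup.mem_carrier[OF sW]
  have ac: "a \<in> carrier G" using Rc a by blast
  let ?A = "generate G {a}"
  have sA: "subgroup ?A G" using subgroup_generate_singleton[OF ac] .
  have AR: "?A \<subseteq> R" using generate_subgroup_incl[of "{a}", OF _ sR] a by simp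
  have sW1: "subgroup (W <#> ?A) G"
    by (rule subgroup_set_mult_normalized[OF sW sA]) (use centralizing_normalizes[OF W] R_centralizing AR in blast)
  note sup = set_mult_superset[OF sW sA]
  have aW1: "a \<in> W <#> ?A" using sup(2) mem_generate_singleton by blast
  have "W <#> ?A \<subseteq> R" using betweenD(3)[OF W] AR subgroup.m_closed[OF sR] by (auto simp: set_mult_def)
  hence bW1: "between (W <#> ?A)" using sW1 sup(1) betweenD(2)[OF W] by (auto simp: between_def)
  obtain i where i: "card (W <#> ?A) = card W * p ^ i" using section_index[OF W bW1 sup(1)] .
  have "W \<subset> W <#> ?A" using sup(1) aW1 a(2) by blast
  hence "card W < card (W <#> ?A)" using psubset_card_mono[OF finite_subgroup[OF fin sW1]] by blast
  hence "i \<noteq> 0" using i by (cases i) auto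
  have "W <#> ?A \<subseteq> (\<lambda>(w, j). w \<otimes> a [^] (j::nat)) ` (W \<times> {..<p})"
  proof
    fix x assume "x \<in> W <#> ?A"
    then obtain w u where wu: "w \<in> W" "u \<in> ?A" "x = w \<otimes> u" by (auto simp: set_mult_def)
    obtain j :: nat where j: "u = a [^] j" using generate_singleton_pow[OF fin ac wu(2)] .
    have "u = (a [^] p) [^] (j div p) \<otimes> a [^] (j mod p)" unfolding j using ac by (simp add: nat_pow_pow nat_pow_mult)
    moreover have "a [^] p \<in> W" using R_pow[OF a(1)] betweenD(2)[OF W] by blast
    hence ap: "(a [^] p) [^] (j div p) \<in> W" using subgroup_nat_pow[OF sW] by blast
    ultimately have "x = (w \<otimes> (a [^] p) [^] (j div p)) \<otimes> a [^] (j mod p)" using wu ac Wc by (simp add: m_assoc)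
    moreover have "w \<otimes> (a [^] p) [^] (j div p) \<in> W" using ap wu(1) subgroup.m_closed[OF sW] by blast
    moreover have "j mod p < p" using prime_gt_0_nat[OF p] by simp
    ultimately show "x \<in> (\<lambda>(w, j). w \<otimes> a [^] (j::nat)) ` (W \<times> {..<p})" by auto
  qed
  hence "card (W <#> ?A) \<le> card ((\<lambda>(w, j). w \<otimes> a [^] (j::nat)) ` (W \<times> {..<p}))"
    using finite_subgroup[OF fin sW] by (intro card_mono) auto
  also have "\<dots> \<le> card (W \<times> {..<p})" using finite_subgroup[OF fin sW] by (intro card_image_le) auto
  also have "\<dots> = card W * p" by (simp add: card_cartesian_product)
  finally have "p ^ i \<le> p ^ 1" using i card_subgroup_pos[OF fin sW] by simp
  hence "i \<le> 1" using power_le_imp_le_exp prime_gt_1_nat[OF p] by blast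
  hence "i = 1" using \<open>i \<noteq> 0\<close> by simp
  thus ?thesis using that[OF bW1 sup(1) aW1] i by simp
qed

lemma prime_index_dichotomy:
  assumes "between W" "between W1" "card W1 = card W * p" "subgroup L G" "W \<subseteq> L" "W \<subseteq> W1"
  shows "L \<inter> W1 = W \<or> W1 \<subseteq> L"
proof -
  have sW: "subgroup W G" and sW1: "subgroup W1 G" using betweenD assms by auto
  have sI: "subgroup (L \<inter> W1) G" using subgroups_Inter_pair[OF assms(4) sW1] .
  obtain i where i: "card (L \<inter> W1) = card W * i" using card_subgroup_dvd[OF sI sW] assms(5,6) by (auto elim!: dvdE)
  obtain j where j: "card W1 = card (L \<inter> W1) * j" using card_subgroup_dvd[OF sW1 sI] by (auto elim!: dvdE)
  have "p = i * j" using i j assms(3) card_subgroup_pos[OF fin sW] by simp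
  hence "i = 1 \<or> j = 1" using p prime_product[of i j] by simp
  thus ?thesis
  proof
    assume "i = 1"
    thus ?thesis using subgroup_eqI[OF sI sW _ fin] i assms(5,6) by auto
  next
    assume "j = 1"
    hence "L \<inter> W1 = W1" using subgroup_eqI[OF sW1 sI _ fin] j by auto
    thus ?thesis by blast
  qed
qed

text \<open>A proper intermediate group of index at least \<open>p\<^sup>d\<close> is an intersection of groups of index \<open>p\<^sup>d\<close>.\<close>

lemma normalizes_all:
  assumes d: "d > 0" and z: "\<And>W w. between W \<Longrightarrow> card R = card W * p ^ d \<Longrightarrow> w \<in> W \<Longrightarrow> z \<otimes> w \<otimes> inv z \<in> W"
  shows "between V \<Longrightarrow> card R = card V * p ^ e \<Longrightarrow> d \<le> e \<Longrightarrow> v \<in> V \<Longrightarrow> z \<otimes> v \<otimes> inv z \<in> V"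
proof (induction e arbitrary: V v)
  case 0
  thus ?case using d "0.prems"(3) by linarith
next
  case (Suc e)
  show ?case
  proof (cases "d = Suc e")
    case True
    thus ?thesis using z Suc.prems by blast
  next
    case False
    hence de: "d \<le> e" "e > 0" using Suc.prems d by auto
    have V: "between V" "subgroup V G" using Suc.prems betweenD by auto
    have cV: "card V > 0" using card_subgroup_pos[OF fin V(2)] .
    have p1: "p > 1" using prime_gt_1_nat[OF p] .
    have "p ^ Suc e > 1" using p1 by (rule one_less_power) simp
    hence "card V \<noteq> card R" using Suc.prems(2) cV by auto
    then obtain a where a: "a \<in> R" "a \<notin> V"
      using betweenD(3)[OF V(1)] by (metis subset_antisym subsetI)
    obtain V1 where V1: "between V1" "V \<subseteq> V1" "a \<in> V1" "card V1 = card V * p" using extend[OF V(1) a] .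
    have "p ^ e > 1" using p1 de(2) by (rule one_less_power)
    have cR: "card R = card V1 * p ^ e" using Suc.prems(2) V1(4) by simp
    hence "card V1 \<noteq> card R" using \<open>p ^ e > 1\<close> V1(4) cV p1 by auto
    \<comment> \<open>Since e \<ge> d > 0, V1 is still proper in R. A vector b outside it gives a
      second one-step extension V2 of V, and V1 \<inter> V2 = V.\<close>
    then obtain b where b: "b \<in> R" "b \<notin> V1"
      using betweenD(3)[OF V1(1)] by (metis subset_antisym subsetI)
    obtain V2 where V2: "between V2" "V \<subseteq> V2" "b \<in> V2" "card V2 = card V * p"
      using extend[OF V(1), of b] b V1(2) by blast
    have cR2: "card R = card V2 * p ^ e" using Suc.prems(2) V2(4) by simp
    have "V1 \<inter> V2 = V"
      using prime_index_dichotomy[OF V(1) V2(1,4) betweenD(1)[OF V1(1)] V1(2) V2(2)] b V2(3) by blast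
    moreover have "z \<otimes> v \<otimes> inv z \<in> V1" using Suc.IH[OF V1(1) cR de(1)] Suc.prems(4) V1(2) by blast
    moreover have "z \<otimes> v \<otimes> inv z \<in> V2" using Suc.IH[OF V2(1) cR2 de(1)] Suc.prems(4) V2(2) by blast
    ultimately show ?thesis by blast
  qed
qed

text \<open>An inclusion W \<subset> W1 of index p stays a maximal inclusion after multiplication by
  <y>: y normalizes both groups because it centralizes R/K, and <y> meets R inside K because q
  \<noteq> p. So codimension d in R/K becomes d steps below R<y>.\<close>

lemma n_maximal_product:
  assumes q: "Factorial_Ring.prime (q::nat)" "q \<noteq> p" and y: "y \<in> centralizing" "pi_elt G {q} y"
  shows "between W \<Longrightarrow> card R = card W * p ^ d \<Longrightarrow>
    subgroup (W <#> generate G {y}) G \<and>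
    n_maximal (G\<lparr>carrier := R <#> generate G {y}\<rparr>) d (W <#> generate G {y})"
proof (induction d arbitrary: W)
  let ?Y = "generate G {y}"
  have yc: "y \<in> carrier G" using y(1) by (simp add: centralizing_def)
  have sY: "subgroup ?Y G" using subgroup_generate_singleton[OF yc] .
  note Yc = subgroup.mem_carrier[OF sY]
  have YC: "?Y \<subseteq> centralizing" using generate_subgroup_incl[OF _ subgroup_centralizing, of "{y}"] y(1) by simp
  have sWY: "subgroup (W <#> ?Y) G" if "between W" for W
    by (rule subgroup_set_mult_normalized[OF betweenD(1)[OF that] sY])
      (use centralizing_normalizes[OF that] YC in blast)
  have YR: "u \<in> K" if u: "u \<in> ?Y" "u \<in> R" for u
  proof -
    obtain i :: nat where i: "u = y [^] i" using generate_singleton_pow[OF fin yc u(1)] .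
    have "{q} \<subseteq> -{p}" using q(2) by simp
    hence "pi_elt G (-{p}) u" unfolding i by (rule pi_elt_mono[OF pi_elt_pow[OF yc y(2)]])
    thus ?thesis using p'_elt_in_K[OF u(2)] by blast
  qed
  {
    case 0
    have sW: "subgroup W G" using 0 betweenD by blast
    have "W = R" using subgroup_eqI[OF sR sW betweenD(3)[OF 0(1)] fin] 0(2) by simp
    thus ?case using sWY[OF 0(1)] by simp
  next
    case (Suc d)
    have W: "between W" "subgroup W G" using Suc.prems betweenD by auto
    note Wc = subgroup.mem_carrier[OF W(2)]
    have "p ^ Suc d > 1" using prime_gt_1_nat[OF p] by (rule one_less_power) simp
    hence "card W \<noteq> card R" using Suc.prems(2) card_subgroup_pos[OF fin W(2)] by auto
    then obtain a where a: "a \<in> R" "a \<notin> W"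
      using betweenD(3)[OF W(1)] by (metis subset_antisym subsetI)
    obtain W1 where W1: "between W1" "W \<subseteq> W1" "a \<in> W1" "card W1 = card W * p" using extend[OF W(1) a] .
    have sW1: "subgroup W1 G" using betweenD W1 by auto
    note W1c = subgroup.mem_carrier[OF sW1]
    have IH: "n_maximal (G\<lparr>carrier := R <#> ?Y\<rparr>) d (W1 <#> ?Y)"
      using Suc.IH[OF W1(1)] Suc.prems(2) W1(4) by simp
    have sub: "W <#> ?Y \<subseteq> W1 <#> ?Y" using W1(2) by (auto simp: set_mult_def)
    have "a \<in> W1 <#> ?Y" using set_mult_superset(1)[OF sW1 sY] W1(3) by blast
    moreover have "a \<notin> W <#> ?Y"
    proof
      assume "a \<in> W <#> ?Y"
      then obtain w u where wu: "w \<in> W" "u \<in> ?Y" "a = w \<otimes> u" by (auto simp: set_mult_def)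
      have "inv w \<otimes> a \<in> R" using wu(1) a(1) betweenD(3)[OF W(1)] sR by (meson subgroup.m_closed subgroup.m_inv_closed subsetD)
      hence "u \<in> R" using wu Wc Yc by (simp add: group_simps)
      hence "u \<in> W" using YR wu(2) betweenD(2)[OF W(1)] by blast
      thus False using a(2) wu W(2) subgroup.m_closed by metis
    qed
    moreover have none: "L = W1 <#> ?Y \<or> L = W <#> ?Y" if L: "subgroup L G" "W <#> ?Y \<subseteq> L" "L \<subseteq> W1 <#> ?Y" for L
    proof -
      have WL: "W \<subseteq> L" "?Y \<subseteq> L" using L(2) set_mult_superset[OF W(2) sY] by auto
      from prime_index_dichotomy[OF W(1) W1(1,4) L(1) WL(1) W1(2)] show ?thesis
      proof
        assume LW: "L \<inter> W1 = W"
        have "L \<subseteq> W <#> ?Y"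
        proof
          fix l assume l: "l \<in> L"
          then obtain w u where wu: "w \<in> W1" "u \<in> ?Y" "l = w \<otimes> u" using L(3) by (auto simp: set_mult_def)
          have "l \<otimes> inv u \<in> L" using l wu(2) WL(2) L(1) by (meson subgroup.m_closed subgroup.m_inv_closed subsetD)
          hence "w \<in> L" using wu W1c Yc by (simp add: group_simps)
          hence "w \<in> W" using LW wu(1) by blast
          thus "l \<in> W <#> ?Y" using wu unfolding set_mult_def by blast
        qed
        thus ?thesis using L(2) by blast
      next
        assume "W1 \<subseteq> L"
        hence "W1 <#> ?Y \<subseteq> L" using WL(2) subgroup.m_closed[OF L(1)] by (auto simp: set_mult_def)
        thus ?thesis using L(3) by blast
      qed
    qed
    ultimately have "W <#> ?Y \<subset> W1 <#> ?Y" using sub by blast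
    moreover have "\<not> (\<exists>L. subgroup L (G\<lparr>carrier := W1 <#> ?Y\<rparr>) \<and> W <#> ?Y \<subset> L \<and> L \<subset> W1 <#> ?Y)"
    proof
      assume "\<exists>L. subgroup L (G\<lparr>carrier := W1 <#> ?Y\<rparr>) \<and> W <#> ?Y \<subset> L \<and> L \<subset> W1 <#> ?Y"
      then obtain L where L: "subgroup L (G\<lparr>carrier := W1 <#> ?Y\<rparr>)" "W <#> ?Y \<subset> L" "L \<subset> W1 <#> ?Y" by blast
      show False using none[OF incl_subgroup[OF sWY[OF W1(1)] L(1)]] L(2,3) by auto
    qed
    ultimately have "maximal_subgroup (G\<lparr>carrier := W1 <#> ?Y\<rparr>) (W <#> ?Y)"
      unfolding maximal_subgroup_def using subgroup_incl[OF sWY[OF W(1)] sWY[OF W1(1)] sub] by simp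
    thus ?case using IH sWY[OF W(1)] by auto
  }
qed

text \<open>W<y> permutes with a conjugate of a Hall t-subgroup containing z, where t is the block
  of q'. The product B has the same p-part of its order as W at most, since neither <y> nor the Hall
  subgroup contributes p. But |R \<inter> B : W| is a power of p, so R \<inter> B = W, and z in B
  normalizes this intersection.\<close>

lemma permutable_product_normalized:
  assumes W: "between W" and y: "y \<in> centralizing" "pi_elt G {q} y"
    and q: "Factorial_Ring.prime (q::nat)" "q \<noteq> p" and \<sigma>: "primes_partition \<sigma>" and s: "s \<in> \<sigma>" "p \<in> s"
    and qn: "sigma_quasinormal \<sigma> G (W <#> generate G {y})" and sWY: "subgroup (W <#> generate G {y}) G"
    and z: "z \<in> carrier G" "pi_elt G {q'} z" "Factorial_Ring.prime q'" "q' \<notin> s" and w: "w \<in> W"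
  shows "z \<otimes> w \<otimes> inv z \<in> W"
proof (cases "z = \<one>")
  case True
  thus ?thesis using w subgroup.mem_carrier[OF betweenD(1)[OF W]] by simp
next
  case False
  let ?Y = "generate G {y}" and ?WY = "W <#> generate G {y}"
  have sW: "subgroup W G" using betweenD W by blast
  have yc: "y \<in> carrier G" using y(1) by (simp add: centralizing_def)
  have sY: "subgroup ?Y G" using subgroup_generate_singleton[OF yc] .
  have Y_elt: "pi_elt G {q} u" if u: "u \<in> ?Y" for u
  proof -
    obtain i :: nat where i: "u = y [^] i" using generate_singleton_pow[OF fin yc u] .
    show ?thesis unfolding i by (rule pi_elt_pow[OF yc y(2)])
  qed
  obtain t where t: "t \<in> \<sigma>" "q' \<in> t" using block_exists[OF \<sigma> z(3)] .
  have "t \<noteq> s" using t z(4) by blast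
  hence pt: "t \<subseteq> -{p}" using block_disjoint[OF \<sigma> t(1) s(1)] s(2) by blast
  obtain \<H> where H: "complete_Hall_set \<sigma> G \<H>"
    "\<And>A x. A \<in> \<H> \<Longrightarrow> x \<in> carrier G \<Longrightarrow> ?WY <#> conjugate G A x = conjugate G A x <#> ?WY"
    using qn unfolding sigma_quasinormal_def by blast
  obtain A g where A: "A \<in> \<H>" "Hall_subgroup t G A" "g \<in> carrier G" "z \<in> conjugate G A g"
    using complete_Hall_conj[OF fin H(1) t(1) z(3) t(2) z(1,2) False] .
  have sA: "subgroup A G" using A(2) by (simp add: Hall_subgroup_def)
  let ?B' = "conjugate G A g"
  note B' = conjugate_subgroup[OF sA A(3)]
  let ?B = "?WY <#> ?B'"
  have sB: "subgroup ?B G" using subgroup_set_mult[OF sWY B'(1) H(2)[OF A(1,3)]] .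
  have WB: "W \<subseteq> ?B" "z \<in> ?B"
    using set_mult_superset[OF sWY B'(1)] set_mult_superset[OF sW sY] A(4) by blast+
  have sI: "subgroup (R \<inter> ?B) G" using subgroups_Inter_pair[OF sR sB] .
  have WI: "W \<subseteq> R \<inter> ?B" using WB betweenD(3)[OF W] by blast
  have bI: "between (R \<inter> ?B)" using sI WI betweenD(2)[OF W] by (auto simp: between_def)
  obtain i where i: "card (R \<inter> ?B) = card W * p ^ i" using section_index[OF W bI WI] .
  have "pi_num {q} (card ?Y)" using pi_num_card_of_pi_elt[OF sY fin Y_elt] .
  moreover have "{q} \<subseteq> -{p}" using q(2) by simp
  ultimately have nY: "pi_num (-{p}) (card ?Y)" by (rule pi_num_mono)
  have nB': "pi_num (-{p}) (card ?B')" unfolding B'(2) using pi_num_mono[OF Hall_num(1)[OF fin A(2)] pt] .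
  have "card ?B dvd card ?WY * card ?B'" using card_set_mult[OF sWY B'(1)] by (metis dvd_triv_left)
  moreover have "card ?WY dvd card W * card ?Y" using card_set_mult[OF sW sY] by (metis dvd_triv_left)
  ultimately have "card ?B dvd card W * card ?Y * card ?B'" by (meson dvd_trans mult_dvd_mono dvd_refl)
  moreover have "card (R \<inter> ?B) dvd card ?B" using card_subgroup_dvd[OF sB sI] by simp
  ultimately have "card (R \<inter> ?B) dvd card W * card ?Y * card ?B'" by (rule dvd_trans[rotated])
  hence "card W * p ^ i dvd card W * (card ?Y * card ?B')"
    unfolding i by (simp only: mult.assoc)
  hence "p ^ i dvd card ?Y * card ?B'" using card_subgroup_pos[OF fin sW] by simp
  hence "pi_num (-{p}) (p ^ i)" using pi_num_dvd nY nB' pi_num_mult by blast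
  moreover have "pi_num {p} (p ^ i)" using p by (simp add: pi_num_prime_power)
  ultimately have "p ^ i = 1" using pi_num_both by blast
  hence WI': "W = R \<inter> ?B" using subgroup_eqI[OF sI sW WI fin] i by simp
  have "z \<otimes> w \<otimes> inv z \<in> R" using normal_closed[OF R z(1)] w betweenD(3)[OF W] by blast
  moreover have "z \<otimes> w \<otimes> inv z \<in> ?B"
    using WB w sB by (meson subgroup.m_closed subgroup.m_inv_closed subsetD)
  ultimately show ?thesis using WI' by blast
qed

text \<open>The p'-part of an element of R lies in K, so a nontrivial action on R/K is already seen
  on p-elements, to which \<open>commute_of_trivial_residual\<close> can be applied.\<close>

lemma p_elt_exists:
  assumes "g \<in> carrier G" "g \<notin> centralizing"
  obtains a where "a \<in> R" "pi_elt G {p} a" "g \<otimes> a \<otimes> inv g \<otimes> inv a \<notin> K"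
proof -
  obtain b where b: "b \<in> R" "g \<otimes> b \<otimes> inv g \<otimes> inv b \<notin> K" using assms by (auto simp: centralizing_def)
  have bc: "b \<in> carrier G" using Rc b by blast
  obtain i j :: nat where ij: "b = b [^] i \<otimes> b [^] j" "pi_elt G {p} (b [^] i)" "pi_elt G (-{p}) (b [^] j)"
    using pi_elt_split[OF fin bc] by blast
  let ?a = "b [^] i" and ?k = "b [^] j"
  have aR: "?a \<in> R" and kK: "?k \<in> K" using subgroup_nat_pow[OF sR b(1)] p'_elt_in_K ij(3) by auto
  have c: "?a \<in> carrier G" "?k \<in> carrier G" using bc by auto
  have "g \<otimes> ?a \<otimes> inv g \<otimes> inv ?a \<notin> K"
  proof
    assume aK: "g \<otimes> ?a \<otimes> inv g \<otimes> inv ?a \<in> K"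
    have "g \<otimes> ?k \<otimes> inv g \<in> K" using normal_closed[OF K assms(1) kK] .
    hence "g \<otimes> ?k \<otimes> inv g \<otimes> inv ?k \<in> K" using kK sK by (meson subgroup.m_closed subgroup.m_inv_closed)
    hence "?a \<otimes> (g \<otimes> ?k \<otimes> inv g \<otimes> inv ?k) \<otimes> inv ?a \<in> K" using normal_closed[OF K c(1)] by blast
    hence "(g \<otimes> ?a \<otimes> inv g \<otimes> inv ?a) \<otimes> (?a \<otimes> (g \<otimes> ?k \<otimes> inv g \<otimes> inv ?k) \<otimes> inv ?a) \<in> K"
      using aK subgroup.m_closed[OF sK] by blast
    moreover have "(g \<otimes> ?a \<otimes> inv g \<otimes> inv ?a) \<otimes> (?a \<otimes> (g \<otimes> ?k \<otimes> inv g \<otimes> inv ?k) \<otimes> inv ?a)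
      = g \<otimes> (?a \<otimes> ?k) \<otimes> inv g \<otimes> inv (?a \<otimes> ?k)"
      using c assms(1) by (simp add: group_simps)
    ultimately show False using b(2) ij(1) by simp
  qed
  thus ?thesis using that[OF aR ij(2)] by blast
qed

text \<open>If some \<open>q\<close>-element with \<open>q\<close> outside the block of \<open>p\<close> acts nontrivially on \<open>R/K\<close>, replace it by a power
  \<open>x\<close> such that \<open>x\<^sup>q\<close> acts trivially; then \<open>R\<langle>x\<rangle>\<close> has nontrivial residual, so it lies high in the subgroup
  lattice, and its maximal subgroup \<open>R\<langle>x\<^sup>q\<rangle>\<close> starts chains through the groups \<open>W\<langle>x\<^sup>q\<rangle>\<close>.\<close>

lemma intermediate_normalized:
  assumes \<sigma>: "primes_partition \<sigma>" and s: "s \<in> \<sigma>" "p \<in> s"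
    and qn: "\<And>M. n_maximal G (Suc k) M \<Longrightarrow> sigma_quasinormal \<sigma> G M"
    and nil: "\<And>L. n_maximal G k L \<Longrightarrow> sigma_residual \<sigma> G L = {\<one>}"
    and V: "between V" "card R = card V * p ^ e" "k \<le> e"
    and z: "z \<in> carrier G" "pi_elt G {q'} z" "Factorial_Ring.prime q'" "q' \<notin> s" and v: "v \<in> V"
  shows "z \<otimes> v \<otimes> inv z \<in> V"
proof (cases "\<forall>q x. Factorial_Ring.prime q \<and> q \<notin> s \<and> x \<in> carrier G \<and> pi_elt G {q} x \<longrightarrow> x \<in> centralizing")
  case True
  thus ?thesis using centralizing_normalizes[OF V(1) _ v] z by blast
next
  case False
  then obtain q x0 where q: "Factorial_Ring.prime q" "q \<notin> s" and x0: "x0 \<in> carrier G" "pi_elt G {q} x0" "x0 \<notin> centralizing"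
    by blast
  obtain m where m: "pi_num {q} m" "x0 [^] m = \<one>" using x0(2) unfolding pi_elt_def by blast
  obtain j where j: "m = q ^ j" using pi_num_singleton_power[OF m(1) q(1)] .
  let ?Q = "\<lambda>i. x0 [^] (q ^ i) \<in> centralizing"
  define i0 where "i0 = (LEAST i. ?Q i)"
  have "?Q j" using m j subgroup.one_closed[OF subgroup_centralizing] by simp
  hence i0: "?Q i0" unfolding i0_def by (rule LeastI)
  have "i0 \<noteq> 0"
  proof
    assume "i0 = 0"
    thus False using i0 x0 by simp
  qed
  then obtain i1 where i1: "i0 = Suc i1" by (cases i0) auto
  define x where "x = x0 [^] (q ^ i1)"
  define y where "y = x [^] q"
  have xc: "x \<in> carrier G" using x0 by (simp add: x_def)
  have x: "pi_elt G {q} x" "x \<notin> centralizing"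
    using pi_elt_pow[OF x0(1,2)] not_less_Least[of i1 ?Q] i1 unfolding x_def i0_def by auto
  have y: "y \<in> centralizing" "pi_elt G {q} y"
    using i0 i1 x0(1) pi_elt_pow[OF xc x(1)] by (auto simp: y_def x_def nat_pow_pow mult.commute)
  have yc: "y \<in> carrier G" using xc by (simp add: y_def)
  have qp: "q \<noteq> p" using q(2) s(2) by blast
  let ?X = "generate G {x}" and ?Y = "generate G {y}"
  have sX: "subgroup ?X G" and sY: "subgroup ?Y G" using subgroup_generate_singleton xc yc by auto
  note Xc = subgroup.mem_carrier[OF sX] and Yc = subgroup.mem_carrier[OF sY]
  let ?S = "R <#> ?X" and ?T = "R <#> ?Y"
  have sS: "subgroup ?S G" and sT: "subgroup ?T G"
    using subgroup_set_mult_normalized[OF sR] sX sY normal_closed[OF R] Xc Yc by auto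
  have RS: "R \<subseteq> ?S" "?X \<subseteq> ?S" "R \<subseteq> ?T" "?Y \<subseteq> ?T"
    using set_mult_superset[OF sR sX] set_mult_superset[OF sR sY] by auto
  have xS: "x \<in> ?S" using RS(2) mem_generate_singleton by blast
  have "y \<in> ?X" unfolding y_def using subgroup_nat_pow[OF sX mem_generate_singleton] .
  hence YX: "?Y \<subseteq> ?X" using generate_subgroup_incl[OF _ sX, of "{y}"] by simp
  hence TS: "?T \<subseteq> ?S" by (auto simp: set_mult_def)
  \<comment> \<open>Otherwise x would commute with every p-element of R, because q lies outside the
    block of p, and x would act trivially on R/K.\<close>
  have "sigma_residual \<sigma> G ?S \<noteq> {\<one>}"
  proof
    assume triv: "sigma_residual \<sigma> G ?S = {\<one>}"
    obtain a where a: "a \<in> R" "pi_elt G {p} a" "x \<otimes> a \<otimes> inv x \<otimes> inv a \<notin> K" using p_elt_exists[OF xc x(2)] .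
    have "pi_elt G s a" using pi_elt_mono[OF a(2)] s(2) by simp
    moreover have "pi_elt G (-s) x" using pi_elt_mono[OF x(1)] q(2) by simp
    ultimately have "a \<otimes> x = x \<otimes> a" using commute_of_trivial_residual[OF \<sigma> s(1) sS triv] a(1) RS(1) xS by blast
    hence "x \<otimes> a \<otimes> inv x \<otimes> inv a = a \<otimes> x \<otimes> inv x \<otimes> inv a" by simp
    also have "\<dots> = \<one>" using xc Rc[OF a(1)] by (simp add: group_simps)
    finally show False using a(3) subgroup.one_closed[OF sK] by simp
  qed
  moreover obtain l where l: "n_maximal G l ?S" using n_maximal_exists[OF fin sS] .
  \<comment> \<open>For l \<ge> k some k-maximal subgroup would contain \<open>?S\<close>, and
    monotonicity would make the residual of \<open>?S\<close> trivial.\<close>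
  ultimately have lk: "l < k"
  proof (rule_tac ccontr)
    assume ne: "sigma_residual \<sigma> G ?S \<noteq> {\<one>}" and "\<not> l < k"
    then obtain L where L: "n_maximal G k L" "?S \<subseteq> L" using n_maximal_above[OF l, of k] by auto
    show False using sigma_residual_mono[OF L(2), of \<sigma>] nil[OF L(1)] one_in_sigma_residual[OF sS, of \<sigma>] ne by blast
  qed
  have "x \<notin> ?T"
  proof -
    have "?Y \<subseteq> centralizing" using generate_subgroup_incl[OF _ subgroup_centralizing, of "{y}"] y(1) by simp
    hence "?T \<subseteq> centralizing" using R_centralizing subgroup.m_closed[OF subgroup_centralizing] by (auto simp: set_mult_def)
    thus ?thesis using x(2) by blast
  qed
  hence "?T \<subset> ?S" using TS xS by blast
  moreover have "\<not> (\<exists>L. subgroup L (G\<lparr>carrier := ?S\<rparr>) \<and> ?T \<subset> L \<and> L \<subset> ?S)"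
  proof
    assume "\<exists>L. subgroup L (G\<lparr>carrier := ?S\<rparr>) \<and> ?T \<subset> L \<and> L \<subset> ?S"
    then obtain L where L: "subgroup L (G\<lparr>carrier := ?S\<rparr>)" "?T \<subset> L" "L \<subset> ?S" by blast
    have sL: "subgroup L G" using incl_subgroup[OF sS L(1)] .
    \<comment> \<open>Removing the R-component of g leaves a power x^i in L with i not divisible by
      q. Together with x^q in \<open>?T\<close> this gives x itself, so L is all of
      \<open>?S\<close>.\<close>
    obtain g where g: "g \<in> L" "g \<notin> ?T" using L(2) by blast
    have "g \<in> ?S" using g(1) L(3) by blast
    then obtain a u where au: "a \<in> R" "u \<in> ?X" "g = a \<otimes> u" unfolding set_mult_def by blast
    have "inv a \<in> L" using au(1) RS(3) L(2) subgroup.m_inv_closed[OF sL] by blast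
    hence "inv a \<otimes> g \<in> L" using g(1) subgroup.m_closed[OF sL] by blast
    hence uL: "u \<in> L" using au Rc Xc by (simp add: group_simps)
    obtain i :: nat where i: "u = x [^] i" using generate_singleton_pow[OF fin xc au(2)] .
    have "\<not> q dvd i"
    proof
      assume "q dvd i"
      then obtain i' where "i = q * i'" by auto
      hence "u = y [^] i'" unfolding i y_def using xc by (simp add: nat_pow_pow)
      hence "u \<in> ?Y" using subgroup_nat_pow[OF sY mem_generate_singleton] by simp
      thus False using g(2) au unfolding set_mult_def by blast
    qed
    hence "gcd i q = 1" using prime_imp_coprime[OF q(1)] by (simp add: coprime_commute)
    moreover have "x [^] q \<in> L" using mem_generate_singleton[of y] RS(4) L(2) unfolding y_def by blast
    hence "x [^] gcd i q \<in> L" using pow_gcd_mem[OF sL xc, of i q] uL i by simp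
    ultimately have "x \<in> L" using xc by simp
    hence "?X \<subseteq> L" using generate_subgroup_incl[OF _ sL, of "{x}"] by simp
    moreover have "R \<subseteq> L" using RS(3) L(2) by blast
    ultimately have "?S \<subseteq> L" using subgroup.m_closed[OF sL] unfolding set_mult_def by blast
    thus False using L(3) by blast
  qed
  ultimately have "maximal_subgroup (G\<lparr>carrier := ?S\<rparr>) ?T"
    unfolding maximal_subgroup_def using subgroup_incl[OF sT sS TS] by simp
  hence T: "n_maximal G (Suc l) ?T" using l by auto
  \<comment> \<open>\<open>?T\<close> is Suc l steps below G, and W<y> is as many steps below
    \<open>?T\<close> as W has codimension in R/K. Codimension k - l therefore makes W<y> a (Suc
    k)-maximal subgroup.\<close>
  define d where "d = k - l"
  have d: "0 < d" "d \<le> e" "Suc l + d = Suc k" using lk V(3) by (auto simp: d_def)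
  have "z \<otimes> w \<otimes> inv z \<in> W" if W: "between W" "card R = card W * p ^ d" "w \<in> W" for W w
  proof -
    note n = n_maximal_product[OF q(1) qp y W(1,2)]
    have "n_maximal G (Suc k) (W <#> ?Y)" using n_maximal_trans[OF T, of d] n d(3) by metis
    thus ?thesis
      using permutable_product_normalized[OF W(1) y q(1) qp \<sigma> s qn _ z W(3)] n by blast
  qed
  thus ?thesis using normalizes_all[OF d(1) _ V(1,2) d(2) v] by blast
qed

end

section \<open>The bound for one chief factor and the rank of G\<close>

context group
begin

text \<open>The subspace V/K has dimension j \<le> r, so for c \<ge> k + r its codimension e is at
  least k and \<open>intermediate_normalized\<close> applies. The contradiction is that V is normal
  in G with j > 0 and e > 0.\<close>

lemma chief_rank_le:
  assumes fin: "finite (carrier G)" and \<sigma>: "primes_partition \<sigma>" and sol: "solvable G"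
    and Hall: "complete_Hall_set \<sigma> G \<H>" and r: "\<And>H. H \<in> \<H> \<Longrightarrow> rank (G\<lparr>carrier := H\<rparr>) \<le> r"
    and qn: "\<And>M. n_maximal G (Suc k) M \<Longrightarrow> sigma_quasinormal \<sigma> G M"
    and nil: "\<And>L. n_maximal G k L \<Longrightarrow> sigma_residual \<sigma> G L = {\<one>}" and k: "k > 0"
    and RK: "chief_factor G R K" and p: "Factorial_Ring.prime p" "order (G\<lparr>carrier := R\<rparr> Mod K) = p ^ c"
  shows "c < k + r"
proof (rule ccontr)
  assume "\<not> c < k + r"
  hence ck: "k + r \<le> c" by simp
  have R: "R \<lhd> G" and K: "K \<lhd> G" "K \<subset> R" and min: "\<And>L. L \<lhd> G \<Longrightarrow> K \<subset> L \<Longrightarrow> \<not> L \<subset> R"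
    using RK by (auto simp: chief_factor_def)
  have sR: "subgroup R G" and sK: "subgroup K G" using R K normal_imp_subgroup by auto
  note Rc = subgroup.mem_carrier[OF sR] and Kc = subgroup.mem_carrier[OF sK]
  have sub_index: "order (G\<lparr>carrier := B\<rparr> Mod A) * card A = card B" if "subgroup A G" "subgroup B G" "A \<subseteq> B" for A B
  proof -
    interpret B: group "G\<lparr>carrier := B\<rparr>" using that subgroup_imp_group by blast
    show ?thesis using B.index_mult_card[of A] subgroup_incl[OF that] finite_subgroup[OF fin that(2)]
      by (simp add: order_def FactGroup_def)
  qed
  have cR: "card R = card K * p ^ c" using sub_index[OF sK sR] K(2) p(2) by (simp add: mult.commute)
  obtain p' where p': "Factorial_Ring.prime p'" "\<And>x. x \<in> R \<Longrightarrow> x [^] p' \<in> K"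
    "\<And>x y. x \<in> R \<Longrightarrow> y \<in> R \<Longrightarrow> x \<otimes> y \<otimes> inv x \<otimes> inv y \<in> K"
    "pi_num {p'} (card R div card K)"
    using chief_factor_elementary[OF fin sol RK] by metis
  have cdiv: "card R div card K = p ^ c" using cR card_subgroup_pos[OF fin sK] by simp
  have "c \<noteq> 0" using ck k by simp
  hence "p dvd card R div card K" using cdiv by simp
  hence pp: "p' = p" using p'(4) p(1) by (auto simp: pi_num_def)
  interpret sec: elementary_section G R K p
    by (intro elementary_section.intro elementary_section_axioms.intro group_axioms fin R K(1)
      psubset_imp_subset[OF K(2)] p(1) p'(2,3)[unfolded pp])
  obtain s where s: "s \<in> \<sigma>" "p \<in> s" using block_exists[OF \<sigma> p(1)] .
  obtain x0 where x0: "x0 \<in> R" "x0 \<notin> K" using K(2) by blast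
  obtain i j :: nat where ij: "x0 = x0 [^] i \<otimes> x0 [^] j" "pi_elt G {p} (x0 [^] i)" "pi_elt G (-{p}) (x0 [^] j)"
    using pi_elt_split[OF fin Rc[OF x0(1)]] by blast
  \<comment> \<open>The p-part of an element of R outside K is also outside K, and a conjugate of it
    lies in H. This makes K \<inter> H a proper subgroup of R \<inter> H, so that there is a chief
    factor of H between them.\<close>
  define x where "x = x0 [^] i"
  have xR: "x \<in> R" unfolding x_def using subgroup_nat_pow[OF sR x0(1)] .
  have "x0 [^] j \<in> K" using sec.p'_elt_in_K[OF subgroup_nat_pow[OF sR x0(1)] ij(3)] .
  hence xK: "x \<notin> K" using ij(1) x0(2) subgroup.m_closed[OF sK] unfolding x_def by metis
  have "x \<noteq> \<one>" using xK subgroup.one_closed[OF sK] by blast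
  then obtain H g where H: "H \<in> \<H>" "Hall_subgroup s G H" "g \<in> carrier G" "x \<in> conjugate G H g"
    using complete_Hall_conj[OF fin Hall s(1) p(1) s(2) Rc[OF xR]] ij(2) unfolding x_def by metis
  have sH: "subgroup H G" using H(2) by (simp add: Hall_subgroup_def)
  note Hc = subgroup.mem_carrier[OF sH]
  define x' where "x' = g \<otimes> x \<otimes> inv g"
  have x'H: "x' \<in> H" using mem_conjugate_iff[OF subgroup.subset[OF sH] H(3) Rc[OF xR]] H(4) by (simp add: x'_def)
  have x'R: "x' \<in> R" unfolding x'_def using normal_closed[OF R H(3) xR] .
  have x'K: "x' \<notin> K"
  proof
    assume "x' \<in> K"
    hence "inv g \<otimes> x' \<otimes> inv (inv g) \<in> K" using normal_closed[OF K(1) inv_closed[OF H(3)]] by blast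
    thus False using xK H(3) Rc[OF xR] by (simp add: x'_def group_simps)
  qed
  let ?H = "G\<lparr>carrier := H\<rparr>"
  interpret H: group ?H using sH subgroup_imp_group by blast
  have nHR: "R \<inter> H \<lhd> ?H" and nHK: "K \<inter> H \<lhd> ?H" using normal_Int_subgroup[OF sH] R K by auto
  \<comment> \<open>A minimal member V0 gives a chief factor V0/(K \<inter> H) of H. Since K
    \<inter> V0 = K \<inter> H, the product V = K V0 satisfies |V/K| = |V0/(K \<inter> H)|, which
    the rank of H bounds.\<close>
  define VS where "VS = {V. V \<lhd> ?H \<and> K \<inter> H \<subset> V \<and> V \<subseteq> R \<inter> H}"
  have "R \<inter> H \<in> VS" using nHR x'H x'R x'K K(2) by (auto simp: VS_def)
  hence ne: "VS \<noteq> {}" by blast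
  have "VS \<subseteq> Pow R" by (auto simp: VS_def)
  hence finVS: "finite VS" using finite_subgroup[OF fin sR] by (meson finite_Pow_iff finite_subset)
  obtain V0 where V0: "V0 \<in> VS" "\<And>L. L \<in> VS \<Longrightarrow> L \<subseteq> V0 \<Longrightarrow> V0 = L"
    using finite_has_minimal[OF finVS ne] by metis
  have nV0: "V0 \<lhd> ?H" "K \<inter> H \<subset> V0" "V0 \<subseteq> R" "V0 \<subseteq> H" using V0(1) by (auto simp: VS_def)
  have chief: "chief_factor ?H V0 (K \<inter> H)" unfolding chief_factor_def
  proof (intro conjI nV0 nHK notI)
    assume "\<exists>L. L \<lhd> ?H \<and> K \<inter> H \<subset> L \<and> L \<subset> V0"
    then obtain L where L: "L \<lhd> ?H" "K \<inter> H \<subset> L" "L \<subset> V0" by blast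
    hence "L \<in> VS" using nV0 by (auto simp: VS_def)
    thus False using V0(2)[of L] L(3) by blast
  qed
  have sV0: "subgroup V0 G" using incl_subgroup[OF sH normal_imp_subgroup[OF nV0(1)]] .
  define V where "V = K <#> V0"
  have sV: "subgroup V G" unfolding V_def using subgroup_set_mult[OF sK sV0 set_mult_normal_commute[OF K(1) sV0]] .
  have VV: "K \<subseteq> V" "V0 \<subseteq> V" unfolding V_def using set_mult_superset[OF sK sV0] by auto
  have VR: "V \<subseteq> R" unfolding V_def using K(2) nV0(3) subgroup.m_closed[OF sR] by (auto simp: set_mult_def)
  have bV: "sec.between V" using sV VV(1) VR by (simp add: sec.between_def)
  have bK: "sec.between K" using sK K(2) by (auto simp: sec.between_def)
  have bR: "sec.between R" using sR K(2) by (auto simp: sec.between_def)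
  have KV: "K \<noteq> V" using nV0(2,4) VV(2) by blast
  obtain j where j: "card V = card K * p ^ j" using sec.section_index[OF bK bV VV(1)] .
  obtain e where e: "card R = card V * p ^ e" using sec.section_index[OF bV bR VR] .
  have "p ^ c = p ^ (j + e)" using cR e j card_subgroup_pos[OF fin sK] by (simp add: power_add)
  hence cje: "c = j + e" using prime_gt_1_nat[OF p(1)] power_inject_exp by blast
  have KiV: "K \<inter> V0 = K \<inter> H" using nV0(2,4) by blast
  have sKH: "subgroup (K \<inter> H) G" using subgroups_Inter_pair[OF sK sH] .
  have "card V * card (K \<inter> H) = card K * card V0" using card_set_mult[OF sK sV0] unfolding V_def KiV .
  hence "card V0 = p ^ j * card (K \<inter> H)" using j card_subgroup_pos[OF fin sK] by simp
  moreover have "order (?H\<lparr>carrier := V0\<rparr> Mod (K \<inter> H)) * card (K \<inter> H) = card V0"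
    using sub_index[OF sKH sV0] nV0(2) by auto
  ultimately have ord: "order (?H\<lparr>carrier := V0\<rparr> Mod (K \<inter> H)) = p ^ j" using card_subgroup_pos[OF fin sKH] by simp
  have "j \<le> rank ?H"
  proof -
    let ?Z = "{k. \<exists>A B p. chief_factor ?H A B \<and> Factorial_Ring.prime (p::nat) \<and>
      order (?H\<lparr>carrier := A\<rparr> Mod B) = p ^ k}"
    \<comment> \<open>On the naturals a supremum bounds the members of a nonempty set only if the
      set is bounded; the bound comes from m < q^m \<le> |H|.\<close>
    have "m \<le> card H" if m: "m \<in> ?Z" for m
    proof -
      obtain A B q where ABq: "chief_factor ?H A B" "Factorial_Ring.prime (q::nat)" "order (?H\<lparr>carrier := A\<rparr> Mod B) = q ^ m"
        using m by blast
      have AB: "A \<lhd> ?H" "B \<lhd> ?H" "B \<subseteq> A" using ABq(1) by (auto simp: chief_factor_def)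
      have sA: "subgroup A G" "subgroup B G" "A \<subseteq> H"
        using incl_subgroup[OF sH] AB normal_imp_subgroup subgroup.subset[OF normal_imp_subgroup[OF AB(1)]] by auto
      have "q ^ m * card B = card A" using sub_index[OF sA(2,1) AB(3)] ABq(3) by simp
      hence "q ^ m \<le> card A" using card_subgroup_pos[OF fin sA(2)] by (metis dvd_imp_le dvd_triv_left card_subgroup_pos fin sA(1))
      moreover have "card A \<le> card H" using card_mono[OF finite_subgroup[OF fin sH] sA(3)] .
      moreover have "m < q ^ m" using power_gt_expt[of q m] prime_gt_1_nat[OF ABq(2)] by simp
      ultimately show ?thesis by linarith
    qed
    hence "bdd_above ?Z" by (auto simp: bdd_above_def)
    moreover have "j \<in> ?Z" using chief p(1) ord by blast
    ultimately show ?thesis unfolding rank_def by (intro cSup_upper)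
  qed
  hence jr: "j \<le> r" using r[OF H(1)] by simp
  hence ke: "k \<le> e" using cje ck by simp
  let ?N = "normalizer G V"
  have Vc: "V \<subseteq> carrier G" using subgroup.subset[OF sV] .
  have sN: "subgroup ?N G" using subgroup_normalizer[OF Vc] .
  have HN: "H \<subseteq> ?N"
  proof
    fix h assume h: "h \<in> H"
    have "h \<otimes> v \<otimes> inv h \<in> V" if v: "v \<in> V" for v
    proof -
      obtain a w where aw: "a \<in> K" "w \<in> V0" "v = a \<otimes> w" using v by (auto simp: V_def set_mult_def)
      have "h \<otimes> a \<otimes> inv h \<in> K" using normal_closed[OF K(1) Hc[OF h] aw(1)] .
      moreover have "h \<otimes> w \<otimes> inv h \<in> V0" using H.normal_closed[OF nV0(1), of h w] h aw(2) m_inv_consistent[OF sH h] by simp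
      moreover have "h \<otimes> v \<otimes> inv h = (h \<otimes> a \<otimes> inv h) \<otimes> (h \<otimes> w \<otimes> inv h)"
        using aw Kc Hc[OF h] subgroup.mem_carrier[OF sV0] by (simp add: group_simps)
      ultimately show ?thesis unfolding V_def set_mult_def by blast
    qed
    thus "h \<in> ?N" using mem_normalizer_iff[OF fin Vc] Hc[OF h] by blast
  qed
  have zN: "z \<in> ?N" if "z \<in> carrier G" "pi_elt G {q} z" "Factorial_Ring.prime q" "q \<notin> s" for z q
    using sec.intermediate_normalized[OF \<sigma> s qn nil bV e ke that] mem_normalizer_iff[OF fin Vc] that(1) by blast
  have "x \<in> ?N" if x: "x \<in> carrier G" "pi_elt G (-s) x" for x
    using mem_of_prime_power_elts[OF fin sN subgroup_self _ x] zN by blast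
  moreover have "x \<in> ?N" if x: "x \<in> carrier G" "pi_elt G s x" for x
  proof -
    \<comment> \<open>The normalizer contains every Sylow subgroup for a prime outside s, so its
      index is an s-number; it contains H, so its index is also prime to s. Hence it is 1.\<close>
    have "pi_num s (card (rcosets ?N))" unfolding pi_num_def
    proof (intro conjI allI impI index_pos[OF fin sN])
      fix q :: nat assume q: "Factorial_Ring.prime q" "q dvd card (rcosets ?N)"
      show "q \<in> s"
      proof (rule ccontr)
        assume qs: "q \<notin> s"
        obtain P a where P: "subgroup P G" "card P = q ^ a" "\<not> q dvd card (rcosets P)" using Sylow_exists[OF fin q(1)] .
        have "pi_num {q} (card P)" unfolding P(2) by (rule pi_num_prime_power[OF q(1)]) simp
        hence "P \<subseteq> ?N" using zN[OF _ pi_elt_of_card[OF P(1) fin] q(1) qs] subgroup.mem_carrier[OF P(1)] by blast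
        hence "q dvd card (rcosets P)" using index_dvd[OF fin sN P(1)] q(2) dvd_trans by blast
        thus False using P(3) by simp
      qed
    qed
    moreover have "pi_num (-s) (card (rcosets ?N))"
      by (rule pi_num_dvd[OF Hall_num(2)[OF fin H(2)] index_dvd[OF fin sN sH HN]])
    ultimately have "card (rcosets ?N) = 1" by (rule pi_num_both)
    hence "card ?N = card (carrier G)" using index_mult_card[OF fin sN] by simp
    hence "?N = carrier G" using card_subset_eq[OF fin subgroup.subset[OF sN]] by blast
    thus ?thesis using x by simp
  qed
  ultimately have "x \<in> ?N" if x: "x \<in> carrier G" for x
    using pi_elt_split[OF fin x, of s] subgroup.m_closed[OF sN] nat_pow_closed[OF x] by metis
  hence "?N = carrier G" using subgroup.subset[OF sN] by blast
  hence "V \<lhd> G" using normal_of_normalizer[OF fin sV] by simp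
  hence "V = R" using min[of V] VV(1) KV VR by blast
  hence "card R = card R * p ^ e" using e by metis
  hence "p ^ e = 1" using card_subgroup_pos[OF fin sR] by simp
  hence "e = 0" using prime_gt_1_nat[OF p(1)] by simp
  thus False using ke k by simp
qed

text \<open>The additive form avoids truncated subtraction; with
  \<open>m_sigma_q \<sigma> G = Suc k\<close> it reads rank G \<le> k + r - 1.\<close>

theorem rank_le_m_sigma_q:
  assumes fin: "finite (carrier G)" and \<sigma>: "primes_partition \<sigma>" and sol: "solvable G"
    and nonnil: "\<not> sigma_nilpotent \<sigma> G"
    and Hall: "complete_Hall_set \<sigma> G \<H>" and r: "\<And>H. H \<in> \<H> \<Longrightarrow> rank (G\<lparr>carrier := H\<rparr>) \<le> r"
  shows "rank G + 2 \<le> m_sigma_q \<sigma> G + r"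
proof -
  obtain k where k: "m_sigma_q \<sigma> G = Suc k" "\<And>M. n_maximal G (Suc k) M \<Longrightarrow> sigma_quasinormal \<sigma> G M"
    using threshold_least[OF fin, of "sigma_quasinormal \<sigma> G"] unfolding m_sigma_q_def by metis
  have nil: "n_maximal G k L \<Longrightarrow> sigma_residual \<sigma> G L = {\<one>}" for L
    using threshold_residual_trivial[OF fin \<sigma>, of "sigma_quasinormal \<sigma> G" k L] k(2) by blast
  \<comment> \<open>G is 0-maximal in itself, so k = 0 would make its residual trivial. Positivity
    also keeps \<open>k + r - 1\<close> from truncating.\<close>
  have k0: "k > 0"
  proof (rule ccontr)
    assume "\<not> k > 0"
    hence "sigma_residual \<sigma> G (carrier G) = {\<one>}" using nil[of "carrier G"] by simp
    thus False using sigma_nilpotent_of_trivial_residual[OF fin \<sigma>] nonnil by blast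
  qed
  let ?Z = "{c. \<exists>R K p. chief_factor G R K \<and> Factorial_Ring.prime (p::nat) \<and>
    order (G\<lparr>carrier := R\<rparr> Mod K) = p ^ c}"
  have bound: "c \<le> k + r - 1" if "c \<in> ?Z" for c
  proof -
    obtain R K p where "chief_factor G R K" "Factorial_Ring.prime (p::nat)" "order (G\<lparr>carrier := R\<rparr> Mod K) = p ^ c"
      using \<open>c \<in> ?Z\<close> by blast
    from chief_rank_le[OF fin \<sigma> sol Hall r k(2) nil k0 this] show ?thesis by simp
  qed
  have "rank G \<le> k + r - 1"
  proof (cases "?Z = {}")
    case True
    \<comment> \<open>Without chief factors of prime power order the rank is the supremum of the
      empty set, which is 0.\<close>
    thus ?thesis unfolding rank_def True by (simp add: Sup_nat_def)
  next
    case False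
    thus ?thesis unfolding rank_def using bound by (rule cSup_least)
  qed
  thus ?thesis using k(1) k0 by simp
qed

end

theorem theorem1p2:
  fixes \<sigma> :: "nat set set" and G :: "('a, 'b) monoid_scheme" and \<H> :: "'a set set"
  assumes "partition_on {p::nat. Factorial_Ring.prime p} \<sigma>"
    and "group G" and "finite (carrier G)"
    and "sigma_soluble \<sigma> G"
    and "complete_Hall_set \<sigma> G \<H>"
  shows "(solvable G \<and> \<not> sigma_nilpotent \<sigma> G \<longrightarrow>
            (\<forall>r::nat. (\<forall>H\<in>\<H>. rank (G\<lparr>carrier := H\<rparr>) \<le> r) \<longrightarrow>
               int (rank G) \<le> int (m_sigma_q \<sigma> G) + int r - 2)) \<and>
         sigma_nilpotent_length \<sigma> G \<le> m_sigma \<sigma> G \<and>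
         (solvable G \<and> \<not> sigma_nilpotent \<sigma> G \<longrightarrow>
            card (prime_factors (order G)) \<le> m_sigma \<sigma> G)"
proof (intro conjI impI allI)
  interpret group G using assms(2) .
  show "sigma_nilpotent_length \<sigma> G \<le> m_sigma \<sigma> G"
    using sigma_nilpotent_length_le_m_sigma assms(1,3,4) by blast
  show "card (prime_factors (order G)) \<le> m_sigma \<sigma> G" if "solvable G \<and> \<not> sigma_nilpotent \<sigma> G"
    using card_primes_le_m_sigma assms(1,3) that by blast
  show "int (rank G) \<le> int (m_sigma_q \<sigma> G) + int r - 2"
    if "solvable G \<and> \<not> sigma_nilpotent \<sigma> G" "\<forall>H\<in>\<H>. rank (G\<lparr>carrier := H\<rparr>) \<le> r" for r
    using rank_le_m_sigma_q[OF assms(3,1) _ _ assms(5), of r] that by fastforce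
qed

end
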